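(* Let $\Bbbk$ be a field, $G$ a group, and $X\subset G$ a finite subset that is a union of conjugacy classes of $G$ and generates $G$; regard $X$ as a rack via $x\vartriangleright y=xyx^{-1}$. Let $V=\bigoplus_{x\in X}V_x$ be a Yetter-Drinfeld module over $\Bbbk G$ with support exactly $X$ and with each $V_x=\Bbbk v_x$ one-dimensional, and let $c:V\otimes V\to V\otimes V$, $c(v_x\otimes v_y)=(x.v_y)\otimes v_x=q(x,y)\,v_{x\vartriangleright y}\otimes v_x$ with $q(x,y)\in\Bbbk^\times$, be its braiding. Assume that the Nichols algebra $B(V)$ has a full set of quadratic relations. Let $G_X$ be the enveloping group of $X$, let $Q_V$ be the quiver with one vertex and loops $v_x$ ($x\in X$), and view $B(V)$ as a subcoalgebra of the path coalgebra $\Bbbk Q_V$. Then: (a) $G_X$ is the universal coalgebra covering group $\tilde G$ of $B(V)$, i.e. $[v_x]\mapsto g_x$ ($x\in X$) defines a group isomorphism $\tilde G\to G_X$. (b) $B(V)\#\Bbbk G_X$, with the map $B(V)\#\Bbbk G_X\to B(V)$ given by $b\#g\mapsto b$ for $b\in B(V)$, $g\in G_X$, is the universal coalgebra covering of $B(V)\subset\Bbbk Q_V$. (c) The map $B(V)\#\Bbbk G_X\to B(V)\#\Bbbk G$, $b\#g\mapsto b\#\pi(g)$, where $\pi:G_X\to G$ is the surjective homomorphism $g_x\mapsto x$, is the universal Hopf covering of $B(V)\#\Bbbk G$.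
   Context: **Full set of quadratic relations.** Let $c$ also denote the bijection $X\times X\to X\times X$, $c(x,y)=(x\vartriangleright y,x)$. For a $c$-orbit $\mathcal O\subseteq X\times X$ put $V_{\mathcal O}=\sum_{(s,t)\in\mathcal O}V_s\otimes V_t\subseteq V\otimes V$. $B(V)$ has a *full set of quadratic relations* if $\ker(1+c)\cap V_{\mathcal O}\neq 0$ for every $c$-orbit $\mathcal O$ not of the form $\{(x,x)\}$. **Enveloping group.** $G_X$ is the group generated by $\{g_x\mid x\in X\}$ with relations $g_xg_y=g_{x\vartriangleright y}g_x$ for $x,y\in X$. $V$ is a Yetter-Drinfeld module over $\Bbbk G_X$ with $G_X$ acting through $\pi:G_X\to G$ and with coaction $v_x\mapsto g_x\otimes v_x$; it has the same braiding $c$. $B(V)\#\Bbbk G_X$ is the corresponding bosonization. **Path coalgebras.** The path coalgebra $\Bbbk Q$ of a quiver $Q$ has the paths as basis; a path is written $a_n\cdots a_1$ (source of $a_{i+1}$ = target of $a_i$), and the comultiplication is deconcatenation $\Delta(p)=\sum_{p=p_2p_1}p_2\otimes p_1$, including the trivial subpaths at the target and source. For $Q=Q_V$, $\Bbbk Q_V$ is identified with the cotensor coalgebra $C(V)=\bigoplus_{n\ge0}V^{\otimes n}$, with $v_{x_1}\otimes\cdots\otimes v_{x_n}$ corresponding to the path $v_{x_1}\cdots v_{x_n}$, and $B(V)=\bigoplus_n\operatorname{Im}\mathfrak S_n\subseteq\Bbbk Q_V$, where $\mathfrak S_n=\sum_{\sigma\in\mathbb S_n}\hat\sigma$ is the quantum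 symmetrizer ($\hat{\ }$ the Matsumoto section $\mathbb S_n\to\mathbb B_n$, the braid group acting via $c$). **Minimal elements.** Let $B\subseteq\Bbbk Q$ be a subcoalgebra containing all vertices and arrows. For vertices $x,y$, let $B(x,y)$ be the set of elements of $B$ that are linear combinations of paths from $x$ to $y$. An element $b=\sum_{i\in I}\lambda_ip_i\in B(x,y)$ (distinct paths $p_i$, nonzero $\lambda_i\in\Bbbk$, $|I|\ge2$) is *minimal* if $\sum_{i\in I'}\lambda_ip_i\notin B$ for every nonempty proper subset $I'\subset I$. Write $p\sim p'$ if $p,p'$ are two of the paths occurring in some minimal element. **Universal coalgebra covering group.** For $B=B(V)\subseteq\Bbbk Q_V$, $\pi_1(Q_V)$ is the free group on the classes $[v_x]$, $x\in X$, and $\tilde G$ is the quotient of $\pi_1(Q_V)$ by the normal subgroup $N(B)$ generated by all $[p]^{-1}[p']$ with $p\sim p'$, where $[v_{x_1}\cdots v_{x_n}]=[v_{x_1}]\cdots[v_{x_n}]$. **Galois coalgebra coverings.** A Galois covering of connected quivers $F:\tilde Q\to Q$ is the quotient map by a group acting freely on $\tilde Q$ by automorphisms, with $\tilde Q$ connected. Each path of $Q$ from $x$ lifts uniquely to a path of $\tilde Q$ starting at a given $\tilde x\in F^{-1}(x)$; lifts of minimal elements are defined linearly from a chosen $\tilde x$. For $B\subseteq\Bbbk Q$, let $\tilde B\subseteq\Bbbk\tilde Q$ be the span of all lifts of paths in $B$ and of minimal elements of $B$. The restriction $F:\tilde B\to B$ is a *Galois coalgebra covering* if for every minimal $b\in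 B(x,y)$ and every $\tilde x\in F^{-1}(x)$ there are a vertex $\tilde y$ of $\tilde Q$ and a minimal element $\tilde b\in\tilde B(\tilde x,\tilde y)$ with $F(\tilde b)=b$. A *universal coalgebra covering* of $B$ is a Galois coalgebra covering $F:\tilde B\to B$ such that for every Galois coalgebra covering $F':B'\to B$ there is a Galois coalgebra covering $E:\tilde B\to B'$ with $F=F'E$. As a coalgebra, $B(V)\#\Bbbk H$ (for $H$ a group over which $V$ is a Yetter-Drinfeld module, with $v_x$ of degree $h_x$) is the smash coproduct $B(V)\rtimes\Bbbk H$, with $\Delta(b\rtimes h)=\sum (b_{(1)}\rtimes (b_{(2)})_{(-1)}h)\otimes((b_{(2)})_{(0)}\rtimes h)$. It is viewed inside the path coalgebra of the quiver with vertex set $H$ and arrows $v_x\rtimes h:h\to h_xh$, the path $v_{x_1}\cdots v_{x_n}\rtimes h$ being the lift of $v_{x_1}\cdots v_{x_n}$ starting at $h$. **Hopf coverings.** Let $R\#\Bbbk H$ and $R\#\Bbbk G$ be coradically graded pointed Hopf algebras that are bosonizations of the same braided graded Hopf algebra $R$, and let $f:H\to G$ be a surjective group homomorphism. A Hopf algebra map $F:R\#\Bbbk H\to R\#\Bbbk G$ is a *Hopf covering* if $F(r\#h)=r\#f(h)$ for all $r\in R$, $h\in H$. Covering Hopf algebras are taken to be link-indecomposable (indecomposable as coalgebras; for $R=B(V)$ this means that $H$ is generated by the degrees of the homogeneous elements of $V$). A Hopf covering $F$ of $A$ is *universal* if for every Hopf covering $F':A'\to A$ there is a Hopf covering $E$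 with $F=F'E$. *)

theory Defs
  imports
    "HOL-Library.Poly_Mapping"
    "HOL-Combinatorics.Permutations"
    "HOL-Combinatorics.Orbits"
    "Graph_Theory.Digraph_Component"
    "HOL-Algebra.Coset"
    "HOL-Algebra.Generated_Groups"
    "HOL-Algebra.Bij"
begin

section \<open>Free vector spaces\<close>

text \<open>The vector space with basis a type (or a subset of a type) is rendered by the type
  \<open>'p \<Rightarrow>\<^sub>0 'k\<close> of finitely supported functions. Linear maps out of it are given by their
  values on the basis; the tensor product of the spaces with bases \<open>'p\<close> and \<open>'q\<close> is the
  space with basis \<open>'p \<times> 'q\<close>.\<close>

definition pm_scale :: "'k::field \<Rightarrow> ('p \<Rightarrow>\<^sub>0 'k) \<Rightarrow> ('p \<Rightarrow>\<^sub>0 'k)" where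
  "pm_scale c u = Poly_Mapping.map ((*) c) u"

lemma lookup_pm_scale: "Poly_Mapping.lookup (pm_scale c u) p = c * Poly_Mapping.lookup u p"
  unfolding pm_scale_def by (simp add: Poly_Mapping.map.rep_eq when_def)

interpretation pm: vector_space "pm_scale :: 'k::field \<Rightarrow> ('p \<Rightarrow>\<^sub>0 'k) \<Rightarrow> ('p \<Rightarrow>\<^sub>0 'k)"
  by unfold_locales
    (auto intro!: poly_mapping_eqI simp: lookup_pm_scale lookup_add algebra_simps)

abbreviation bas :: "'p \<Rightarrow> ('p \<Rightarrow>\<^sub>0 'k::field)" where
  "bas p \<equiv> Poly_Mapping.single p 1"

definition lin_ext :: "('p \<Rightarrow> ('q \<Rightarrow>\<^sub>0 'k::field)) \<Rightarrow> ('p \<Rightarrow>\<^sub>0 'k) \<Rightarrow> ('q \<Rightarrow>\<^sub>0 'k)" where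
  "lin_ext f u = (\<Sum>p\<in>Poly_Mapping.keys u. pm_scale (Poly_Mapping.lookup u p) (f p))"

definition tens :: "('p \<Rightarrow>\<^sub>0 'k::field) \<Rightarrow> ('q \<Rightarrow>\<^sub>0 'k) \<Rightarrow> ('p \<times> 'q \<Rightarrow>\<^sub>0 'k)" where
  "tens u v = lin_ext (\<lambda>p. lin_ext (\<lambda>q. bas (p, q)) v) u"


section \<open>Free groups and presentations\<close>

text \<open>Elements of the free group on \<open>X\<close> are reduced words; the letter \<open>(x, True)\<close> stands for
  \<open>x\<close> and \<open>(x, False)\<close> for its inverse.\<close>

definition letter_inv :: "'x \<times> bool \<Rightarrow> 'x \<times> bool" where
  "letter_inv a = (fst a, \<not> snd a)"

definition cons_red :: "'x \<times> bool \<Rightarrow> ('x \<times> bool) list \<Rightarrow> ('x \<times> bool) list" where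
  "cons_red a w = (case w of [] \<Rightarrow> [a] | b # w' \<Rightarrow> if b = letter_inv a then w' else a # w)"

definition free_group :: "'x set \<Rightarrow> ('x \<times> bool) list monoid" where
  "free_group X =
     \<lparr>carrier = {w. set w \<subseteq> X \<times> UNIV \<and> successively (\<lambda>a b. b \<noteq> letter_inv a) w},
      mult = foldr cons_red,
      one = []\<rparr>"

definition normal_closure :: "('a, 'm) monoid_scheme \<Rightarrow> 'a set \<Rightarrow> 'a set" where
  "normal_closure F S = \<Inter>{N. N \<lhd> F \<and> S \<subseteq> N}"

text \<open>The class in \<open>free_group X Mod N\<close> of the word \<open>x\<^sub>1\<dots>x\<^sub>n\<close> of generators is
  the coset of \<open>pos_word [x\<^sub>1,\<dots>,x\<^sub>n]\<close>.\<close>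

definition pos_word :: "'x list \<Rightarrow> ('x \<times> bool) list" where
  "pos_word w = map (\<lambda>x. (x, True)) w"

definition presented_group ::
    "'x set \<Rightarrow> ('x \<times> bool) list set \<Rightarrow> ('x \<times> bool) list set monoid" where
  "presented_group X S = free_group X Mod normal_closure (free_group X) S"

definition presented_gen ::
    "'x set \<Rightarrow> ('x \<times> bool) list set \<Rightarrow> 'x \<Rightarrow> ('x \<times> bool) list set" where
  "presented_gen X S x = normal_closure (free_group X) S #>\<^bsub>free_group X\<^esub> pos_word [x]"


section \<open>The conjugation rack and its enveloping group\<close>

definition conjugate :: "('g, 'm) monoid_scheme \<Rightarrow> 'g \<Rightarrow> 'g \<Rightarrow> 'g" where
  "conjugate G x y = x \<otimes>\<^bsub>G\<^esub> y \<otimes>\<^bsub>G\<^esub> inv\<^bsub>G\<^esub> x"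

definition rack_braiding :: "('g, 'm) monoid_scheme \<Rightarrow> 'g \<times> 'g \<Rightarrow> 'g \<times> 'g" where
  "rack_braiding G = (\<lambda>(x, y). (conjugate G x y, x))"

definition enveloping_relators :: "('g, 'm) monoid_scheme \<Rightarrow> 'g set \<Rightarrow> ('g \<times> bool) list set" where
  "enveloping_relators G X =
     {pos_word [x, y] \<otimes>\<^bsub>free_group X\<^esub> inv\<^bsub>free_group X\<^esub> pos_word [conjugate G x y, x]
       | x y. x \<in> X \<and> y \<in> X}"

definition enveloping_group ::
    "('g, 'm) monoid_scheme \<Rightarrow> 'g set \<Rightarrow> ('g \<times> bool) list set monoid" where
  "enveloping_group G X = presented_group X (enveloping_relators G X)"

definition enveloping_gen ::
    "('g, 'm) monoid_scheme \<Rightarrow> 'g set \<Rightarrow> 'g \<Rightarrow> ('g \<times> bool) list set" where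
  "enveloping_gen G X = presented_gen X (enveloping_relators G X)"

definition word_eval :: "('g, 'm) monoid_scheme \<Rightarrow> ('g \<times> bool) list \<Rightarrow> 'g" where
  "word_eval G w =
     foldr (\<lambda>(x, s) g. (if s then x else inv\<^bsub>G\<^esub> x) \<otimes>\<^bsub>G\<^esub> g) w \<one>\<^bsub>G\<^esub>"

text \<open>All words in a coset of the enveloping group have the same value in \<open>G\<close>.\<close>

definition enveloping_proj :: "('g, 'm) monoid_scheme \<Rightarrow> ('g \<times> bool) list set \<Rightarrow> 'g" where
  "enveloping_proj G C = the_elem (word_eval G ` C)"


section \<open>Yetter-Drinfeld structures\<close>

text \<open>A Yetter-Drinfeld structure over the group algebra of \<open>H\<close> on the vector space with basis
  \<open>(v\<^sub>x)\<close>, \<open>x \<in> X\<close>: \<open>yd_act D h x\<close> is \<open>h.v\<^sub>x\<close>, and \<open>yd_coact D x\<close> is the coaction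
  \<open>\<delta>(v\<^sub>x)\<close>, the basis vector \<open>h \<otimes> v\<^sub>y\<close> being \<open>bas (h, y)\<close>. The basis vectors are not required
  to be homogeneous.\<close>

record (overloaded) ('h, 'x, 'k) yd_struct =
  yd_act :: "'h \<Rightarrow> 'x \<Rightarrow> ('x \<Rightarrow>\<^sub>0 'k)"
  yd_coact :: "'x \<Rightarrow> ('h \<times> 'x \<Rightarrow>\<^sub>0 'k)"

definition yetter_drinfeld ::
    "('h, 'm) monoid_scheme \<Rightarrow> 'x set \<Rightarrow> ('h, 'x, 'k::field) yd_struct \<Rightarrow> bool" where
  "yetter_drinfeld H X D \<longleftrightarrow>
     group H \<and>
     (\<forall>h\<in>carrier H. \<forall>x\<in>X. Poly_Mapping.keys (yd_act D h x) \<subseteq> X) \<and>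
     (\<forall>x\<in>X. yd_act D \<one>\<^bsub>H\<^esub> x = bas x) \<and>
     (\<forall>g\<in>carrier H. \<forall>h\<in>carrier H. \<forall>x\<in>X.
        yd_act D (g \<otimes>\<^bsub>H\<^esub> h) x = lin_ext (yd_act D g) (yd_act D h x)) \<and>
     (\<forall>x\<in>X. Poly_Mapping.keys (yd_coact D x) \<subseteq> carrier H \<times> X) \<and>
     (\<forall>x\<in>X. lin_ext (\<lambda>(h, y). bas y) (yd_coact D x) = bas x) \<and>
     (\<forall>x\<in>X. lin_ext (\<lambda>(h, y). bas (h, h, y)) (yd_coact D x) =
        lin_ext (\<lambda>(h, y). lin_ext (\<lambda>(h', z). bas (h, h', z)) (yd_coact D y)) (yd_coact D x)) \<and>
     (\<forall>g\<in>carrier H. \<forall>x\<in>X.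
        lin_ext (yd_coact D) (yd_act D g x) =
        lin_ext (\<lambda>(h, y). lin_ext (\<lambda>z. bas (conjugate H g h, z)) (yd_act D g y)) (yd_coact D x))"

definition yd_braiding :: "('h, 'x, 'k::field) yd_struct \<Rightarrow> 'x \<Rightarrow> 'x \<Rightarrow> ('x \<times> 'x \<Rightarrow>\<^sub>0 'k)" where
  "yd_braiding D x y =
     lin_ext (\<lambda>(h, x'). lin_ext (\<lambda>y'. bas (y', x')) (yd_act D h y)) (yd_coact D x)"

definition yd_support :: "'x set \<Rightarrow> ('h, 'x, 'k::field) yd_struct \<Rightarrow> 'h set" where
  "yd_support X D = (\<Union>x\<in>X. fst ` Poly_Mapping.keys (yd_coact D x))"

text \<open>The diagonal action and coaction on the tensor powers; the word \<open>[x\<^sub>1,\<dots>,x\<^sub>n]\<close> stands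
  for \<open>v\<^bsub>x\<^sub>1\<^esub> \<otimes> \<dots> \<otimes> v\<^bsub>x\<^sub>n\<^esub>\<close>.\<close>

definition act_word ::
    "('h, 'x, 'k::field) yd_struct \<Rightarrow> 'h \<Rightarrow> 'x list \<Rightarrow> ('x list \<Rightarrow>\<^sub>0 'k)" where
  "act_word D h w =
     foldr (\<lambda>x t. lin_ext (\<lambda>y. lin_ext (\<lambda>u. bas (y # u)) t) (yd_act D h x)) w (bas [])"

definition coact_word ::
    "('h, 'm) monoid_scheme \<Rightarrow> ('h, 'x, 'k::field) yd_struct \<Rightarrow> 'x list \<Rightarrow> ('h \<times> 'x list \<Rightarrow>\<^sub>0 'k)" where
  "coact_word H D w =
     foldr (\<lambda>x t. lin_ext (\<lambda>(h, y). lin_ext (\<lambda>(h', u). bas (h \<otimes>\<^bsub>H\<^esub> h', y # u)) t) (yd_coact D x))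
       w (bas (\<one>\<^bsub>H\<^esub>, []))"


section \<open>Nichols algebras\<close>

text \<open>Throughout, \<open>c x y\<close> is the value of a braiding on \<open>v\<^sub>x \<otimes> v\<^sub>y\<close>. Permutations of
  \<open>{..<n}\<close> and positions in words are counted from \<open>0\<close>.\<close>

definition braid_at :: "('x \<Rightarrow> 'x \<Rightarrow> ('x \<times> 'x \<Rightarrow>\<^sub>0 'k::field)) \<Rightarrow> nat \<Rightarrow> 'x list \<Rightarrow> ('x list \<Rightarrow>\<^sub>0 'k)" where
  "braid_at c i w = lin_ext (\<lambda>(x, y). bas (w[i := x, Suc i := y])) (c (w ! i) (w ! Suc i))"

definition perm_of_expr :: "nat list \<Rightarrow> nat \<Rightarrow> nat" where
  "perm_of_expr is = foldr (\<lambda>i \<sigma>. transpose i (Suc i) \<circ> \<sigma>) is id"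

definition reduced_expr :: "nat \<Rightarrow> (nat \<Rightarrow> nat) \<Rightarrow> nat list \<Rightarrow> bool" where
  "reduced_expr n \<sigma> is \<longleftrightarrow>
     (\<forall>i\<in>set is. Suc i < n) \<and> perm_of_expr is = \<sigma> \<and>
     (\<forall>js. (\<forall>j\<in>set js. Suc j < n) \<and> perm_of_expr js = \<sigma> \<longrightarrow> length is \<le> length js)"

text \<open>The action of the Matsumoto lift of \<open>\<sigma>\<close>, which is independent of the chosen reduced
  expression.\<close>

definition matsumoto ::
    "('x \<Rightarrow> 'x \<Rightarrow> ('x \<times> 'x \<Rightarrow>\<^sub>0 'k::field)) \<Rightarrow> nat \<Rightarrow> (nat \<Rightarrow> nat) \<Rightarrow> ('x list \<Rightarrow>\<^sub>0 'k) \<Rightarrow> ('x list \<Rightarrow>\<^sub>0 'k)" where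
  "matsumoto c n \<sigma> = foldr (\<lambda>i T. lin_ext (braid_at c i) \<circ> T) (SOME is. reduced_expr n \<sigma> is) id"

definition quantum_symmetrizer ::
    "('x \<Rightarrow> 'x \<Rightarrow> ('x \<times> 'x \<Rightarrow>\<^sub>0 'k::field)) \<Rightarrow> nat \<Rightarrow> ('x list \<Rightarrow>\<^sub>0 'k) \<Rightarrow> ('x list \<Rightarrow>\<^sub>0 'k)" where
  "quantum_symmetrizer c n u = (\<Sum>\<sigma> | \<sigma> permutes {..<n}. matsumoto c n \<sigma> u)"

definition tensor_power :: "'x set \<Rightarrow> nat \<Rightarrow> ('x list \<Rightarrow>\<^sub>0 'k::field) set" where
  "tensor_power X n = {u. Poly_Mapping.keys u \<subseteq> {w. set w \<subseteq> X \<and> length w = n}}"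

definition nichols :: "('x \<Rightarrow> 'x \<Rightarrow> ('x \<times> 'x \<Rightarrow>\<^sub>0 'k::field)) \<Rightarrow> 'x set \<Rightarrow> ('x list \<Rightarrow>\<^sub>0 'k) set" where
  "nichols c X = pm.span (\<Union>n. quantum_symmetrizer c n ` tensor_power X n)"

text \<open>The product of the Nichols algebra, realized as the image of the quantum symmetrizers, is
  the quantum shuffle product.\<close>

definition quantum_shuffle ::
    "('x \<Rightarrow> 'x \<Rightarrow> ('x \<times> 'x \<Rightarrow>\<^sub>0 'k::field)) \<Rightarrow> 'x list \<Rightarrow> 'x list \<Rightarrow> ('x list \<Rightarrow>\<^sub>0 'k)" where
  "quantum_shuffle c u w =
     (\<Sum>\<sigma> | \<sigma> permutes {..<length u + length w} \<and>
            strict_mono_on {..<length u} \<sigma> \<and>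
            strict_mono_on {length u..<length u + length w} \<sigma>.
        matsumoto c (length u + length w) \<sigma> (bas (u @ w)))"

definition full_quadratic_relations ::
    "('g, 'm) monoid_scheme \<Rightarrow> 'g set \<Rightarrow> ('g \<Rightarrow> 'g \<Rightarrow> ('g \<times> 'g \<Rightarrow>\<^sub>0 'k::field)) \<Rightarrow> bool" where
  "full_quadratic_relations G X c \<longleftrightarrow>
     (\<forall>p\<in>X \<times> X. \<forall>Orb. Orb = orbit (rack_braiding G) p \<longrightarrow> \<not> (\<exists>x. Orb = {(x, x)}) \<longrightarrow>
        {u. u + lin_ext (\<lambda>(x, y). c x y) u = 0} \<inter> {u. Poly_Mapping.keys u \<subseteq> Orb} \<noteq> {0})"


section \<open>Path coalgebras\<close>

text \<open>Quivers are digraphs in the sense of \<^theory>\<open>Graph_Theory.Digraph\<close> (loops and parallel arcs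
  allowed). The path \<open>a\<^sub>n\<dots>a\<^sub>1\<close> with source \<open>x\<close> is \<open>(x, [a\<^sub>n,\<dots>,a\<^sub>1])\<close>; the arcs are
  listed as they are written, so the walk traverses the reversed list.\<close>

type_synonym ('v, 'a) path = "'v \<times> 'a list"

definition paths :: "('v, 'a) pre_digraph \<Rightarrow> 'v \<Rightarrow> 'v \<Rightarrow> ('v, 'a) path set" where
  "paths Q x y = {(x, as) | as. pre_digraph.awalk Q x (rev as) y}"

definition all_paths :: "('v, 'a) pre_digraph \<Rightarrow> ('v, 'a) path set" where
  "all_paths Q = (\<Union>x\<in>verts Q. \<Union>y\<in>verts Q. paths Q x y)"

definition path_coprod ::
    "('v, 'a) pre_digraph \<Rightarrow> ('v, 'a) path \<Rightarrow> (('v, 'a) path \<times> ('v, 'a) path \<Rightarrow>\<^sub>0 'k::field)" where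
  "path_coprod Q = (\<lambda>(x, as). \<Sum>i\<le>length as.
     bas ((pre_digraph.awlast Q x (rev (drop i as)), take i as), (x, drop i as)))"

definition full_subcoalgebra ::
    "('v, 'a) pre_digraph \<Rightarrow> (('v, 'a) path \<Rightarrow>\<^sub>0 'k::field) set \<Rightarrow> bool" where
  "full_subcoalgebra Q B \<longleftrightarrow>
     pm.subspace B \<and>
     (\<forall>b\<in>B. Poly_Mapping.keys b \<subseteq> all_paths Q) \<and>
     (\<forall>b\<in>B. lin_ext (path_coprod Q) b \<in> pm.span {tens b1 b2 | b1 b2. b1 \<in> B \<and> b2 \<in> B}) \<and>
     (\<forall>x\<in>verts Q. bas (x, []) \<in> B) \<and>
     (\<forall>a\<in>arcs Q. bas (tail Q a, [a]) \<in> B)"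

definition hom_space ::
    "('v, 'a) pre_digraph \<Rightarrow> (('v, 'a) path \<Rightarrow>\<^sub>0 'k::field) set \<Rightarrow> 'v \<Rightarrow> 'v \<Rightarrow>
     (('v, 'a) path \<Rightarrow>\<^sub>0 'k) set" where
  "hom_space Q B x y = {b \<in> B. Poly_Mapping.keys b \<subseteq> paths Q x y}"

definition minimal ::
    "('v, 'a) pre_digraph \<Rightarrow> (('v, 'a) path \<Rightarrow>\<^sub>0 'k::field) set \<Rightarrow> 'v \<Rightarrow> 'v \<Rightarrow>
     (('v, 'a) path \<Rightarrow>\<^sub>0 'k) \<Rightarrow> bool" where
  "minimal Q B x y b \<longleftrightarrow>
     b \<in> hom_space Q B x y \<and> card (Poly_Mapping.keys b) \<ge> 2 \<and>
     (\<forall>I. I \<noteq> {} \<and> I \<subset> Poly_Mapping.keys b \<longrightarrow>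
        (\<Sum>p\<in>I. Poly_Mapping.single p (Poly_Mapping.lookup b p)) \<notin> B)"

definition path_equiv ::
    "('v, 'a) pre_digraph \<Rightarrow> (('v, 'a) path \<Rightarrow>\<^sub>0 'k::field) set \<Rightarrow>
     ('v, 'a) path \<Rightarrow> ('v, 'a) path \<Rightarrow> bool" where
  "path_equiv Q B p p' \<longleftrightarrow>
     (\<exists>x y b. minimal Q B x y b \<and> p \<in> Poly_Mapping.keys b \<and> p' \<in> Poly_Mapping.keys b)"


section \<open>Coverings of quivers and of coalgebras\<close>

type_synonym ('v, 'a, 'w, 'b) quiver_map = "('v \<Rightarrow> 'w) \<times> ('a \<Rightarrow> 'b)"

definition quiver_morphism ::
    "('v, 'a) pre_digraph \<Rightarrow> ('v, 'a, 'w, 'b) quiver_map \<Rightarrow> ('w, 'b) pre_digraph \<Rightarrow> bool" where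
  "quiver_morphism Q' F Q \<longleftrightarrow>
     (\<forall>x\<in>verts Q'. fst F x \<in> verts Q) \<and>
     (\<forall>a\<in>arcs Q'. snd F a \<in> arcs Q \<and>
        tail Q (snd F a) = fst F (tail Q' a) \<and> head Q (snd F a) = fst F (head Q' a))"

definition quiver_auts :: "('v, 'a) pre_digraph \<Rightarrow> ('v, 'a, 'v, 'a) quiver_map set" where
  "quiver_auts Q =
     {\<phi> \<in> carrier (BijGroup (verts Q) \<times>\<times> BijGroup (arcs Q)). quiver_morphism Q \<phi> Q}"

text \<open>\<open>F\<close> is the quotient map by a group \<open>\<Gamma>\<close> of automorphisms acting freely.\<close>

definition galois_covering ::
    "('v, 'a) pre_digraph \<Rightarrow> ('v, 'a, 'w, 'b) quiver_map \<Rightarrow> ('w, 'b) pre_digraph \<Rightarrow> bool" where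
  "galois_covering Q' F Q \<longleftrightarrow>
     wf_digraph Q' \<and> wf_digraph Q \<and> connected Q' \<and> connected Q \<and>
     quiver_morphism Q' F Q \<and> fst F ` verts Q' = verts Q \<and> snd F ` arcs Q' = arcs Q \<and>
     (\<exists>\<Gamma>. subgroup \<Gamma> (BijGroup (verts Q') \<times>\<times> BijGroup (arcs Q')) \<and> \<Gamma> \<subseteq> quiver_auts Q' \<and>
        (\<forall>\<phi>\<in>\<Gamma>. (\<exists>x\<in>verts Q'. fst \<phi> x = x) \<longrightarrow>
           \<phi> = \<one>\<^bsub>BijGroup (verts Q') \<times>\<times> BijGroup (arcs Q')\<^esub>) \<and>
        (\<forall>x\<in>verts Q'. \<forall>y\<in>verts Q'. fst F x = fst F y \<longleftrightarrow> (\<exists>\<phi>\<in>\<Gamma>. y = fst \<phi> x)) \<and>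
        (\<forall>a\<in>arcs Q'. \<forall>b\<in>arcs Q'. snd F a = snd F b \<longleftrightarrow> (\<exists>\<phi>\<in>\<Gamma>. b = snd \<phi> a)))"

definition path_map :: "('v, 'a, 'w, 'b) quiver_map \<Rightarrow> ('v, 'a) path \<Rightarrow> ('w, 'b) path" where
  "path_map F = (\<lambda>(x, as). (fst F x, map (snd F) as))"

definition path_lin ::
    "('v, 'a, 'w, 'b) quiver_map \<Rightarrow> (('v, 'a) path \<Rightarrow>\<^sub>0 'k::field) \<Rightarrow> (('w, 'b) path \<Rightarrow>\<^sub>0 'k)" where
  "path_lin F = lin_ext (\<lambda>p. bas (path_map F p))"

definition lift_path ::
    "('v, 'a) pre_digraph \<Rightarrow> ('v, 'a, 'w, 'b) quiver_map \<Rightarrow> 'v \<Rightarrow> ('w, 'b) path \<Rightarrow> ('v, 'a) path" where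
  "lift_path Q' F x' p = (THE p'. p' \<in> all_paths Q' \<and> fst p' = x' \<and> path_map F p' = p)"

definition lift_elem ::
    "('v, 'a) pre_digraph \<Rightarrow> ('v, 'a, 'w, 'b) quiver_map \<Rightarrow> 'v \<Rightarrow>
     (('w, 'b) path \<Rightarrow>\<^sub>0 'k::field) \<Rightarrow> (('v, 'a) path \<Rightarrow>\<^sub>0 'k)" where
  "lift_elem Q' F x' = lin_ext (\<lambda>p. bas (lift_path Q' F x' p))"

definition lifted_coalgebra ::
    "('v, 'a) pre_digraph \<Rightarrow> ('v, 'a, 'w, 'b) quiver_map \<Rightarrow> ('w, 'b) pre_digraph \<Rightarrow>
     (('w, 'b) path \<Rightarrow>\<^sub>0 'k::field) set \<Rightarrow> (('v, 'a) path \<Rightarrow>\<^sub>0 'k) set" where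
  "lifted_coalgebra Q' F Q B = pm.span
     {lift_elem Q' F x' b | x' b. x' \<in> verts Q' \<and> (\<exists>y.
        (\<exists>p\<in>paths Q (fst F x') y. b = bas p \<and> b \<in> B) \<or> minimal Q B (fst F x') y b)}"

definition galois_coalgebra_covering ::
    "('v, 'a) pre_digraph \<Rightarrow> (('v, 'a) path \<Rightarrow>\<^sub>0 'k::field) set \<Rightarrow> ('v, 'a, 'w, 'b) quiver_map \<Rightarrow>
     ('w, 'b) pre_digraph \<Rightarrow> (('w, 'b) path \<Rightarrow>\<^sub>0 'k) set \<Rightarrow> bool" where
  "galois_coalgebra_covering Q' B' F Q B \<longleftrightarrow>
     full_subcoalgebra Q B \<and> galois_covering Q' F Q \<and> B' = lifted_coalgebra Q' F Q B \<and>
     (\<forall>x y b. minimal Q B x y b \<longrightarrow> (\<forall>x'\<in>verts Q'. fst F x' = x \<longrightarrow>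
        (\<exists>y'\<in>verts Q'. \<exists>b'. minimal Q' B' x' y' b' \<and> path_lin F b' = b)))"

text \<open>HOL does not quantify over types inside a formula: the two type arguments are the types of
  vertices and of arcs of the coverings against which universality is tested.\<close>

definition universal_coalgebra_covering ::
    "'u itself \<Rightarrow> 'c itself \<Rightarrow>
     ('v, 'a) pre_digraph \<Rightarrow> (('v, 'a) path \<Rightarrow>\<^sub>0 'k::field) set \<Rightarrow> ('v, 'a, 'w, 'b) quiver_map \<Rightarrow>
     ('w, 'b) pre_digraph \<Rightarrow> (('w, 'b) path \<Rightarrow>\<^sub>0 'k) set \<Rightarrow> bool" where
  "universal_coalgebra_covering _ _ Qt Bt F Q B \<longleftrightarrow>
     galois_coalgebra_covering Qt Bt F Q B \<and>
     (\<forall>(Q' :: ('u, 'c) pre_digraph) B' F'. galois_coalgebra_covering Q' B' F' Q B \<longrightarrow>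
        (\<exists>E. galois_coalgebra_covering Qt Bt E Q' B' \<and>
           (\<forall>b\<in>Bt. path_lin F b = path_lin F' (path_lin E b))))"


section \<open>The Nichols algebra in a path coalgebra\<close>

definition loop_quiver :: "'x set \<Rightarrow> (unit, 'x) pre_digraph" where
  "loop_quiver X = \<lparr>verts = {()}, arcs = X, tail = (\<lambda>_. ()), head = (\<lambda>_. ())\<rparr>"

definition word_path :: "('x list \<Rightarrow>\<^sub>0 'k::field) \<Rightarrow> ((unit, 'x) path \<Rightarrow>\<^sub>0 'k)" where
  "word_path = lin_ext (\<lambda>w. bas ((), w))"

definition nichols_paths ::
    "('x \<Rightarrow> 'x \<Rightarrow> ('x \<times> 'x \<Rightarrow>\<^sub>0 'k::field)) \<Rightarrow> 'x set \<Rightarrow> ((unit, 'x) path \<Rightarrow>\<^sub>0 'k) set" where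
  "nichols_paths c X = word_path ` nichols c X"

definition covering_relators ::
    "'x set \<Rightarrow> ((unit, 'x) path \<Rightarrow>\<^sub>0 'k::field) set \<Rightarrow> ('x \<times> bool) list set" where
  "covering_relators X B =
     {inv\<^bsub>free_group X\<^esub> pos_word (snd p) \<otimes>\<^bsub>free_group X\<^esub> pos_word (snd p')
       | p p'. path_equiv (loop_quiver X) B p p'}"

definition covering_group ::
    "'x set \<Rightarrow> ((unit, 'x) path \<Rightarrow>\<^sub>0 'k::field) set \<Rightarrow> ('x \<times> bool) list set monoid" where
  "covering_group X B = presented_group X (covering_relators X B)"

definition covering_gen ::
    "'x set \<Rightarrow> ((unit, 'x) path \<Rightarrow>\<^sub>0 'k::field) set \<Rightarrow> 'x \<Rightarrow> ('x \<times> bool) list set" where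
  "covering_gen X B = presented_gen X (covering_relators X B)"

text \<open>The quiver with vertex set \<open>H\<close> and arrows \<open>(x, h) : h \<rightarrow> d\<^sub>x h\<close>, and its projection to the
  loop quiver.\<close>

definition degree_quiver ::
    "('h, 'm) monoid_scheme \<Rightarrow> 'x set \<Rightarrow> ('x \<Rightarrow> 'h) \<Rightarrow> ('h, 'x \<times> 'h) pre_digraph" where
  "degree_quiver H X d =
     \<lparr>verts = carrier H, arcs = X \<times> carrier H, tail = snd, head = (\<lambda>(x, h). d x \<otimes>\<^bsub>H\<^esub> h)\<rparr>"

definition degree_proj :: "('h, 'x \<times> 'h, unit, 'x) quiver_map" where
  "degree_proj = ((\<lambda>_. ()), fst)"

text \<open>The basis vector \<open>(w, h)\<close> of a bosonization (see below) as a path, for homogeneous \<open>v\<^sub>x\<close> of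
  degree \<open>d x\<close>.\<close>

definition smash_path ::
    "('h, 'm) monoid_scheme \<Rightarrow> 'x set \<Rightarrow> ('x \<Rightarrow> 'h) \<Rightarrow>
     ('x list \<times> 'h \<Rightarrow>\<^sub>0 'k::field) \<Rightarrow> (('h, 'x \<times> 'h) path \<Rightarrow>\<^sub>0 'k)" where
  "smash_path H X d =
     lin_ext (\<lambda>(w, h). bas (lift_path (degree_quiver H X d) degree_proj h ((), w)))"


section \<open>Bosonizations and Hopf coverings\<close>

record (overloaded) ('p, 'k) bialg =
  bspace :: "('p \<Rightarrow>\<^sub>0 'k) set"
  bprod :: "('p \<Rightarrow>\<^sub>0 'k) \<Rightarrow> ('p \<Rightarrow>\<^sub>0 'k) \<Rightarrow> ('p \<Rightarrow>\<^sub>0 'k)"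
  bunit :: "'p \<Rightarrow>\<^sub>0 'k"
  bcoprod :: "('p \<Rightarrow>\<^sub>0 'k) \<Rightarrow> ('p \<times> 'p \<Rightarrow>\<^sub>0 'k)"
  bcounit :: "('p \<Rightarrow>\<^sub>0 'k) \<Rightarrow> 'k"

definition smash :: "('x list \<Rightarrow>\<^sub>0 'k::field) \<Rightarrow> 'h \<Rightarrow> ('x list \<times> 'h \<Rightarrow>\<^sub>0 'k)" where
  "smash r h = lin_ext (\<lambda>w. bas (w, h)) r"

text \<open>The smash product and coproduct
  \<open>(u # g)(w # h) = u (g.w) # gh\<close> and
  \<open>\<Delta>(w # h) = \<Sum> (w\<^sub>1 # (w\<^sub>2)\<^sub>(\<^sub>-\<^sub>1\<^sub>) h) \<otimes> ((w\<^sub>2)\<^sub>(\<^sub>0\<^sub>) # h)\<close>,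
  where the coproduct of words is deconcatenation and their product is the quantum shuffle
  product.\<close>

definition bosonization ::
    "('x \<Rightarrow> 'x \<Rightarrow> ('x \<times> 'x \<Rightarrow>\<^sub>0 'k::field)) \<Rightarrow> 'x set \<Rightarrow> ('h, 'm) monoid_scheme \<Rightarrow>
     ('h, 'x, 'k) yd_struct \<Rightarrow> ('x list \<times> 'h, 'k) bialg" where
  "bosonization c X H D =
     \<lparr>bspace = pm.span {smash r h | r h. r \<in> nichols c X \<and> h \<in> carrier H},
      bprod = (\<lambda>a b. lin_ext (\<lambda>(u, g). lin_ext (\<lambda>(w, h).
         lin_ext (\<lambda>w'. smash (quantum_shuffle c u w') (g \<otimes>\<^bsub>H\<^esub> h)) (act_word D g w)) b) a),
      bunit = bas ([], \<one>\<^bsub>H\<^esub>),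
      bcoprod = lin_ext (\<lambda>(w, h). \<Sum>i\<le>length w.
         lin_ext (\<lambda>(g, w'). bas ((take i w, g \<otimes>\<^bsub>H\<^esub> h), (w', h))) (coact_word H D (drop i w))),
      bcounit = (\<lambda>a. \<Sum>p\<in>Poly_Mapping.keys a. if fst p = [] then Poly_Mapping.lookup a p else 0)\<rparr>"

text \<open>A Hopf algebra map is a map of bialgebras (it then respects antipodes). The condition on
  coproducts is \<open>\<Delta> \<circ> F = (F \<otimes> F) \<circ> \<Delta>\<close>, with \<open>F\<close> only defined on the subspace \<open>bspace A\<close>.\<close>

definition hopf_map :: "(('p \<Rightarrow>\<^sub>0 'k::field) \<Rightarrow> ('q \<Rightarrow>\<^sub>0 'k)) \<Rightarrow> ('p, 'k) bialg \<Rightarrow> ('q, 'k) bialg \<Rightarrow> bool" where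
  "hopf_map F A A' \<longleftrightarrow>
     (\<forall>a\<in>bspace A. F a \<in> bspace A') \<and>
     (\<forall>a\<in>bspace A. \<forall>b\<in>bspace A. F (a + b) = F a + F b) \<and>
     (\<forall>t. \<forall>a\<in>bspace A. F (pm_scale t a) = pm_scale t (F a)) \<and>
     (\<forall>a\<in>bspace A. \<forall>b\<in>bspace A. F (bprod A a b) = bprod A' (F a) (F b)) \<and>
     F (bunit A) = bunit A' \<and>
     (\<forall>a\<in>bspace A. \<exists>ts. set ts \<subseteq> bspace A \<times> bspace A \<and>
        bcoprod A a = (\<Sum>(b, b')\<leftarrow>ts. tens b b') \<and>
        bcoprod A' (F a) = (\<Sum>(b, b')\<leftarrow>ts. tens (F b) (F b'))) \<and>
     (\<forall>a\<in>bspace A. bcounit A' (F a) = bcounit A a)"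

text \<open>A Yetter-Drinfeld structure inducing the braiding \<open>c\<close>; it realizes the braided Hopf algebra
  \<open>B(V)\<close>, which depends on \<open>c\<close> only.\<close>

definition realizes ::
    "('x \<Rightarrow> 'x \<Rightarrow> ('x \<times> 'x \<Rightarrow>\<^sub>0 'k::field)) \<Rightarrow> 'x set \<Rightarrow> ('h, 'm) monoid_scheme \<Rightarrow>
     ('h, 'x, 'k) yd_struct \<Rightarrow> bool" where
  "realizes c X H D \<longleftrightarrow>
     yetter_drinfeld H X D \<and> (\<forall>x\<in>X. \<forall>y\<in>X. yd_braiding D x y = c x y)"

definition link_indecomposable ::
    "'x set \<Rightarrow> ('h, 'm) monoid_scheme \<Rightarrow> ('h, 'x, 'k::field) yd_struct \<Rightarrow> bool" where
  "link_indecomposable X H D \<longleftrightarrow> generate H (yd_support X D) = carrier H"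

definition hopf_covering ::
    "('x \<Rightarrow> 'x \<Rightarrow> ('x \<times> 'x \<Rightarrow>\<^sub>0 'k::field)) \<Rightarrow> 'x set \<Rightarrow>
     ('h, 'm) monoid_scheme \<Rightarrow> ('h, 'x, 'k) yd_struct \<Rightarrow>
     ('g, 'n) monoid_scheme \<Rightarrow> ('g, 'x, 'k) yd_struct \<Rightarrow>
     (('x list \<times> 'h \<Rightarrow>\<^sub>0 'k) \<Rightarrow> ('x list \<times> 'g \<Rightarrow>\<^sub>0 'k)) \<Rightarrow> bool" where
  "hopf_covering c X H DH G DG F \<longleftrightarrow>
     realizes c X H DH \<and> realizes c X G DG \<and> link_indecomposable X H DH \<and>
     hopf_map F (bosonization c X H DH) (bosonization c X G DG) \<and>
     (\<exists>f\<in>epi H G. \<forall>r\<in>nichols c X. \<forall>h\<in>carrier H. F (smash r h) = smash r (f h))"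

text \<open>The type argument is the type of elements of the groups against which universality is
  tested.\<close>

definition universal_hopf_covering ::
    "'u itself \<Rightarrow> ('x \<Rightarrow> 'x \<Rightarrow> ('x \<times> 'x \<Rightarrow>\<^sub>0 'k::field)) \<Rightarrow> 'x set \<Rightarrow>
     ('h, 'm) monoid_scheme \<Rightarrow> ('h, 'x, 'k) yd_struct \<Rightarrow>
     ('g, 'n) monoid_scheme \<Rightarrow> ('g, 'x, 'k) yd_struct \<Rightarrow>
     (('x list \<times> 'h \<Rightarrow>\<^sub>0 'k) \<Rightarrow> ('x list \<times> 'g \<Rightarrow>\<^sub>0 'k)) \<Rightarrow> bool" where
  "universal_hopf_covering _ c X H DH G DG F \<longleftrightarrow>
     hopf_covering c X H DH G DG F \<and>
     (\<forall>(H' :: 'u monoid) D' F'. hopf_covering c X H' D' G DG F' \<longrightarrow>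
        (\<exists>E. hopf_covering c X H DH H' D' E \<and>
           (\<forall>a\<in>bspace (bosonization c X H DH). F a = F' (E a))))"

definition enveloping_yd ::
    "('g, 'm) monoid_scheme \<Rightarrow> 'g set \<Rightarrow> ('g, 'g, 'k::field) yd_struct \<Rightarrow>
     (('g \<times> bool) list set, 'g, 'k) yd_struct" where
  "enveloping_yd G X D =
     \<lparr>yd_act = (\<lambda>g. yd_act D (enveloping_proj G g)),
      yd_coact = (\<lambda>x. bas (enveloping_gen G X x, x))\<rparr>"

definition smash_map :: "('h \<Rightarrow> 'g) \<Rightarrow> ('x list \<times> 'h \<Rightarrow>\<^sub>0 'k::field) \<Rightarrow> ('x list \<times> 'g \<Rightarrow>\<^sub>0 'k)" where
  "smash_map f = lin_ext (\<lambda>(w, h). bas (w, f h))"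

end

theory Submission
  imports Defs
begin

text \<open>
  The braiding maps \<open>v\<^sub>x \<otimes> v\<^sub>y\<close> to a multiple of \<open>v\<^bsub>x \<triangleright> y\<^esub> \<otimes> v\<^sub>x\<close>. Hence every map \<open>d\<close> from \<open>X\<close> to a
  group with \<open>d x d y = d (x \<triangleright> y) d x\<close> grades the Nichols algebra by the degrees
  \<open>d x\<^sub>1 \<dots> d x\<^sub>n\<close> of words, and the enveloping group is the universal group of such degrees. All three
  statements compare this grading with the one by minimal elements.

  (a) A minimal element is homogeneous, since a homogeneous component is a partial sum that lies in
  the Nichols algebra. So all relators of the covering group hold in the enveloping group. For the
  converse, let \<open>u\<close> be a nonzero kernel vector of \<open>1 + c\<close> on a \<open>c\<close>-orbit. As \<open>c\<close> is a weighted cyclic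
  shift on the orbit, no coefficient of \<open>u\<close> vanishes, and the functional \<open>1 / u\<close> kills the image of
  \<open>1 + c\<close>, which is the degree two part of the Nichols algebra. Therefore no monomial of the orbit lies
  in the Nichols algebra (\<open>orbit_monomial_not_in_nichols\<close>), the element \<open>(1 + c)(v\<^sub>x \<otimes> v\<^sub>y)\<close> is minimal
  (\<open>quadratic_min_elem\<close>), and it yields the relation \<open>x y = (x \<triangleright> y) x\<close> of the enveloping group
  (\<open>covering_group_iso\<close>).

  (b) In a Galois covering \<open>Q\<close> of the loop quiver the arrows over each loop permute the vertices, and
  words lift uniquely to paths with a given source. For a coalgebra covering the lifts of a minimal
  element have a common target; by the quadratic minimal elements the enveloping group then acts on
  the vertices. The orbit map of a base point is a covering of \<open>Q\<close> by the degree quiver of the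
  enveloping group, the quotient by right translations with the stabilizer
  (\<open>universal_coalgebra_covering_degree_quiver\<close>). The lifted coalgebras correspond to each other because
  all of them are spanned by the lifts of elements of the Nichols algebra, with arbitrary source.

  (c) For a Hopf covering by a bosonization over \<open>H\<close>, comparing coproducts and using coassociativity
  shows that the vectors \<open>v\<^sub>x\<close> are homogeneous over \<open>H\<close>, of degrees \<open>d x\<close> above \<open>x\<close>
  (\<open>homogeneous_of_push_forward\<close>). The compatibility of action and coaction forces
  \<open>d x d y = d (x \<triangleright> y) d x\<close>, so there is a homomorphism from the enveloping group to \<open>H\<close>; it respects
  the actions because \<open>d x\<close> acts through the braiding (\<open>universal_hopf_covering_proj\<close>).

  Both (b) and (c) need that the Nichols algebra is closed under deconcatenation
  (\<open>nichols_coproduct\<close>). The quantum symmetrizer factors through the one of \<open>S\<^sub>k \<times> S\<^sub>m\<close>, because the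
  lengths of a permutation in this subgroup and of a shortest coset representative add, and because
  the braid of a permutation does not depend on the reduced expression (\<open>reduced_expr_unique\<close>,
  Matsumoto's theorem).
\<close>

section \<open>Linear extensions, tensors and restrictions\<close>

abbreviation supp :: "('p \<Rightarrow>\<^sub>0 'k::zero) \<Rightarrow> 'p set" where
  "supp \<equiv> Poly_Mapping.keys"

abbreviation coef :: "('p \<Rightarrow>\<^sub>0 'k::zero) \<Rightarrow> 'p \<Rightarrow> 'k" where
  "coef \<equiv> Poly_Mapping.lookup"

lemma lookup_lin_ext:
  "coef (lin_ext f u) r =
     (\<Sum>p\<in>supp u. coef u p * coef (f p) r)"
  unfolding lin_ext_def by (simp add: lookup_sum lookup_pm_scale)

lemma lin_ext_superset:
  assumes "finite S" "supp u \<subseteq> S"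
  shows "lin_ext f u = (\<Sum>p\<in>S. pm_scale (coef u p) (f p))"
  unfolding lin_ext_def using assms
  by (intro sum.mono_neutral_left) (auto simp: in_keys_iff)

lemma lin_ext_0 [simp]: "lin_ext f 0 = 0"
  by (simp add: lin_ext_def)

lemma lin_ext_add: "lin_ext f (u + v) = lin_ext f u + lin_ext f v"
proof -
  let ?S = "supp u \<union> supp v"
  have "supp (u + v) \<subseteq> ?S" by (rule Poly_Mapping.keys_add)
  then show ?thesis
    by (simp add: lin_ext_superset[of ?S] lookup_add pm.scale_left_distrib sum.distrib)
qed

lemma lin_ext_scale: "lin_ext f (pm_scale t u) = pm_scale t (lin_ext f u)"
proof -
  have "supp (pm_scale t u) \<subseteq> supp u"
    by (auto simp: in_keys_iff lookup_pm_scale)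
  then show ?thesis
    by (simp add: lin_ext_superset[of "supp u"] lookup_pm_scale pm.scale_sum_right)
qed

lemma lin_ext_sum: "lin_ext f (\<Sum>i\<in>A. u i) = (\<Sum>i\<in>A. lin_ext f (u i))"
  by (induction A rule: infinite_finite_induct) (auto simp: lin_ext_add)

lemma pm_scale_single [simp]: "pm_scale t (Poly_Mapping.single p s) = Poly_Mapping.single p (t * s)"
  by (rule poly_mapping_eqI) (simp add: lookup_pm_scale lookup_single when_def)

lemma lin_ext_single [simp]: "lin_ext f (Poly_Mapping.single p t) = pm_scale t (f p)"
  by (cases "t = 0") (simp_all add: lin_ext_def)

lemma lin_ext_cong:
  "(\<And>p. p \<in> supp u \<Longrightarrow> f p = g p) \<Longrightarrow> lin_ext f u = lin_ext g u"
  by (simp add: lin_ext_def)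

lemma lin_ext_lin_ext: "lin_ext f (lin_ext g u) = lin_ext (\<lambda>p. lin_ext f (g p)) u"
  by (simp add: lin_ext_def[of g] lin_ext_sum lin_ext_scale) (simp add: lin_ext_def)

lemma lin_ext_bas [simp]: "lin_ext bas u = u"
proof (rule poly_mapping_eqI)
  fix r
  have "coef (lin_ext bas u) r
      = (\<Sum>p\<in>supp u. if p = r then coef u r else 0)"
    unfolding lookup_lin_ext by (intro sum.cong) (auto simp: lookup_single when_def)
  then show "coef (lin_ext bas u) r = coef u r"
    by (simp add: in_keys_iff)
qed

lemma lin_ext_sum_fun: "lin_ext (\<lambda>p. \<Sum>i\<in>A. f i p) u = (\<Sum>i\<in>A. lin_ext (f i) u)"
  unfolding lin_ext_def pm.scale_sum_right by (rule sum.swap)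

lemma lin_ext_zero_fun [simp]: "lin_ext (\<lambda>p. 0) u = 0"
  by (simp add: lin_ext_def)

lemma keys_lin_ext:
  "supp (lin_ext f u) \<subseteq> (\<Union>p\<in>supp u. supp (f p))"
proof
  fix r assume "r \<in> supp (lin_ext f u)"
  then have "(\<Sum>p\<in>supp u. coef u p * coef (f p) r) \<noteq> 0"
    by (simp add: in_keys_iff lookup_lin_ext)
  then obtain p where "p \<in> supp u"
      "coef u p * coef (f p) r \<noteq> 0"
    by (meson sum.neutral)
  then show "r \<in> (\<Union>p\<in>supp u. supp (f p))"
    by (auto simp: in_keys_iff)
qed

lemma lin_ext_in_subspace:
  assumes "pm.subspace S" "\<And>p. p \<in> supp u \<Longrightarrow> f p \<in> S"
  shows "lin_ext f u \<in> S"
  unfolding lin_ext_def using assms by (intro pm.subspace_sum pm.subspace_scale) auto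

lemma lin_ext_span:
  assumes "u \<in> pm.span A" "pm.subspace S" "\<And>a. a \<in> A \<Longrightarrow> lin_ext f a \<in> S"
  shows "lin_ext f u \<in> S"
  using assms(1)
proof (induction rule: pm.span_induct_alt)
  case base
  then show ?case using assms(2) by (simp add: pm.subspace_0)
next
  case (step c x y)
  then show ?case using assms
    by (auto simp: lin_ext_add lin_ext_scale intro!: pm.subspace_add pm.subspace_scale)
qed

lemma lin_ext_span_eq:
  assumes "u \<in> pm.span A" "\<And>a. a \<in> A \<Longrightarrow> lin_ext f a = lin_ext g a"
  shows "lin_ext f u = lin_ext g u"
  using assms(1)
proof (induction rule: pm.span_induct_alt)
  case base
  then show ?case by simp
next
  case (step c x y)
  then show ?case using assms by (simp add: lin_ext_add lin_ext_scale)
qed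

lemma subspace_keys_subset: "pm.subspace {u :: 'p \<Rightarrow>\<^sub>0 'k::field. supp u \<subseteq> S}"
proof (rule pm.subspaceI)
  fix x y :: "'p \<Rightarrow>\<^sub>0 'k"
  assume "x \<in> {u. supp u \<subseteq> S}" "y \<in> {u. supp u \<subseteq> S}"
  then show "x + y \<in> {u. supp u \<subseteq> S}"
    using Poly_Mapping.keys_add[of x y] by auto
qed (auto simp: in_keys_iff lookup_pm_scale)

lemma lookup_lin_ext_inj:
  assumes "inj_on h (supp u \<union> {p})"
  shows "coef (lin_ext (\<lambda>p. bas (h p)) u) (h p) = coef u p"
proof -
  have "coef (lin_ext (\<lambda>p. bas (h p)) u) (h p)
      = (\<Sum>p'\<in>supp u. if p' = p then coef u p else 0)"
    unfolding lookup_lin_ext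
  proof (rule sum.cong)
    fix p' assume "p' \<in> supp u"
    then have "h p' = h p \<longleftrightarrow> p' = p" using assms inj_on_eq_iff[of h _ p' p] by blast
    then show "coef u p' * coef (bas (h p')) (h p)
        = (if p' = p then coef u p else 0)"
      by (simp add: lookup_single when_def)
  qed simp
  also have "\<dots> = coef u p"
    by (simp add: in_keys_iff)
  finally show ?thesis .
qed

lemma keys_lin_ext_inj:
  assumes "inj_on h (supp u)"
  shows "supp (lin_ext (\<lambda>p. bas (h p)) u) = h ` supp u"
proof
  show "supp (lin_ext (\<lambda>p. bas (h p)) u) \<subseteq> h ` supp u"
    using keys_lin_ext[of "\<lambda>p. bas (h p)" u] by auto
  show "h ` supp u \<subseteq> supp (lin_ext (\<lambda>p. bas (h p)) u)"
  proof
    fix r assume "r \<in> h ` supp u"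
    then obtain p where p: "p \<in> supp u" "r = h p" by blast
    then have "supp u \<union> {p} = supp u" by blast
    then have "coef (lin_ext (\<lambda>p. bas (h p)) u) (h p) = coef u p"
      using lookup_lin_ext_inj[of h u p] assms by simp
    then show "r \<in> supp (lin_ext (\<lambda>p. bas (h p)) u)"
      using p by (simp add: in_keys_iff)
  qed
qed

text \<open>The component of a vector along the basis elements with property \<open>P\<close>. The partial sums in the
  definition of minimal elements and the homogeneous components for a grading are of this form.\<close>

definition part :: "('p \<Rightarrow> bool) \<Rightarrow> ('p \<Rightarrow>\<^sub>0 'k::field) \<Rightarrow> ('p \<Rightarrow>\<^sub>0 'k)" where
  "part P = lin_ext (\<lambda>p. if P p then bas p else 0)"

lemma lookup_part: "coef (part P u) p = (if P p then coef u p else 0)"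
proof -
  have "coef (part P u) p
      = (\<Sum>p'\<in>supp u. if p' = p \<and> P p then coef u p else 0)"
    unfolding part_def lookup_lin_ext
    by (intro sum.cong) (auto simp: lookup_single when_def)
  then show ?thesis
    by (cases "P p") (simp_all add: in_keys_iff)
qed

lemma keys_part: "supp (part P u) = {p \<in> supp u. P p}"
  by (auto simp: in_keys_iff lookup_part split: if_splits)

lemma part_eq_sum:
  assumes "I \<subseteq> supp u"
  shows "(\<Sum>p\<in>I. Poly_Mapping.single p (coef u p)) = part (\<lambda>p. p \<in> I) u"
proof (rule poly_mapping_eqI)
  fix r
  have "finite I" using finite_subset[OF assms] by simp
  moreover have "coef (\<Sum>p\<in>I. Poly_Mapping.single p (coef u p)) r
      = (\<Sum>p\<in>I. if p = r then coef u r else 0)"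
    unfolding lookup_sum by (intro sum.cong) (auto simp: lookup_single when_def)
  ultimately show "coef (\<Sum>p\<in>I. Poly_Mapping.single p (coef u p)) r
      = coef (part (\<lambda>p. p \<in> I) u) r"
    by (simp add: lookup_part)
qed

lemma part_all: "(\<And>p. p \<in> supp u \<Longrightarrow> P p) \<Longrightarrow> part P u = u"
  by (rule poly_mapping_eqI) (auto simp: lookup_part in_keys_iff)

lemma part_none: "(\<And>p. p \<in> supp u \<Longrightarrow> \<not> P p) \<Longrightarrow> part P u = 0"
  by (rule poly_mapping_eqI) (auto simp: lookup_part in_keys_iff)

text \<open>For a grading \<open>d\<close> of the basis, taking the component of degree \<open>z\<close> fixes or kills each of the
  homogeneous elements in \<open>A\<close>.\<close>

lemma part_span_homogeneous:
  assumes "u \<in> pm.span A"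
    and "\<And>a p p'. a \<in> A \<Longrightarrow> p \<in> supp a \<Longrightarrow> p' \<in> supp a \<Longrightarrow> d p = d p'"
  shows "part (\<lambda>p. d p = z) u \<in> pm.span A"
  unfolding part_def
proof (rule lin_ext_span[OF assms(1) pm.subspace_span])
  fix a assume a: "a \<in> A"
  have "part (\<lambda>p. d p = z) a = a \<or> part (\<lambda>p. d p = z) a = 0"
    using assms(2)[OF a] part_all[of a "\<lambda>p. d p = z"] part_none[of a "\<lambda>p. d p = z"] by metis
  then show "lin_ext (\<lambda>p. if d p = z then bas p else 0) a \<in> pm.span A"
    using a by (auto simp: part_def[symmetric] intro: pm.span_base pm.span_zero)
qed

lemma lookup_tens: "coef (tens u v) (p, q) = coef u p * coef v q"
proof -
  have 1: "coef (lin_ext (\<lambda>q. bas (p', q)) v) (p, q)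
      = (if p' = p then coef v q else 0)" for p'
  proof (cases "p' = p")
    case True
    then show ?thesis using lookup_lin_ext_inj[of "\<lambda>q. (p, q)" v q] by (simp add: inj_on_def)
  next
    case False
    then show ?thesis by (simp add: lookup_lin_ext lookup_single when_def)
  qed
  have "coef (tens u v) (p, q) = (\<Sum>p'\<in>supp u.
      if p' = p then coef u p * coef v q else 0)"
    unfolding tens_def lookup_lin_ext[of _ u] 1 by (intro sum.cong) auto
  then show ?thesis
    by (simp add: in_keys_iff)
qed

lemma tens_add_left: "tens (u + u') v = tens u v + tens u' v"
  by (rule poly_mapping_eqI) (auto simp: lookup_tens lookup_add algebra_simps)

lemma tens_add_right: "tens u (v + v') = tens u v + tens u v'"
  by (rule poly_mapping_eqI) (auto simp: lookup_tens lookup_add algebra_simps)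

lemma tens_scale_left: "tens (pm_scale t u) v = pm_scale t (tens u v)"
  by (rule poly_mapping_eqI) (auto simp: lookup_tens lookup_pm_scale algebra_simps)

lemma tens_scale_right: "tens u (pm_scale t v) = pm_scale t (tens u v)"
  by (rule poly_mapping_eqI) (auto simp: lookup_tens lookup_pm_scale algebra_simps)

lemma tens_0_left [simp]: "tens 0 v = 0"
  by (rule poly_mapping_eqI) (auto simp: lookup_tens)

lemma tens_0_right [simp]: "tens u 0 = 0"
  by (rule poly_mapping_eqI) (auto simp: lookup_tens)

lemma tens_bas [simp]: "tens (bas p) (bas q) = bas (p, q)"
  by (simp add: tens_def)

lemma tens_sum_left: "tens (\<Sum>i\<in>A. u i) v = (\<Sum>i\<in>A. tens (u i) v)"
  by (induction A rule: infinite_finite_induct) (auto simp: tens_add_left)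

lemma tens_sum_right: "tens v (\<Sum>i\<in>A. u i) = (\<Sum>i\<in>A. tens v (u i))"
  by (induction A rule: infinite_finite_induct) (auto simp: tens_add_right)

lemma lin_ext_tens: "lin_ext f (tens u v) = lin_ext (\<lambda>p. lin_ext (\<lambda>q. f (p, q)) v) u"
  by (simp add: tens_def lin_ext_lin_ext)

lemma lin_ext_tens_prod:
  fixes f :: "'p \<Rightarrow> ('r \<Rightarrow>\<^sub>0 'k::field)"
  shows "lin_ext (\<lambda>(p, q). tens (f p) (g q)) (tens u v) = tens (lin_ext f u) (lin_ext g v)"
proof -
  have "lin_ext (\<lambda>q. tens w (g q)) v = tens w (lin_ext g v)" for w :: "'r \<Rightarrow>\<^sub>0 'k"
    by (simp add: lin_ext_def tens_sum_right tens_scale_right)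
  then have "lin_ext (\<lambda>(p, q). tens (f p) (g q)) (tens u v) = lin_ext (\<lambda>p. tens (f p) (lin_ext g v)) u"
    by (simp add: lin_ext_tens)
  then show ?thesis
    by (simp add: lin_ext_def[of _ u] tens_sum_left tens_scale_left)
qed

lemma tens_in_span:
  assumes "u \<in> pm.span A" "v \<in> pm.span B"
  shows "tens u v \<in> pm.span {tens a b | a b. a \<in> A \<and> b \<in> B}" (is "_ \<in> pm.span ?T")
  using assms(1)
proof (induction rule: pm.span_induct_alt)
  case base
  then show ?case by (simp add: pm.span_zero)
next
  case (step t a y)
  have "tens a v \<in> pm.span ?T"
    using assms(2)
  proof (induction rule: pm.span_induct_alt)
    case base
    then show ?case by (simp add: pm.span_zero)
  next
    case (step s b z)
    then have "tens a b \<in> ?T" using \<open>a \<in> A\<close> by blast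
    then show ?case using step
      by (simp add: tens_add_right tens_scale_right pm.span_add pm.span_scale pm.span_base)
  qed
  then show ?case using step by (simp add: tens_add_left tens_scale_left pm.span_add pm.span_scale)
qed

section \<open>Groups given by generators and relators\<close>

lemma letter_inv_inv [simp]: "letter_inv (letter_inv a) = a"
  by (simp add: letter_inv_def)

lemma fst_letter_inv [simp]: "fst (letter_inv a) = fst a"
  by (simp add: letter_inv_def)

abbreviation reduced :: "('x \<times> bool) list \<Rightarrow> bool" where
  "reduced \<equiv> successively (\<lambda>a b. b \<noteq> letter_inv a)"

lemma cons_red_Nil [simp]: "cons_red a [] = [a]"
  by (simp add: cons_red_def)

lemma cons_red_Cons: "cons_red a (b # w) = (if b = letter_inv a then w else a # b # w)"
  by (simp add: cons_red_def)

lemma reduced_cons_red: "reduced w \<Longrightarrow> reduced (cons_red a w)"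
  by (cases w) (auto simp: cons_red_Cons successively_Cons)

lemma set_cons_red: "set (cons_red a w) \<subseteq> insert a (set w)"
  by (cases w) (auto simp: cons_red_Cons)

lemma cons_red_reduced: "reduced (a # w) \<Longrightarrow> cons_red a w = a # w"
  by (cases w) (auto simp: cons_red_Cons)

lemma cons_red_cancel: "reduced w \<Longrightarrow> cons_red a (cons_red (letter_inv a) w) = w"
  by (cases w) (auto simp: cons_red_Cons cons_red_reduced)

lemma reduced_mult: "reduced w \<Longrightarrow> reduced (foldr cons_red v w)"
  by (induction v) (auto simp: reduced_cons_red)

lemma set_mult: "set (foldr cons_red v w) \<subseteq> set v \<union> set w"
  by (induction v) (use set_cons_red in fastforce)+

text \<open>Prepending a letter acts on reduced words by a bijection whose inverse prepends the inverse
  letter. Associativity of the multiplication of reduced words rests on this.\<close>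

lemma mult_cons_red:
  assumes "reduced v" "reduced w"
  shows "foldr cons_red (cons_red a v) w = cons_red a (foldr cons_red v w)"
proof (cases v)
  case (Cons b v')
  then show ?thesis
    using assms cons_red_cancel[of "foldr cons_red v' w" a]
    by (auto simp: cons_red_Cons reduced_mult successively_Cons)
qed simp

lemma mult_reduced_assoc:
  assumes "reduced v" "reduced w"
  shows "foldr cons_red (foldr cons_red u v) w = foldr cons_red u (foldr cons_red v w)"
  by (induction u) (use assms in \<open>auto simp: mult_cons_red reduced_mult\<close>)

definition word_inv :: "('x \<times> bool) list \<Rightarrow> ('x \<times> bool) list" where
  "word_inv w = rev (map letter_inv w)"

lemma word_inv_mult: "reduced v \<Longrightarrow> foldr cons_red (word_inv w) (foldr cons_red w v) = v"
proof (induction w arbitrary: v)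
  case (Cons a w)
  have "foldr cons_red (word_inv (a # w)) (foldr cons_red (a # w) v)
      = foldr cons_red (word_inv w) (cons_red (letter_inv a) (cons_red a (foldr cons_red w v)))"
    by (simp add: word_inv_def)
  then show ?case
    using Cons cons_red_cancel[of "foldr cons_red w v" "letter_inv a"] by (simp add: reduced_mult)
qed (simp add: word_inv_def)

lemma mult_Nil_reduced: "reduced w \<Longrightarrow> foldr cons_red w [] = w"
proof (induction w)
  case (Cons a w)
  then have "foldr cons_red w [] = w" by (cases w) auto
  then show ?case using Cons.prems by (simp add: cons_red_reduced)
qed simp

lemma reduced_word_inv: "reduced w \<Longrightarrow> reduced (word_inv w)"
  unfolding word_inv_def by (simp add: successively_map) (erule successively_mono; force)

lemma free_group_carrier: "w \<in> carrier (free_group X) \<longleftrightarrow> set w \<subseteq> X \<times> UNIV \<and> reduced w"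
  by (simp add: free_group_def)

lemma free_group_simps [simp]:
  "mult (free_group X) = foldr cons_red" "one (free_group X) = []"
  by (simp_all add: free_group_def)

lemma group_free_group: "group (free_group X)"
proof (rule groupI)
  fix u v w assume "u \<in> carrier (free_group X)" "v \<in> carrier (free_group X)" "w \<in> carrier (free_group X)"
  then show "u \<otimes>\<^bsub>free_group X\<^esub> v \<otimes>\<^bsub>free_group X\<^esub> w = u \<otimes>\<^bsub>free_group X\<^esub> (v \<otimes>\<^bsub>free_group X\<^esub> w)"
    by (simp add: free_group_carrier mult_reduced_assoc)
next
  fix w assume w: "w \<in> carrier (free_group X)"
  have "foldr cons_red (word_inv w) (foldr cons_red w []) = []"
    by (rule word_inv_mult) simp
  moreover have "foldr cons_red w [] = w"
    using w by (intro mult_Nil_reduced) (simp add: free_group_carrier)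
  moreover have "word_inv w \<in> carrier (free_group X)"
  proof -
    have "set (word_inv w) = letter_inv ` set w"
      by (simp add: word_inv_def)
    moreover have "letter_inv ` set w \<subseteq> X \<times> UNIV"
      using w unfolding free_group_carrier letter_inv_def by fastforce
    ultimately show ?thesis
      using w reduced_word_inv[of w] by (simp add: free_group_carrier)
  qed
  ultimately show "\<exists>v\<in>carrier (free_group X). v \<otimes>\<^bsub>free_group X\<^esub> w = \<one>\<^bsub>free_group X\<^esub>"
    by auto
next
  fix u v assume "u \<in> carrier (free_group X)" "v \<in> carrier (free_group X)"
  then show "u \<otimes>\<^bsub>free_group X\<^esub> v \<in> carrier (free_group X)"
    using set_mult[of u v] by (auto simp: free_group_carrier reduced_mult)
qed (auto simp: free_group_carrier)

lemma free_group_letter: "a \<in> X \<times> UNIV \<Longrightarrow> [a] \<in> carrier (free_group X)"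
  by (simp add: free_group_carrier)

lemma pos_word_carrier: "set w \<subseteq> X \<Longrightarrow> pos_word w \<in> carrier (free_group X)"
  by (induction w) (auto simp: free_group_carrier pos_word_def successively_Cons letter_inv_def hd_map)

lemma mult_letter_word:
  "a # w \<in> carrier (free_group X) \<Longrightarrow> a # w = [a] \<otimes>\<^bsub>free_group X\<^esub> w"
  by (simp add: free_group_carrier cons_red_reduced)

lemma inv_letter:
  assumes "a \<in> X \<times> UNIV"
  shows "inv\<^bsub>free_group X\<^esub> [a] = [letter_inv a]"
proof -
  interpret F: group "free_group X" by (rule group_free_group)
  have "[letter_inv a] \<in> carrier (free_group X)"
    using assms by (intro free_group_letter) (auto simp: letter_inv_def)
  moreover have "[letter_inv a] \<otimes>\<^bsub>free_group X\<^esub> [a] = \<one>\<^bsub>free_group X\<^esub>"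
    by (simp add: cons_red_Cons)
  ultimately show ?thesis
    using F.inv_equality free_group_letter[OF assms] by metis
qed

lemma (in group) normal_Inter:
  assumes "\<N> \<noteq> {}" "\<And>N. N \<in> \<N> \<Longrightarrow> N \<lhd> G"
  shows "\<Inter>\<N> \<lhd> G"
proof -
  have "subgroup (\<Inter>\<N>) G"
    using assms by (intro subgroups_Inter) (auto simp: normal_imp_subgroup)
  moreover have "x \<otimes> h \<otimes> inv x \<in> \<Inter>\<N>" if "x \<in> carrier G" "h \<in> \<Inter>\<N>" for x h
    using that assms(2) by (auto intro: normal.inv_op_closed2)
  ultimately show ?thesis by (simp add: normal_inv_iff)
qed

lemma (in group) normal_normal_closure:
  assumes "S \<subseteq> carrier G"
  shows "normal_closure G S \<lhd> G"
proof -
  have "carrier G \<lhd> G" by (simp add: normal_inv_iff subgroup_self)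
  then show ?thesis
    unfolding normal_closure_def using assms by (intro normal_Inter) auto
qed

lemma normal_closure_superset: "S \<subseteq> normal_closure G S"
  unfolding normal_closure_def by blast

lemma normal_closure_least: "N \<lhd> G \<Longrightarrow> S \<subseteq> N \<Longrightarrow> normal_closure G S \<subseteq> N"
  unfolding normal_closure_def by blast

definition word_value :: "('h, 'm) monoid_scheme \<Rightarrow> ('x \<Rightarrow> 'h) \<Rightarrow> ('x \<times> bool) list \<Rightarrow> 'h" where
  "word_value H d w =
     foldr (\<lambda>(x, s) g. (if s then d x else inv\<^bsub>H\<^esub> d x) \<otimes>\<^bsub>H\<^esub> g) w \<one>\<^bsub>H\<^esub>"

text \<open>The elements of a presented group are cosets. If \<open>d\<close> respects the relators, then all words of
  a coset have the same value, and this value is chosen.\<close>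

definition presented_map :: "('h, 'm) monoid_scheme \<Rightarrow> ('x \<Rightarrow> 'h) \<Rightarrow> ('x \<times> bool) list set \<Rightarrow> 'h" where
  "presented_map H d C = the_elem (word_value H d ` C)"

lemma enveloping_proj_eq: "enveloping_proj G = presented_map G id"
  by (rule ext) (simp add: enveloping_proj_def presented_map_def word_value_def word_eval_def[abs_def]
    case_prod_unfold cong: if_cong)

definition word_degree :: "('h, 'm) monoid_scheme \<Rightarrow> ('x \<Rightarrow> 'h) \<Rightarrow> 'x list \<Rightarrow> 'h" where
  "word_degree H d w = foldr (\<lambda>x g. d x \<otimes>\<^bsub>H\<^esub> g) w \<one>\<^bsub>H\<^esub>"

lemma word_degree_simps [simp]:
  "word_degree H d [] = \<one>\<^bsub>H\<^esub>" "word_degree H d (x # w) = d x \<otimes>\<^bsub>H\<^esub> word_degree H d w"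
  by (simp_all add: word_degree_def)

lemma word_value_simps [simp]:
  "word_value H d [] = \<one>\<^bsub>H\<^esub>"
  "word_value H d (a # w) = (if snd a then d (fst a) else inv\<^bsub>H\<^esub> d (fst a)) \<otimes>\<^bsub>H\<^esub> word_value H d w"
  by (simp_all add: word_value_def case_prod_unfold)

lemma word_value_pos_word: "word_value H d (pos_word w) = word_degree H d w"
  by (induction w) (simp_all add: pos_word_def)

text \<open>A map from the generators to a group. The relations that it satisfies are left open: such a map
  describes a homomorphism from the free group, and it grades the words over \<open>X\<close>.\<close>

locale generator_map = group H for H (structure) +
  fixes X :: "'x set" and d :: "'x \<Rightarrow> 'a"
  assumes d_closed: "x \<in> X \<Longrightarrow> d x \<in> carrier H"
begin

lemma word_value_closed: "set w \<subseteq> X \<times> UNIV \<Longrightarrow> word_value H d w \<in> carrier H"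
  by (induction w) (auto simp: d_closed)

lemma word_degree_closed: "set w \<subseteq> X \<Longrightarrow> word_degree H d w \<in> carrier H"
  by (induction w) (auto simp: d_closed)

lemma word_degree_append:
  "set u \<subseteq> X \<Longrightarrow> set w \<subseteq> X \<Longrightarrow> word_degree H d (u @ w) = word_degree H d u \<otimes> word_degree H d w"
  by (induction u) (auto simp: d_closed word_degree_closed m_assoc)

lemma word_value_cons_red:
  assumes "a \<in> X \<times> UNIV" "set w \<subseteq> X \<times> UNIV"
  shows "word_value H d (cons_red a w) = word_value H d [a] \<otimes> word_value H d w"
proof (cases w)
  case Nil
  then show ?thesis using assms d_closed by auto
next
  case (Cons b w')
  have c: "d (fst a) \<in> carrier H" "word_value H d w' \<in> carrier H"
    using assms Cons d_closed word_value_closed by auto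
  show ?thesis
  proof (cases "b = letter_inv a")
    case True
    then show ?thesis using c Cons
      by (auto simp: cons_red_Cons letter_inv_def m_assoc[symmetric])
  next
    case False
    have "d (fst b) \<in> carrier H" using assms Cons d_closed by auto
    then show ?thesis using False c Cons
      by (auto simp: cons_red_Cons m_assoc)
  qed
qed

lemma word_value_mult:
  "set v \<subseteq> X \<times> UNIV \<Longrightarrow> set w \<subseteq> X \<times> UNIV \<Longrightarrow>
     word_value H d (foldr cons_red v w) = word_value H d v \<otimes> word_value H d w"
proof (induction v)
  case (Cons a v)
  have "set (foldr cons_red v w) \<subseteq> X \<times> UNIV" using Cons.prems set_mult[of v w] by auto
  then have "word_value H d (foldr cons_red (a # v) w)
      = word_value H d [a] \<otimes> (word_value H d v \<otimes> word_value H d w)"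
    using Cons word_value_cons_red[of a "foldr cons_red v w"] by simp
  moreover have "word_value H d v \<in> carrier H" "word_value H d w \<in> carrier H"
      "word_value H d [a] \<in> carrier H"
    using Cons.prems word_value_closed[of v] word_value_closed[of w] word_value_closed[of "[a]"] by auto
  ultimately show ?case
    using Cons.prems d_closed by (auto simp: m_assoc[symmetric])
qed (simp add: word_value_closed)

lemma word_value_hom: "word_value H d \<in> hom (free_group X) H"
  by (rule homI) (auto simp: free_group_carrier word_value_closed word_value_mult)

end

lemma presented_group_carrier:
  "carrier (presented_group X S) = rcosets\<^bsub>free_group X\<^esub> (normal_closure (free_group X) S)"
  by (simp add: presented_group_def FactGroup_def)

locale presentation =
  fixes X :: "'x set" and S :: "('x \<times> bool) list set"
  assumes relators: "S \<subseteq> carrier (free_group X)"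
begin

abbreviation "F \<equiv> free_group X"
abbreviation "N \<equiv> normal_closure F S"
abbreviation "P \<equiv> presented_group X S"
abbreviation cls where "cls w \<equiv> N #>\<^bsub>F\<^esub> w"

sublocale F: group F by (rule group_free_group)
sublocale N: normal N F by (rule F.normal_normal_closure[OF relators])
sublocale P: group P unfolding presented_group_def by (rule N.factorgroup_is_group)

lemma cls_hom: "cls \<in> hom F P"
  unfolding presented_group_def by (rule N.r_coset_hom_Mod)

lemma cls_closed: "w \<in> carrier F \<Longrightarrow> cls w \<in> carrier P"
  by (rule hom_in_carrier[OF cls_hom])

lemma cls_surj: "C \<in> carrier P \<Longrightarrow> \<exists>w\<in>carrier F. C = cls w"
  by (auto simp: presented_group_carrier RCOSETS_def)

lemma cls_mult: "v \<in> carrier F \<Longrightarrow> w \<in> carrier F \<Longrightarrow> cls (v \<otimes>\<^bsub>F\<^esub> w) = cls v \<otimes>\<^bsub>P\<^esub> cls w"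
  by (rule hom_mult[OF cls_hom])

lemma cls_one: "cls [] = \<one>\<^bsub>P\<^esub>"
  using hom_one[OF cls_hom F.is_group P.is_group] by simp

lemma cls_inv: "w \<in> carrier F \<Longrightarrow> cls (inv\<^bsub>F\<^esub> w) = inv\<^bsub>P\<^esub> cls w"
proof -
  interpret group_hom F P cls
    by (simp add: group_hom_def group_hom_axioms_def F.is_group P.is_group cls_hom)
  show "w \<in> carrier F \<Longrightarrow> cls (inv\<^bsub>F\<^esub> w) = inv\<^bsub>P\<^esub> cls w" by simp
qed

abbreviation "gen \<equiv> presented_gen X S"

lemma gen_eq: "gen x = cls [(x, True)]"
  by (simp add: presented_gen_def pos_word_def)

lemma gen_closed: "x \<in> X \<Longrightarrow> gen x \<in> carrier P"
  unfolding gen_eq by (rule cls_closed) (simp add: free_group_letter)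

sublocale gen: generator_map P X gen
  by unfold_locales (rule gen_closed)

lemma cls_eq_word_value: "w \<in> carrier F \<Longrightarrow> cls w = word_value P gen w"
proof (induction w)
  case (Cons a w)
  have w: "w \<in> carrier F" and a: "a \<in> X \<times> UNIV"
    using Cons.prems by (auto simp: free_group_carrier successively_Cons)
  obtain x s where xs: "a = (x, s)" by force
  have "cls [(x, False)] = inv\<^bsub>P\<^esub> gen x"
    using cls_inv[of "[(x, True)]"] inv_letter[of "(x, True)" X] a xs
    by (simp add: gen_eq letter_inv_def free_group_letter)
  then have "cls [a] = (if s then gen x else inv\<^bsub>P\<^esub> gen x)"
    using xs by (simp add: gen_eq)
  moreover have "cls (a # w) = cls [a] \<otimes>\<^bsub>P\<^esub> cls w"
    using cls_mult[OF free_group_letter[OF a] w] mult_letter_word[OF Cons.prems] by simp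
  ultimately show ?case using Cons.IH[OF w] xs by simp
qed (simp add: cls_one)

lemma generation_induct [consumes 1, case_names one gen inv]:
  assumes "C \<in> carrier P"
    and "Q \<one>\<^bsub>P\<^esub>"
    and "\<And>x C. x \<in> X \<Longrightarrow> C \<in> carrier P \<Longrightarrow> Q C \<Longrightarrow> Q (gen x \<otimes>\<^bsub>P\<^esub> C)"
    and "\<And>x C. x \<in> X \<Longrightarrow> C \<in> carrier P \<Longrightarrow> Q C \<Longrightarrow> Q (inv\<^bsub>P\<^esub> gen x \<otimes>\<^bsub>P\<^esub> C)"
  shows "Q C"
proof -
  have "Q (word_value P gen w)" if "set w \<subseteq> X \<times> UNIV" for w
    using that
  proof (induction w)
    case (Cons a w)
    then show ?case
      using assms(3)[of "fst a" "word_value P gen w"] assms(4)[of "fst a" "word_value P gen w"]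
      by (auto simp: gen.word_value_closed)
  qed (simp add: assms(2))
  then show ?thesis
    using cls_surj[OF assms(1)] cls_eq_word_value by (metis free_group_carrier)
qed

lemma relator_value:
  assumes "s \<in> S"
  shows "word_value P gen s = \<one>\<^bsub>P\<^esub>"
proof -
  have s: "s \<in> carrier F" using relators assms by (rule subsetD)
  have "s \<in> N" by (rule subsetD[OF normal_closure_superset assms])
  then have "cls s = N" by (intro F.coset_join2[OF s] N.is_subgroup)
  then show ?thesis using cls_eq_word_value[OF s] by (simp add: presented_group_def FactGroup_def)
qed

text \<open>The universal property: the kernel of the homomorphism on the free group is normal, so with the
  relators it contains their normal closure.\<close>

context
  fixes H :: "('h, 'm) monoid_scheme" and d
  assumes H: "generator_map H X d" and kills: "\<And>s. s \<in> S \<Longrightarrow> word_value H d s = \<one>\<^bsub>H\<^esub>"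
begin

interpretation H: generator_map H X d by (rule H)

lemma presented_map_cls:
  assumes "w \<in> carrier F"
  shows "presented_map H d (cls w) = word_value H d w"
proof -
  interpret h: group_hom F H "word_value H d"
    by (simp add: group_hom_def group_hom_axioms_def F.is_group H.is_group H.word_value_hom)
  have "N \<subseteq> kernel F H (word_value H d)"
    by (rule normal_closure_least[OF h.normal_kernel]) (use relators kills in \<open>auto simp: kernel_def\<close>)
  then have "word_value H d v = word_value H d w" if "v \<in> cls w" for v
    using that assms by (auto simp: r_coset_def kernel_def simp del: free_group_simps)
  moreover have "w \<in> cls w" by (rule F.rcos_self[OF assms N.is_subgroup])
  ultimately have "word_value H d ` cls w = {word_value H d w}" by blast
  then show ?thesis by (simp add: presented_map_def)
qed

lemma presented_map_hom: "presented_map H d \<in> hom P H"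
proof (rule homI)
  fix C assume "C \<in> carrier P"
  then obtain w where w: "w \<in> carrier F" "C = cls w" using cls_surj by blast
  then have "word_value H d w \<in> carrier H" by (intro H.word_value_closed) (simp add: free_group_carrier)
  then show "presented_map H d C \<in> carrier H" using w by (simp only: presented_map_cls)
next
  fix C D assume "C \<in> carrier P" "D \<in> carrier P"
  then obtain v w where vw: "v \<in> carrier F" "w \<in> carrier F" "C = cls v" "D = cls w"
    using cls_surj by metis
  then show "presented_map H d (C \<otimes>\<^bsub>P\<^esub> D) = presented_map H d C \<otimes>\<^bsub>H\<^esub> presented_map H d D"
    using hom_mult[OF H.word_value_hom vw(1,2)] presented_map_cls[OF F.m_closed[OF vw(1,2)]]
    by (simp only: vw cls_mult presented_map_cls)
qed

lemma presented_map_gen: "x \<in> X \<Longrightarrow> presented_map H d (gen x) = d x"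
  unfolding gen_eq by (subst presented_map_cls) (auto simp: free_group_letter H.d_closed)

end

lemma hom_eq_on_gen:
  assumes "group H" "f \<in> hom P H" "f' \<in> hom P H" "\<And>x. x \<in> X \<Longrightarrow> f (gen x) = f' (gen x)"
    and "C \<in> carrier P"
  shows "f C = f' C"
proof -
  interpret f: group_hom P H f
    using assms(1,2) P.is_group by (intro group_hom.intro group_hom_axioms.intro)
  interpret f': group_hom P H f'
    using assms(1,3) P.is_group by (intro group_hom.intro group_hom_axioms.intro)
  show ?thesis
    using assms(5)
    by (induction rule: generation_induct) (simp_all add: gen_closed assms(4) del: free_group_simps)
qed

lemma generate_gen: "generate P (gen ` X) = carrier P"
proof
  show "generate P (gen ` X) \<subseteq> carrier P"
    by (rule P.generate_incl) (auto simp: gen_closed)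
  show "carrier P \<subseteq> generate P (gen ` X)"
  proof
    fix C assume "C \<in> carrier P"
    then show "C \<in> generate P (gen ` X)"
    proof (induction rule: generation_induct)
      case (gen x C)
      then show ?case by (intro generate.eng[OF generate.incl]) simp_all
    next
      case (inv x C)
      then show ?case by (intro generate.eng[OF generate.inv]) simp_all
    qed (rule generate.one)
  qed
qed

end

section \<open>Reduced expressions of permutations\<close>

definition invs :: "nat \<Rightarrow> (nat \<Rightarrow> nat) \<Rightarrow> (nat \<times> nat) set" where
  "invs n \<sigma> = {(a, b). a < b \<and> b < n \<and> \<sigma> b < \<sigma> a}"

abbreviation adj :: "nat \<Rightarrow> nat \<Rightarrow> nat" where
  "adj i \<equiv> transpose i (Suc i)"

text \<open>The notation \<open>inv\<close> is reserved for inverses in groups.\<close>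

abbreviation pinv :: "('a \<Rightarrow> 'a) \<Rightarrow> 'a \<Rightarrow> 'a" where
  "pinv \<equiv> inv_into UNIV"

abbreviation perms :: "nat \<Rightarrow> (nat \<Rightarrow> nat) set" where
  "perms n \<equiv> {\<sigma>. \<sigma> permutes {..<n}}"

lemma finite_invs [simp]: "finite (invs n \<sigma>)"
  by (rule finite_subset[of _ "{..<n} \<times> {..<n}"]) (auto simp: invs_def)

lemma invs_id: "invs n (\<lambda>a. a) = {}" "invs n id = {}"
  by (auto simp: invs_def)

lemma perm_of_expr_simps [simp]:
  "perm_of_expr [] = id" "perm_of_expr (i # is) = adj i \<circ> perm_of_expr is"
  by (simp_all add: perm_of_expr_def)

lemma perm_of_expr_append: "perm_of_expr (is @ js) = perm_of_expr is \<circ> perm_of_expr js"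
  by (induction "is") (simp_all add: o_assoc)

lemma adj_permutes: "Suc i < n \<Longrightarrow> adj i permutes {..<n}"
  by (rule permutes_swap_id) auto

lemma adj_comp_permutes: "\<sigma> permutes {..<n} \<Longrightarrow> Suc i < n \<Longrightarrow> adj i \<circ> \<sigma> permutes {..<n}"
  by (rule permutes_compose) (simp_all add: adj_permutes)

lemma adj_adj_comp [simp]: "adj i \<circ> (adj i \<circ> \<sigma>) = \<sigma>"
  by (simp add: o_assoc)

lemma perm_of_expr_permutes: "\<forall>i\<in>set is. Suc i < n \<Longrightarrow> perm_of_expr is permutes {..<n}"
  by (induction "is") (auto simp: adj_comp_permutes permutes_id)

lemma inv_adj_comp:
  assumes "\<sigma> permutes {..<n}"
  shows "pinv (adj i \<circ> \<sigma>) x = pinv \<sigma> (adj i x)"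
proof -
  have "bij \<sigma>" by (rule permutes_bij[OF assms])
  then have "pinv (adj i \<circ> \<sigma>) = pinv \<sigma> \<circ> pinv (adj i)" by (intro o_inv_distrib) simp_all
  then show ?thesis by simp
qed

text \<open>Multiplying with an adjacent transposition on the left exchanges the values \<open>i\<close> and
  \<open>i + 1\<close> and changes the order of no other pair of values.\<close>

lemma invs_adj_comp:
  assumes \<sigma>: "\<sigma> permutes {..<n}" and i: "Suc i < n" and less: "pinv \<sigma> i < pinv \<sigma> (Suc i)"
  shows "invs n (adj i \<circ> \<sigma>) = insert (pinv \<sigma> i, pinv \<sigma> (Suc i)) (invs n \<sigma>)"
    and "(pinv \<sigma> i, pinv \<sigma> (Suc i)) \<notin> invs n \<sigma>"
proof -
  have eq: "\<sigma> a = v \<longleftrightarrow> a = pinv \<sigma> v" for a v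
    using permutes_inverses[OF \<sigma>] by metis
  have r: "pinv \<sigma> (Suc i) < n" using permutes_in_image[OF permutes_inv[OF \<sigma>], of "Suc i"] i by simp
  show "(pinv \<sigma> i, pinv \<sigma> (Suc i)) \<notin> invs n \<sigma>"
    using permutes_inverses[OF \<sigma>] by (simp add: invs_def)
  have "adj i (\<sigma> b) < adj i (\<sigma> a) \<longleftrightarrow> (a, b) = (pinv \<sigma> i, pinv \<sigma> (Suc i)) \<or> \<sigma> b < \<sigma> a"
    if "a < b" for a b
  proof (cases "(a, b) = (pinv \<sigma> i, pinv \<sigma> (Suc i))")
    case True
    then show ?thesis using permutes_inverses[OF \<sigma>] by simp
  next
    case False
    then have "\<not> (\<sigma> a = i \<and> \<sigma> b = Suc i)" "\<not> (\<sigma> a = Suc i \<and> \<sigma> b = i)"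
      using eq that less by auto
    then have "adj i (\<sigma> b) < adj i (\<sigma> a) \<longleftrightarrow> \<sigma> b < \<sigma> a"
      by (auto simp: transpose_def)
    then show ?thesis using False by blast
  qed
  then show "invs n (adj i \<circ> \<sigma>) = insert (pinv \<sigma> i, pinv \<sigma> (Suc i)) (invs n \<sigma>)"
    using less r unfolding invs_def by auto
qed

lemma card_invs_ascent:
  assumes "\<sigma> permutes {..<n}" "Suc i < n" "pinv \<sigma> i < pinv \<sigma> (Suc i)"
  shows "card (invs n (adj i \<circ> \<sigma>)) = Suc (card (invs n \<sigma>))"
  using invs_adj_comp[OF assms] by simp

lemma card_invs_descent:
  assumes "\<sigma> permutes {..<n}" "Suc i < n" "pinv \<sigma> (Suc i) < pinv \<sigma> i"
  shows "card (invs n \<sigma>) = Suc (card (invs n (adj i \<circ> \<sigma>)))"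
  using card_invs_ascent[OF adj_comp_permutes[OF assms(1,2)] assms(2)] assms
  by (simp add: inv_adj_comp)

lemma inv_permutes_neq:
  assumes "\<sigma> permutes {..<n}"
  shows "pinv \<sigma> i \<noteq> pinv \<sigma> (Suc i)"
  by (metis n_not_Suc_n permutes_inverses(1)[OF assms])

lemma card_invs_adj_le:
  assumes "\<sigma> permutes {..<n}" "Suc i < n"
  shows "card (invs n (adj i \<circ> \<sigma>)) \<le> Suc (card (invs n \<sigma>))"
  using card_invs_ascent[OF assms] card_invs_descent[OF assms] inv_permutes_neq[OF assms(1), of i]
  by (cases "pinv \<sigma> i < pinv \<sigma> (Suc i)") auto

lemma card_invs_le_length:
  "\<forall>i\<in>set is. Suc i < n \<Longrightarrow> card (invs n (perm_of_expr is)) \<le> length is"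
proof (induction "is")
  case Nil
  show ?case by (simp add: invs_id)
next
  case (Cons i "is")
  then have "card (invs n (adj i \<circ> perm_of_expr is)) \<le> Suc (card (invs n (perm_of_expr is)))"
    by (intro card_invs_adj_le perm_of_expr_permutes) auto
  moreover have "card (invs n (perm_of_expr is)) \<le> length is" using Cons by simp
  ultimately have "card (invs n (adj i \<circ> perm_of_expr is)) \<le> length (i # is)" by simp
  then show ?case by (simp only: perm_of_expr_simps)
qed

lemma block_mono:
  fixes p :: "nat \<Rightarrow> nat"
  assumes "\<And>i. l \<le> i \<Longrightarrow> Suc i < h \<Longrightarrow> p i < p (Suc i)" "l \<le> i" "i < j" "j < h"
  shows "p i < p j"
  using assms(3,4)
proof (induction j)
  case (Suc j)
  then show ?case using assms(1)[of j] assms(2) by (cases "i = j") auto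
qed simp

text \<open>An increasing self-map of \<open>{..<n}\<close> satisfies \<open>a \<le> \<sigma> a\<close>; this applies to \<open>\<sigma>\<close> and its inverse.\<close>

lemma increasing_permutes_id:
  assumes \<sigma>: "\<sigma> permutes {..<n}" and asc: "\<And>i. Suc i < n \<Longrightarrow> pinv \<sigma> i < pinv \<sigma> (Suc i)"
  shows "\<sigma> = id"
proof -
  have less: "pinv \<sigma> i < pinv \<sigma> j" if "i < j" "j < n" for i j
    using block_mono[of 0 n "pinv \<sigma>" i j] asc that by blast
  have le: "a \<le> pinv \<sigma> a" if "a < n" for a
    using that
  proof (induction a)
    case (Suc a)
    then show ?case using asc[of a] by simp
  qed simp
  have "a \<le> \<sigma> a" if "a < n" for a
    using that
  proof (induction a)
    case (Suc a)
    have "\<sigma> (Suc a) < n" "\<sigma> a < n"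
      using permutes_in_image[OF \<sigma>, of "Suc a"] permutes_in_image[OF \<sigma>, of a] Suc.prems by auto
    moreover have "\<sigma> a \<noteq> \<sigma> (Suc a)" using permutes_inj[OF \<sigma>] by (metis n_not_Suc_n injD)
    ultimately have "\<sigma> a < \<sigma> (Suc a)"
      using less[of "\<sigma> (Suc a)" "\<sigma> a"] permutes_inverses(2)[OF \<sigma>] by (cases "\<sigma> a < \<sigma> (Suc a)") auto
    then show ?case using Suc by simp
  qed simp
  moreover have "\<sigma> a \<le> a" if "a < n" for a
    using le[of "\<sigma> a"] permutes_in_image[OF \<sigma>, of a] permutes_inverses(2)[OF \<sigma>, of a] that by simp
  ultimately have "\<sigma> a = a" for a
    using permutes_not_in[OF \<sigma>, of a] by (cases "a < n") (auto intro: antisym)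
  then show ?thesis by auto
qed

lemma reduced_expr_exists:
  "\<sigma> permutes {..<n} \<Longrightarrow>
     \<exists>is. (\<forall>i\<in>set is. Suc i < n) \<and> perm_of_expr is = \<sigma> \<and> length is = card (invs n \<sigma>)"
proof (induction "card (invs n \<sigma>)" arbitrary: \<sigma> rule: less_induct)
  case less
  show ?case
  proof (cases "\<exists>i. Suc i < n \<and> pinv \<sigma> (Suc i) < pinv \<sigma> i")
    case True
    then obtain i where i: "Suc i < n" "pinv \<sigma> (Suc i) < pinv \<sigma> i" by blast
    have c: "card (invs n \<sigma>) = Suc (card (invs n (adj i \<circ> \<sigma>)))"
      by (rule card_invs_descent[OF less.prems i])
    then obtain "is" where "\<forall>i\<in>set is. Suc i < n" "perm_of_expr is = adj i \<circ> \<sigma>"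
        "length is = card (invs n (adj i \<circ> \<sigma>))"
      using less.hyps[of "adj i \<circ> \<sigma>"] adj_comp_permutes[OF less.prems i(1)] by auto
    then show ?thesis using i c by (intro exI[of _ "i # is"]) simp
  next
    case False
    then have "pinv \<sigma> i < pinv \<sigma> (Suc i)" if "Suc i < n" for i
      using that inv_permutes_neq[OF less.prems, of i] by (metis linorder_neqE_nat)
    then have "\<sigma> = id" by (rule increasing_permutes_id[OF less.prems])
    then show ?thesis by (intro exI[of _ "[]"]) (simp add: invs_id)
  qed
qed

text \<open>The minimal length of an expression is the number of inversions: each letter adds at most one
  inversion, and multiplying with a descent removes one.\<close>

lemma reduced_expr_iff:
  assumes "\<sigma> permutes {..<n}"
  shows "reduced_expr n \<sigma> is \<longleftrightarrow>
    (\<forall>i\<in>set is. Suc i < n) \<and> perm_of_expr is = \<sigma> \<and> length is = card (invs n \<sigma>)"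
  using reduced_expr_exists[OF assms] card_invs_le_length unfolding reduced_expr_def
  by (metis le_antisym)

lemma reduced_expr_Cons:
  assumes "reduced_expr n \<sigma> (i # is)" "\<sigma> permutes {..<n}"
  shows "Suc i < n" "pinv \<sigma> (Suc i) < pinv \<sigma> i" "adj i \<circ> \<sigma> permutes {..<n}"
    "reduced_expr n (adj i \<circ> \<sigma>) is" "card (invs n \<sigma>) = Suc (length is)"
proof -
  have r: "\<forall>i\<in>set (i # is). Suc i < n" "adj i \<circ> perm_of_expr is = \<sigma>" "Suc (length is) = card (invs n \<sigma>)"
    using assms by (auto simp: reduced_expr_iff)
  then show i: "Suc i < n" by simp
  show p: "adj i \<circ> \<sigma> permutes {..<n}" by (rule adj_comp_permutes[OF assms(2) i])
  have e: "perm_of_expr is = adj i \<circ> \<sigma>" using r(2) by auto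
  then have "card (invs n (adj i \<circ> \<sigma>)) \<le> length is"
    using card_invs_le_length[of "is" n] r(1) by simp
  then show d: "pinv \<sigma> (Suc i) < pinv \<sigma> i"
    using card_invs_ascent[OF assms(2) i] r(3) inv_permutes_neq[OF assms(2), of i]
    by (metis Suc_n_not_le_n le_SucI linorder_neqE_nat)
  show "reduced_expr n (adj i \<circ> \<sigma>) is"
    using p e r card_invs_descent[OF assms(2) i d] by (simp add: reduced_expr_iff)
  show "card (invs n \<sigma>) = Suc (length is)" using r(3) by simp
qed

lemma reduced_expr_ConsI:
  assumes "\<sigma> permutes {..<n}" "Suc i < n" "pinv \<sigma> (Suc i) < pinv \<sigma> i" "reduced_expr n (adj i \<circ> \<sigma>) is"
  shows "reduced_expr n \<sigma> (i # is)"
  using assms card_invs_descent[OF assms(1-3)] adj_comp_permutes[OF assms(1,2)]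
  by (auto simp: reduced_expr_iff)

text \<open>The braid relations are required on an invariant set only: the braiding is of rack type for
  letters in \<open>X\<close>, and \<open>M\<close> will be a tensor power of the span of \<open>X\<close>.\<close>

locale braid_operators =
  fixes n :: nat and T :: "nat \<Rightarrow> 'm \<Rightarrow> 'm" and M :: "'m set"
  assumes T_closed: "Suc i < n \<Longrightarrow> u \<in> M \<Longrightarrow> T i u \<in> M"
    and T_comm: "Suc i < j \<Longrightarrow> Suc j < n \<Longrightarrow> u \<in> M \<Longrightarrow> T i (T j u) = T j (T i u)"
    and T_braid: "Suc (Suc i) < n \<Longrightarrow> u \<in> M \<Longrightarrow>
      T i (T (Suc i) (T i u)) = T (Suc i) (T i (T (Suc i) u))"
begin

lemma expr_closed: "\<forall>i\<in>set is. Suc i < n \<Longrightarrow> u \<in> M \<Longrightarrow> foldr T is u \<in> M"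
  by (induction "is") (auto simp: T_closed)

text \<open>Matsumoto's theorem. Two reduced expressions of \<open>\<sigma>\<close> that begin with different letters
  \<open>i < j\<close> are compared with reduced expressions that begin with the longest element of the
  subgroup generated by the two letters; both letters being descents of \<open>\<sigma>\<close>, that element can be
  split off.\<close>

lemma reduced_expr_unique:
  assumes "\<sigma> permutes {..<n}" "reduced_expr n \<sigma> is" "reduced_expr n \<sigma> js" "u \<in> M"
  shows "foldr T is u = foldr T js u"
  using assms(1-3)
proof (induction "length is" arbitrary: \<sigma> "is" js rule: less_induct)
  case less
  have len: "length is = length js" using less.prems by (simp add: reduced_expr_iff)
  have main: "T i (foldr T is' u) = T j (foldr T js' u)"
    if ij: "i < j" and e: "reduced_expr n \<sigma> (i # is')" "reduced_expr n \<sigma> (j # js')"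
      and l: "length is' < length is" for i j is' js'
  proof -
    note \<sigma> = less.prems(1)
    note I = reduced_expr_Cons[OF e(1) \<sigma>] and J = reduced_expr_Cons[OF e(2) \<sigma>]
    have l': "length js' < length is" using l I(5) J(5) by simp
    show ?thesis
    proof (cases "j = Suc i")
      case False
      then have far: "Suc i < j" using ij by simp
      then have fx: "adj i j = j" "adj i (Suc j) = Suc j" "adj j i = i" "adj j (Suc i) = Suc i"
        by (auto simp: transpose_def)
      let ?\<tau> = "adj j \<circ> (adj i \<circ> \<sigma>)"
      have comm: "adj i \<circ> (adj j \<circ> \<sigma>) = ?\<tau>"
        using far by (auto simp: fun_eq_iff transpose_def)
      have \<tau>: "?\<tau> permutes {..<n}" by (rule adj_comp_permutes[OF I(3) J(1)])
      then obtain t where t: "reduced_expr n ?\<tau> t" using reduced_expr_exists reduced_expr_iff by blast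
      have "reduced_expr n (adj i \<circ> \<sigma>) (j # t)"
        using I J t fx by (intro reduced_expr_ConsI) (simp_all add: inv_adj_comp[OF \<sigma>])
      then have 1: "foldr T is' u = foldr T (j # t) u" by (rule less.hyps[OF l I(3,4)])
      have "reduced_expr n (adj j \<circ> \<sigma>) (i # t)"
        using I J t fx comm by (intro reduced_expr_ConsI) (simp_all add: inv_adj_comp[OF \<sigma>])
      then have 2: "foldr T js' u = foldr T (i # t) u" by (rule less.hyps[OF l' J(3,4)])
      have "foldr T t u \<in> M"
        using t \<tau> assms(4) by (intro expr_closed) (auto simp: reduced_expr_iff)
      then show ?thesis using 1 2 T_comm[OF far J(1)] by simp
    next
      case True
      let ?\<sigma>1 = "adj i \<circ> \<sigma>" let ?\<sigma>2 = "adj j \<circ> ?\<sigma>1" let ?\<tau> = "adj i \<circ> ?\<sigma>2"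
      let ?\<rho>1 = "adj j \<circ> \<sigma>" let ?\<rho>2 = "adj i \<circ> ?\<rho>1"
      have fx: "adj i j = i" "adj i (Suc j) = Suc j" "adj j i = i" "adj j (Suc i) = Suc j"
        "adj j (Suc j) = j" "adj i i = j" "adj i (Suc i) = i" "adj j j = Suc j"
        using True by (auto simp: transpose_def)
      have braid: "adj j \<circ> ?\<rho>2 = ?\<tau>"
        using True by (auto simp: fun_eq_iff transpose_def)
      have p2: "?\<sigma>2 permutes {..<n}" "?\<rho>2 permutes {..<n}"
        using I J by (auto intro!: adj_comp_permutes)
      have \<tau>: "?\<tau> permutes {..<n}" by (rule adj_comp_permutes[OF p2(1) I(1)])
      then obtain t where t: "reduced_expr n ?\<tau> t" using reduced_expr_exists reduced_expr_iff by blast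
      have d: "pinv \<sigma> (Suc j) < pinv \<sigma> j" "pinv \<sigma> j < pinv \<sigma> i" using I(2) J(2) True by auto
      have "reduced_expr n ?\<sigma>2 (i # t)"
        by (rule reduced_expr_ConsI[OF p2(1) I(1) _ t])
          (simp only: inv_adj_comp[OF I(3)] inv_adj_comp[OF \<sigma>] fx d)
      then have "reduced_expr n ?\<sigma>1 (j # i # t)"
        by (rule reduced_expr_ConsI[OF I(3) J(1), rotated])
          (simp only: inv_adj_comp[OF \<sigma>] fx less_trans[OF d])
      then have 1: "foldr T is' u = foldr T (j # i # t) u" by (rule less.hyps[OF l I(3,4)])
      have "reduced_expr n ?\<rho>2 (j # t)"
        by (rule reduced_expr_ConsI[OF p2(2) J(1)])
          (simp_all only: inv_adj_comp[OF J(3)] inv_adj_comp[OF \<sigma>] fx d braid t)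
      then have "reduced_expr n ?\<rho>1 (i # j # t)"
        by (rule reduced_expr_ConsI[OF J(3) I(1), rotated])
          (simp only: inv_adj_comp[OF \<sigma>] fx less_trans[OF d])
      then have 2: "foldr T js' u = foldr T (i # j # t) u" by (rule less.hyps[OF l' J(3,4)])
      have "foldr T t u \<in> M"
        using t \<tau> assms(4) by (intro expr_closed) (auto simp: reduced_expr_iff)
      then show ?thesis using 1 2 T_braid[of i] J(1) True by simp
    qed
  qed
  show ?case
  proof (cases "is")
    case Nil
    then show ?thesis using len by simp
  next
    case i: (Cons i is')
    then obtain j js' where j: "js = j # js'" using len by (cases js) auto
    have I: "adj i \<circ> \<sigma> permutes {..<n}" "reduced_expr n (adj i \<circ> \<sigma>) is'"
      using reduced_expr_Cons less.prems i by blast+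
    have J: "reduced_expr n (adj j \<circ> \<sigma>) js'" using reduced_expr_Cons less.prems j by blast
    consider "i = j" | "i < j" | "j < i" by linarith
    then show ?thesis
    proof cases
      case 1
      then have "foldr T is' u = foldr T js' u" using less.hyps[OF _ I] J i by simp
      then show ?thesis using 1 i j by simp
    next
      case 2
      then show ?thesis using main[of i j is' js'] less.prems i j by simp
    next
      case 3
      then show ?thesis using main[of j i js' is'] less.prems i j len by simp
    qed
  qed
qed

end

section \<open>Parabolic decomposition of the symmetric group\<close>

text \<open>The subgroup \<open>S\<^sub>k \<times> S\<^sub>m\<close> of \<open>S\<^sub>n\<close>, for \<open>n = k + m\<close>, and the shortest representatives of its
  right cosets: those without left descent in the subgroup.\<close>

definition block_perms :: "nat \<Rightarrow> nat \<Rightarrow> (nat \<Rightarrow> nat) set" where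
  "block_perms n k = {\<pi>. \<pi> permutes {..<n} \<and> \<pi> ` {..<k} = {..<k}}"

definition coset_reps :: "nat \<Rightarrow> nat \<Rightarrow> (nat \<Rightarrow> nat) set" where
  "coset_reps n k = {\<tau>. \<tau> permutes {..<n} \<and>
     (\<forall>i. Suc i < n \<longrightarrow> Suc i \<noteq> k \<longrightarrow> pinv \<tau> i < pinv \<tau> (Suc i))}"

lemma block_perms_less_iff:
  assumes "\<pi> \<in> block_perms n k"
  shows "\<pi> x < k \<longleftrightarrow> x < k"
proof -
  have "inj \<pi>" using assms by (auto simp: block_perms_def permutes_inj)
  then have "\<pi> x \<in> \<pi> ` {..<k} \<longleftrightarrow> x \<in> {..<k}" by (rule inj_image_mem_iff)
  then show ?thesis using assms by (simp add: block_perms_def)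
qed

lemma block_perms_comp:
  assumes "\<pi> \<in> block_perms n k" "\<rho> \<in> block_perms n k"
  shows "\<pi> \<circ> \<rho> \<in> block_perms n k"
proof -
  have "(\<pi> \<circ> \<rho>) ` {..<k} = \<pi> ` \<rho> ` {..<k}" by (rule image_comp[symmetric])
  moreover have "\<pi> \<circ> \<rho> permutes {..<n}"
    using assms by (intro permutes_compose) (auto simp: block_perms_def)
  ultimately show ?thesis using assms by (simp add: block_perms_def)
qed

lemma block_perms_inv:
  assumes "\<pi> \<in> block_perms n k"
  shows "pinv \<pi> \<in> block_perms n k"
proof -
  have p: "\<pi> permutes {..<n}" using assms by (simp add: block_perms_def)
  have "pinv \<pi> ` \<pi> ` {..<k} = {..<k}" by (rule image_inv_f_f[OF permutes_inj[OF p]])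
  then show ?thesis using assms permutes_inv[OF p] by (simp add: block_perms_def)
qed

lemma adj_block_perms: "Suc i < n \<Longrightarrow> Suc i \<noteq> k \<Longrightarrow> adj i \<in> block_perms n k"
proof -
  assume a: "Suc i < n" "Suc i \<noteq> k"
  have "adj i ` {..<k} = {..<k}"
  proof (cases "Suc i < k")
    case True
    then show ?thesis by (intro permutes_image adj_permutes)
  next
    case False
    then have "adj i ` {..<k} = id ` {..<k}"
      using a(2) by (intro image_cong) (auto simp: transpose_def)
    then show ?thesis by simp
  qed
  then show ?thesis using a by (simp add: block_perms_def adj_permutes)
qed

lemma coset_reps_mono:
  assumes "\<tau> \<in> coset_reps n k" "i < j" "j < n" "j < k \<or> k \<le> i"
  shows "pinv \<tau> i < pinv \<tau> j"
proof -
  have asc: "pinv \<tau> x < pinv \<tau> (Suc x)" if "Suc x < n" "Suc x \<noteq> k" for x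
    using assms(1) that by (simp add: coset_reps_def)
  show ?thesis
  proof (cases "j < k")
    case True
    show ?thesis
      by (rule block_mono[of 0 "Suc j" "pinv \<tau>" i j]) (use True assms(2,3) in \<open>auto intro!: asc\<close>)
  next
    case False
    show ?thesis
      by (rule block_mono[of k n "pinv \<tau>" i j]) (use False assms(2-4) in \<open>auto intro!: asc\<close>)
  qed
qed

text \<open>A pair of positions whose \<open>\<tau>\<close>-values lie in different blocks is an inversion of \<open>\<pi> \<circ> \<tau>\<close> if and
  only if it is one of \<open>\<tau>\<close>, because \<open>\<pi>\<close> preserves the blocks. Within a block \<open>\<tau>\<close> has no inversions,
  and the inversions of \<open>\<pi> \<circ> \<tau>\<close> are those of \<open>\<pi>\<close>, transported by \<open>\<tau>\<close>.\<close>

lemma card_invs_block_comp: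
  assumes "k \<le> n" and \<pi>: "\<pi> \<in> block_perms n k" and \<tau>: "\<tau> \<in> coset_reps n k"
  shows "card (invs n (\<pi> \<circ> \<tau>)) = card (invs n \<pi>) + card (invs n \<tau>)"
proof -
  have p\<tau>: "\<tau> permutes {..<n}" using \<tau> by (simp add: coset_reps_def)
  have p\<pi>: "\<pi> permutes {..<n}" using \<pi> by (simp add: block_perms_def)
  note i\<tau> = permutes_inverses[OF p\<tau>]
  have less_n: "\<tau> a < n \<longleftrightarrow> a < n" for a using permutes_in_image[OF p\<tau>, of a] by simp
  have inv_n: "pinv \<tau> a < n \<longleftrightarrow> a < n" for a
    using permutes_in_image[OF permutes_inv[OF p\<tau>], of a] by simp
  note bl = block_perms_less_iff[OF \<pi>]
  have mono: "c < d \<Longrightarrow> d < n \<Longrightarrow> d < k \<or> k \<le> c \<Longrightarrow> pinv \<tau> c < pinv \<tau> d" for c d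
    using coset_reps_mono[OF \<tau>] by blast
  have block: "d < k \<or> k \<le> c" if "(c, d) \<in> invs n \<pi>" for c d
    using that bl[of c] bl[of d] by (auto simp: invs_def)
  let ?J = "(\<lambda>(c, d). (pinv \<tau> c, pinv \<tau> d)) ` invs n \<pi>"
  have J: "?J = {(a, b). a < b \<and> b < n \<and> (\<tau> a, \<tau> b) \<in> invs n \<pi>}"
  proof (intro equalityI subsetI)
    fix z assume "z \<in> ?J"
    then obtain c d where cd: "(c, d) \<in> invs n \<pi>" "z = (pinv \<tau> c, pinv \<tau> d)" by auto
    then have "pinv \<tau> c < pinv \<tau> d" "pinv \<tau> d < n"
      using mono[of c d] block[of c d] inv_n by (auto simp: invs_def)
    then show "z \<in> {(a, b). a < b \<and> b < n \<and> (\<tau> a, \<tau> b) \<in> invs n \<pi>}"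
      using cd i\<tau> by simp
  next
    fix z assume "z \<in> {(a, b). a < b \<and> b < n \<and> (\<tau> a, \<tau> b) \<in> invs n \<pi>}"
    then obtain a b where "z = (a, b)" "(\<tau> a, \<tau> b) \<in> invs n \<pi>" by auto
    then show "z \<in> ?J" using i\<tau> by (intro image_eqI[of _ _ "(\<tau> a, \<tau> b)"]) auto
  qed
  have iff: "\<pi> (\<tau> b) < \<pi> (\<tau> a) \<longleftrightarrow> \<tau> b < \<tau> a \<or> (\<tau> a, \<tau> b) \<in> invs n \<pi>"
    and excl: "\<not> (\<tau> b < \<tau> a \<and> (\<tau> a, \<tau> b) \<in> invs n \<pi>)" if ab: "a < b" "b < n" for a b
  proof -
    show "\<not> (\<tau> b < \<tau> a \<and> (\<tau> a, \<tau> b) \<in> invs n \<pi>)" by (auto simp: invs_def)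
    have n: "\<tau> a < n" "\<tau> b < n" using ab less_n by auto
    consider "\<tau> a < k" "\<tau> b < k" | "k \<le> \<tau> a" "k \<le> \<tau> b" | "\<tau> a < k" "k \<le> \<tau> b" | "\<tau> b < k" "k \<le> \<tau> a"
      by linarith
    then show "\<pi> (\<tau> b) < \<pi> (\<tau> a) \<longleftrightarrow> \<tau> b < \<tau> a \<or> (\<tau> a, \<tau> b) \<in> invs n \<pi>"
    proof cases
      case 1
      then have "\<not> \<tau> b < \<tau> a" using mono[of "\<tau> b" "\<tau> a"] n i\<tau> ab by auto
      moreover have "\<tau> a \<noteq> \<tau> b" using ab permutes_inj[OF p\<tau>] by (metis injD less_irrefl)
      ultimately show ?thesis using n by (auto simp: invs_def)
    next
      case 2
      then have "\<not> \<tau> b < \<tau> a" using mono[of "\<tau> b" "\<tau> a"] n i\<tau> ab by auto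
      moreover have "\<tau> a \<noteq> \<tau> b" using ab permutes_inj[OF p\<tau>] by (metis injD less_irrefl)
      ultimately show ?thesis using n by (auto simp: invs_def)
    next
      case 3
      then have "\<pi> (\<tau> a) < k" "\<not> \<pi> (\<tau> b) < k" using bl by auto
      then show ?thesis using 3 by (auto simp: invs_def)
    next
      case 4
      then have "\<pi> (\<tau> b) < k" "\<not> \<pi> (\<tau> a) < k" using bl by auto
      then show ?thesis using 4 by (auto simp: invs_def)
    qed
  qed
  have "invs n (\<pi> \<circ> \<tau>) = invs n \<tau> \<union> ?J"
    unfolding J using iff by (auto simp: invs_def[of n "\<pi> \<circ> \<tau>"] invs_def[of n \<tau>])
  moreover have "invs n \<tau> \<inter> ?J = {}"
    unfolding J using excl by (auto simp: invs_def[of n \<tau>])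
  moreover have "card ?J = card (invs n \<pi>)"
    by (rule card_image) (auto simp: inj_on_def dest!: arg_cong[of "pinv \<tau> _" _ \<tau>] simp: i\<tau>)
  ultimately show ?thesis by (simp add: card_Un_disjoint)
qed

text \<open>The representative of a coset is an element of minimal length. It is unique since lengths add:
  two representatives that differ by \<open>\<rho>\<close> in the subgroup force \<open>\<rho>\<close> to have length zero.\<close>

lemma bij_betw_block_coset:
  assumes k: "k \<le> n"
  shows "bij_betw (\<lambda>(\<pi>, \<tau>). \<pi> \<circ> \<tau>) (block_perms n k \<times> coset_reps n k) (perms n)"
proof (rule bij_betw_imageI)
  show "inj_on (\<lambda>(\<pi>, \<tau>). \<pi> \<circ> \<tau>) (block_perms n k \<times> coset_reps n k)"
  proof (rule inj_onI, clarify)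
    fix \<pi> \<tau> \<pi>' \<tau>'
    assume a: "\<pi> \<in> block_perms n k" "\<tau> \<in> coset_reps n k" "\<pi>' \<in> block_perms n k"
      "\<tau>' \<in> coset_reps n k" "\<pi> \<circ> \<tau> = \<pi>' \<circ> \<tau>'"
    then have p: "\<pi> permutes {..<n}" "\<pi>' permutes {..<n}" by (auto simp: block_perms_def)
    define \<rho> where "\<rho> = pinv \<pi>' \<circ> \<pi>"
    have \<rho>: "\<rho> \<in> block_perms n k" using a by (simp add: \<rho>_def block_perms_comp block_perms_inv)
    then have p\<rho>: "\<rho> permutes {..<n}" by (simp add: block_perms_def)
    have e: "\<tau>' = \<rho> \<circ> \<tau>"
      using a(5) permutes_inverses(2)[OF p(2)] by (auto simp: \<rho>_def fun_eq_iff)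
    have e': "\<tau> = pinv \<rho> \<circ> \<tau>'"
      using permutes_inverses(2)[OF p\<rho>] by (auto simp: e fun_eq_iff)
    have "card (invs n \<tau>') = card (invs n \<rho>) + card (invs n \<tau>)"
      using card_invs_block_comp[OF k \<rho> a(2)] e by simp
    moreover have "card (invs n \<tau>) = card (invs n (pinv \<rho>)) + card (invs n \<tau>')"
      using card_invs_block_comp[OF k block_perms_inv[OF \<rho>] a(4)] e' by simp
    ultimately have "card (invs n \<rho>) = 0" by simp
    then have "reduced_expr n \<rho> []"
      using reduced_expr_exists[OF p\<rho>] reduced_expr_iff[OF p\<rho>] by force
    then have "\<rho> = id" by (simp add: reduced_expr_def)
    then show "\<pi> = \<pi>' \<and> \<tau> = \<tau>'"
      using e permutes_inverses(1)[OF p(2)] by (auto simp: \<rho>_def fun_eq_iff) metis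
  qed
  show "(\<lambda>(\<pi>, \<tau>). \<pi> \<circ> \<tau>) ` (block_perms n k \<times> coset_reps n k) = perms n"
  proof (intro equalityI subsetI)
    fix \<sigma> assume "\<sigma> \<in> (\<lambda>(\<pi>, \<tau>). \<pi> \<circ> \<tau>) ` (block_perms n k \<times> coset_reps n k)"
    then show "\<sigma> \<in> perms n"
      by (auto simp: block_perms_def coset_reps_def intro: permutes_compose)
  next
    fix \<sigma> assume "\<sigma> \<in> perms n"
    then have \<sigma>: "\<sigma> permutes {..<n}" by simp
    have id: "id \<in> block_perms n k" by (simp add: block_perms_def permutes_id)
    then obtain \<pi> where \<pi>: "\<pi> \<in> block_perms n k"
      and min: "\<And>\<pi>'. \<pi>' \<in> block_perms n k \<Longrightarrow> card (invs n (\<pi> \<circ> \<sigma>)) \<le> card (invs n (\<pi>' \<circ> \<sigma>))"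
      using ex_has_least_nat[of "\<lambda>\<pi>. \<pi> \<in> block_perms n k" id "\<lambda>\<pi>. card (invs n (\<pi> \<circ> \<sigma>))"] by blast
    let ?\<tau> = "\<pi> \<circ> \<sigma>"
    have p\<pi>: "\<pi> permutes {..<n}" using \<pi> by (simp add: block_perms_def)
    have p\<tau>: "?\<tau> permutes {..<n}" using permutes_compose[OF \<sigma> p\<pi>] .
    have "pinv ?\<tau> i < pinv ?\<tau> (Suc i)" if i: "Suc i < n" "Suc i \<noteq> k" for i
    proof (rule ccontr)
      assume "\<not> pinv ?\<tau> i < pinv ?\<tau> (Suc i)"
      then have "pinv ?\<tau> (Suc i) < pinv ?\<tau> i" using inv_permutes_neq[OF p\<tau>, of i] by simp
      then have "card (invs n ?\<tau>) = Suc (card (invs n (adj i \<circ> ?\<tau>)))"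
        by (rule card_invs_descent[OF p\<tau> i(1)])
      moreover have "card (invs n ?\<tau>) \<le> card (invs n ((adj i \<circ> \<pi>) \<circ> \<sigma>))"
        by (rule min[OF block_perms_comp[OF adj_block_perms[OF i] \<pi>]])
      ultimately show False by (simp add: comp_assoc)
    qed
    then have "?\<tau> \<in> coset_reps n k" using p\<tau> by (simp add: coset_reps_def)
    moreover have "\<sigma> = pinv \<pi> \<circ> ?\<tau>" using permutes_inverses(2)[OF p\<pi>] by (auto simp: fun_eq_iff)
    ultimately show "\<sigma> \<in> (\<lambda>(\<pi>, \<tau>). \<pi> \<circ> \<tau>) ` (block_perms n k \<times> coset_reps n k)"
      using block_perms_inv[OF \<pi>] by (intro image_eqI[of _ _ "(pinv \<pi>, ?\<tau>)"]) auto
  qed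
qed

text \<open>A permutation of \<open>{..<m}\<close> acting on the second block \<open>{k..<k + m}\<close>.\<close>

definition shift_perm :: "nat \<Rightarrow> (nat \<Rightarrow> nat) \<Rightarrow> nat \<Rightarrow> nat" where
  "shift_perm k \<beta> x = (if x < k then x else k + \<beta> (x - k))"

lemma perm_of_expr_shift: "perm_of_expr (map ((+) k) js) = shift_perm k (perm_of_expr js)"
proof (induction js)
  case Nil
  then show ?case by (auto simp: shift_perm_def)
next
  case (Cons j js)
  have "adj (k + j) (shift_perm k \<beta> x) = shift_perm k (adj j \<circ> \<beta>) x" for \<beta> x
    by (auto simp: shift_perm_def transpose_def)
  then show ?case using Cons by (auto simp: fun_eq_iff o_def)
qed

lemma shift_perm_permutes:
  assumes "\<beta> permutes {..<m}"
  shows "shift_perm k \<beta> permutes {..<k + m}"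
proof -
  obtain js where "\<forall>j\<in>set js. Suc j < m" "perm_of_expr js = \<beta>" using reduced_expr_exists[OF assms] by blast
  then show ?thesis
    using perm_of_expr_permutes[of "map ((+) k) js" "k + m"] by (simp add: perm_of_expr_shift)
qed

lemma invs_block_perm:
  assumes \<alpha>: "\<alpha> permutes {..<k}"
  shows "invs (k + m) (\<alpha> \<circ> shift_perm k \<beta>) = invs k \<alpha> \<union> (\<lambda>(a, b). (k + a, k + b)) ` invs m \<beta>"
proof -
  have low: "(\<alpha> \<circ> shift_perm k \<beta>) x = \<alpha> x" "\<alpha> x < k" if "x < k" for x
    using that permutes_in_image[OF \<alpha>, of x] by (auto simp: shift_perm_def)
  have high: "(\<alpha> \<circ> shift_perm k \<beta>) (k + y) = k + \<beta> y" for y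
    using permutes_not_in[OF \<alpha>] by (simp add: shift_perm_def)
  show ?thesis
  proof (intro equalityI subsetI)
    fix z assume "z \<in> invs (k + m) (\<alpha> \<circ> shift_perm k \<beta>)"
    then obtain a b where z: "z = (a, b)" and ab: "a < b" "b < k + m"
      "(\<alpha> \<circ> shift_perm k \<beta>) b < (\<alpha> \<circ> shift_perm k \<beta>) a"
      by (auto simp: invs_def)
    consider "b < k" | "a < k" "k \<le> b" | "k \<le> a" using ab by linarith
    then show "z \<in> invs k \<alpha> \<union> (\<lambda>(a, b). (k + a, k + b)) ` invs m \<beta>"
    proof cases
      case 1
      then show ?thesis using ab low[of a] low[of b] z by (auto simp: invs_def)
    next
      case 2
      then show ?thesis using ab(3) low[of a] high[of "b - k"] by simp
    next
      case 3
      then have "(a - k, b - k) \<in> invs m \<beta>"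
        using ab high[of "a - k"] high[of "b - k"] by (auto simp: invs_def)
      then show ?thesis using 3 ab z by (intro UnI2 image_eqI[of _ _ "(a - k, b - k)"]) auto
    qed
  next
    fix z assume "z \<in> invs k \<alpha> \<union> (\<lambda>(a, b). (k + a, k + b)) ` invs m \<beta>"
    then show "z \<in> invs (k + m) (\<alpha> \<circ> shift_perm k \<beta>)"
    proof
      assume "z \<in> invs k \<alpha>"
      then show ?thesis using low by (auto simp: invs_def simp del: o_apply)
    next
      assume "z \<in> (\<lambda>(a, b). (k + a, k + b)) ` invs m \<beta>"
      then show ?thesis using high by (auto simp: invs_def simp del: o_apply)
    qed
  qed
qed

lemma reduced_expr_block_perm:
  assumes "\<alpha> permutes {..<k}" "\<beta> permutes {..<m}" "reduced_expr k \<alpha> is" "reduced_expr m \<beta> js"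
  shows "\<alpha> \<circ> shift_perm k \<beta> permutes {..<k + m}"
    and "reduced_expr (k + m) (\<alpha> \<circ> shift_perm k \<beta>) (is @ map ((+) k) js)"
proof -
  have "\<alpha> permutes {..<k + m}" using assms(1) by (rule permutes_subset) auto
  then show p: "\<alpha> \<circ> shift_perm k \<beta> permutes {..<k + m}"
    using shift_perm_permutes[OF assms(2)] by (intro permutes_compose)
  have "card (invs (k + m) (\<alpha> \<circ> shift_perm k \<beta>))
      = card (invs k \<alpha>) + card ((\<lambda>(a, b). (k + a, k + b)) ` invs m \<beta>)"
    unfolding invs_block_perm[OF assms(1)] 
    by (rule card_Un_disjoint[OF finite_invs finite_imageI[OF finite_invs]]) (auto simp: invs_def)
  also have "\<dots> = card (invs k \<alpha>) + card (invs m \<beta>)"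
    by (subst card_image) (auto simp: inj_on_def)
  finally show "reduced_expr (k + m) (\<alpha> \<circ> shift_perm k \<beta>) (is @ map ((+) k) js)"
    using assms p by (auto simp: reduced_expr_iff perm_of_expr_append perm_of_expr_shift)
qed

lemma bij_betw_block_perms:
  "bij_betw (\<lambda>(\<alpha>, \<beta>). \<alpha> \<circ> shift_perm k \<beta>) (perms k \<times> perms m) (block_perms (k + m) k)"
proof (rule bij_betw_imageI)
  have low: "(\<alpha> \<circ> shift_perm k \<beta>) x = \<alpha> x" if "x < k" for \<alpha> \<beta> x
    using that by (simp add: shift_perm_def)
  have high: "(\<alpha> \<circ> shift_perm k \<beta>) (k + y) = k + \<beta> y" if "\<alpha> permutes {..<k}" for \<alpha> \<beta> y
    using permutes_not_in[OF that] by (simp add: shift_perm_def)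
  show "inj_on (\<lambda>(\<alpha>, \<beta>). \<alpha> \<circ> shift_perm k \<beta>) (perms k \<times> perms m)"
  proof (rule inj_onI, clarify)
    fix \<alpha> \<beta> \<alpha>' \<beta>'
    assume a: "\<alpha> permutes {..<k}" "\<alpha>' permutes {..<k}"
      and e: "\<alpha> \<circ> shift_perm k \<beta> = \<alpha>' \<circ> shift_perm k \<beta>'"
    have "\<beta> y = \<beta>' y" for y using high[OF a(1), of \<beta> y] high[OF a(2), of \<beta>' y] e by simp
    moreover have "\<alpha> x = \<alpha>' x" for x
      using low[of x \<alpha> \<beta>] low[of x \<alpha>' \<beta>'] e permutes_not_in[OF a(1), of x] permutes_not_in[OF a(2), of x]
      by (cases "x < k") auto
    ultimately show "\<alpha> = \<alpha>' \<and> \<beta> = \<beta>'" by auto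
  qed
  show "(\<lambda>(\<alpha>, \<beta>). \<alpha> \<circ> shift_perm k \<beta>) ` (perms k \<times> perms m) = block_perms (k + m) k"
  proof (intro equalityI subsetI)
    fix \<pi> assume "\<pi> \<in> (\<lambda>(\<alpha>, \<beta>). \<alpha> \<circ> shift_perm k \<beta>) ` (perms k \<times> perms m)"
    then obtain \<alpha> \<beta> where ab: "\<alpha> permutes {..<k}" "\<beta> permutes {..<m}" "\<pi> = \<alpha> \<circ> shift_perm k \<beta>"
      by auto
    moreover have "\<pi> permutes {..<k + m}"
      using ab reduced_expr_block_perm(1) reduced_expr_exists reduced_expr_iff by metis
    moreover have "\<pi> ` {..<k} = \<alpha> ` {..<k}" unfolding ab(3) using low by (intro image_cong) auto
    ultimately show "\<pi> \<in> block_perms (k + m) k"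
      using permutes_image[OF ab(1)] by (simp add: block_perms_def)
  next
    fix \<pi> assume \<pi>: "\<pi> \<in> block_perms (k + m) k"
    then have p: "\<pi> permutes {..<k + m}" by (simp add: block_perms_def)
    note bl = block_perms_less_iff[OF \<pi>]
    define \<alpha> where "\<alpha> x = (if x < k then \<pi> x else x)" for x
    define \<beta> where "\<beta> y = \<pi> (k + y) - k" for y
    have k\<beta>: "k + \<beta> y = \<pi> (k + y)" for y using bl[of "k + y"] by (simp add: \<beta>_def)
    have "bij_betw \<alpha> {..<k} {..<k}"
    proof (rule bij_betw_imageI)
      show "inj_on \<alpha> {..<k}" using permutes_inj[OF p] by (auto simp: \<alpha>_def inj_on_def)
      have "\<alpha> ` {..<k} = \<pi> ` {..<k}" by (intro image_cong) (auto simp: \<alpha>_def)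
      then show "\<alpha> ` {..<k} = {..<k}" using \<pi> by (simp add: block_perms_def)
    qed
    then have \<alpha>: "\<alpha> permutes {..<k}" by (rule bij_imp_permutes) (simp add: \<alpha>_def)
    have "inj \<beta>" by (rule injI) (metis k\<beta> add_left_cancel injD[OF permutes_inj[OF p]])
    moreover have fix\<beta>: "\<beta> y = y" if "y \<notin> {..<m}" for y
      using permutes_not_in[OF p, of "k + y"] that by (simp add: \<beta>_def)
    moreover have "\<beta> ` {..<m} \<subseteq> {..<m}"
    proof
      fix z assume "z \<in> \<beta> ` {..<m}"
      then obtain y where y: "y < m" "z = \<beta> y" by auto
      then have "k + z < k + m" using k\<beta>[of y] permutes_in_image[OF p, of "k + y"] by simp
      then show "z \<in> {..<m}" by simp
    qed
    ultimately have "bij_betw \<beta> {..<m} {..<m}"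
      by (metis bij_betw_def endo_inj_surj finite_lessThan inj_on_subset subset_UNIV)
    then have \<beta>: "\<beta> permutes {..<m}" using fix\<beta> by (rule bij_imp_permutes)
    have "\<pi> = \<alpha> \<circ> shift_perm k \<beta>"
    proof
      fix x
      show "\<pi> x = (\<alpha> \<circ> shift_perm k \<beta>) x"
        using low[of x \<alpha> \<beta>] high[OF \<alpha>, of \<beta> "x - k"] k\<beta>[of "x - k"] by (cases "x < k") (auto simp: \<alpha>_def)
    qed
    then show "\<pi> \<in> (\<lambda>(\<alpha>, \<beta>). \<alpha> \<circ> shift_perm k \<beta>) ` (perms k \<times> perms m)"
      using \<alpha> \<beta> by (intro image_eqI[of _ _ "(\<alpha>, \<beta>)"]) auto
  qed
qed

section \<open>The Nichols algebra as a coalgebra\<close>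

lemma lin_ext_swap:
  "lin_ext (\<lambda>p. lin_ext (\<lambda>r. f p r) v) u = lin_ext (\<lambda>r. lin_ext (\<lambda>p. f p r) u) v"
proof -
  have "lin_ext (\<lambda>p. lin_ext (\<lambda>r. f p r) v) u
      = (\<Sum>p\<in>supp u. \<Sum>r\<in>supp v.
          pm_scale (coef u p * coef v r) (f p r))"
    by (simp add: lin_ext_def pm.scale_sum_right)
  also have "\<dots> = lin_ext (\<lambda>r. lin_ext (\<lambda>p. f p r) u) v"
    by (subst sum.swap) (simp add: lin_ext_def pm.scale_sum_right mult.commute)
  finally show ?thesis .
qed

text \<open>Concatenation identifies \<open>V\<^sup>k \<otimes> V\<^sup>m\<close> with \<open>V\<^sup>n\<close> for \<open>n = k + m\<close>.\<close>

definition conc :: "('x list \<times> 'x list \<Rightarrow>\<^sub>0 'k::field) \<Rightarrow> ('x list \<Rightarrow>\<^sub>0 'k)" where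
  "conc = lin_ext (\<lambda>(u, w). bas (u @ w))"

lemma conc_tens: "conc (tens a b) = lin_ext (\<lambda>u. lin_ext (\<lambda>w. bas (u @ w)) b) a"
  by (simp add: conc_def lin_ext_tens)

lemma braid_at_append_left:
  assumes "Suc i < length u"
  shows "braid_at c i (u @ w) = lin_ext (\<lambda>u. bas (u @ w)) (braid_at c i u)"
  using assms
  by (simp add: braid_at_def lin_ext_lin_ext nth_append list_update_append case_prod_unfold)

lemma braid_at_append_right:
  assumes "length u = k"
  shows "braid_at c (k + i) (u @ w) = lin_ext (\<lambda>w. bas (u @ w)) (braid_at c i w)"
  using assms
  by (simp add: braid_at_def lin_ext_lin_ext nth_append list_update_append case_prod_unfold)

lemma braid_conc_left:
  assumes "\<And>u. u \<in> supp a \<Longrightarrow> length u = k" "Suc i < k"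
  shows "lin_ext (braid_at c i) (conc (tens a b)) = conc (tens (lin_ext (braid_at c i) a) b)"
proof -
  have "lin_ext (braid_at c i) (conc (tens a b))
      = lin_ext (\<lambda>u. lin_ext (\<lambda>w. lin_ext (\<lambda>u. bas (u @ w)) (braid_at c i u)) b) a"
    unfolding conc_tens lin_ext_lin_ext
    by (intro lin_ext_cong) (use assms in \<open>simp add: braid_at_append_left\<close>)
  also have "\<dots> = lin_ext (\<lambda>u. lin_ext (\<lambda>u. lin_ext (\<lambda>w. bas (u @ w)) b) (braid_at c i u)) a"
    by (subst lin_ext_swap) (rule refl)
  finally show ?thesis by (simp add: conc_tens lin_ext_lin_ext)
qed

lemma braid_conc_right:
  assumes "\<And>u. u \<in> supp a \<Longrightarrow> length u = k"
  shows "lin_ext (braid_at c (k + i)) (conc (tens a b)) = conc (tens a (lin_ext (braid_at c i) b))"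
  unfolding conc_tens lin_ext_lin_ext
  by (intro lin_ext_cong) (use assms in \<open>simp add: braid_at_append_right\<close>)

lemma subspace_tensor_power: "pm.subspace (tensor_power X n)"
  unfolding tensor_power_def by (rule subspace_keys_subset)

lemma bas_tensor_power [simp]: "bas w \<in> tensor_power X n \<longleftrightarrow> set w \<subseteq> X \<and> length w = n"
  by (simp add: tensor_power_def)

lemma tensor_power_keys:
  "u \<in> tensor_power X n \<Longrightarrow> w \<in> supp u \<Longrightarrow> set w \<subseteq> X \<and> length w = n"
  by (auto simp: tensor_power_def)

lemma matsumoto_eq_foldr:
  "matsumoto c n \<sigma> u = foldr (\<lambda>i. lin_ext (braid_at c i)) (SOME is. reduced_expr n \<sigma> is) u"
proof -
  have "foldr (\<lambda>i T. lin_ext (braid_at c i) \<circ> T) is id u = foldr (\<lambda>i. lin_ext (braid_at c i)) is u" for "is"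
    by (induction "is") auto
  then show ?thesis by (simp add: matsumoto_def)
qed

lemma foldr_lin_ext: "foldr (\<lambda>i. lin_ext (f i)) is u = lin_ext (\<lambda>p. foldr (\<lambda>i. lin_ext (f i)) is (bas p)) u"
  by (induction "is") (simp_all add: lin_ext_lin_ext)

lemma matsumoto_lin_ext: "matsumoto c n \<sigma> u = lin_ext (\<lambda>p. matsumoto c n \<sigma> (bas p)) u"
  unfolding matsumoto_eq_foldr by (rule foldr_lin_ext)

lemma quantum_symmetrizer_lin_ext:
  "quantum_symmetrizer c n u = lin_ext (\<lambda>p. quantum_symmetrizer c n (bas p)) u"
  unfolding quantum_symmetrizer_def by (subst matsumoto_lin_ext) (simp add: lin_ext_sum_fun)

text \<open>The two last conditions compare both sides of the braid equation on \<open>v\<^sub>x \<otimes> v\<^sub>y \<otimes> v\<^sub>z\<close>: the first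
  equates the words, the second the coefficients.\<close>

locale rack_type_braiding =
  fixes X :: "'x set" and ra :: "'x \<Rightarrow> 'x \<Rightarrow> 'x" and q :: "'x \<Rightarrow> 'x \<Rightarrow> 'k::field"
    and c :: "'x \<Rightarrow> 'x \<Rightarrow> ('x \<times> 'x \<Rightarrow>\<^sub>0 'k)"
  assumes ra_closed: "x \<in> X \<Longrightarrow> y \<in> X \<Longrightarrow> ra x y \<in> X"
    and c_eq: "x \<in> X \<Longrightarrow> y \<in> X \<Longrightarrow> c x y = Poly_Mapping.single (ra x y, x) (q x y)"
    and ra_distrib: "x \<in> X \<Longrightarrow> y \<in> X \<Longrightarrow> z \<in> X \<Longrightarrow> ra x (ra y z) = ra (ra x y) (ra x z)"
    and q_cocycle: "x \<in> X \<Longrightarrow> y \<in> X \<Longrightarrow> z \<in> X \<Longrightarrow>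
      q x z * q (ra x y) (ra x z) = q y z * q x (ra y z)"
begin

abbreviation "T i \<equiv> lin_ext (braid_at c i)"

definition braid_word :: "nat \<Rightarrow> 'x list \<Rightarrow> 'x list" where
  "braid_word i w = w[i := ra (w ! i) (w ! Suc i), Suc i := w ! i]"

lemma length_braid_word [simp]: "length (braid_word i w) = length w"
  by (simp add: braid_word_def)

lemma nth_braid_word:
  "j < length w \<Longrightarrow> braid_word i w ! j
     = (if j = Suc i then w ! i else if j = i then ra (w ! i) (w ! Suc i) else w ! j)"
  by (auto simp: braid_word_def nth_list_update)

lemma set_braid_word:
  assumes "set w \<subseteq> X" "Suc i < length w"
  shows "set (braid_word i w) \<subseteq> X"
proof
  fix x assume "x \<in> set (braid_word i w)"
  then obtain j where j: "j < length w" "x = braid_word i w ! j" by (auto simp: in_set_conv_nth)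
  have "w ! i \<in> X" "w ! Suc i \<in> X" "w ! j \<in> X"
    using assms j(1) by (auto dest: nth_mem)
  then show "x \<in> X" using j by (simp add: nth_braid_word ra_closed)
qed

lemma braid_at_eq:
  assumes "set w \<subseteq> X" "Suc i < length w"
  shows "braid_at c i w = Poly_Mapping.single (braid_word i w) (q (w ! i) (w ! Suc i))"
proof -
  have "w ! i \<in> X" "w ! Suc i \<in> X" using assms by (auto dest: nth_mem)
  then show ?thesis by (simp add: braid_at_def c_eq braid_word_def)
qed

lemma T_single:
  assumes "set w \<subseteq> X" "Suc i < length w"
  shows "T i (Poly_Mapping.single w t) = Poly_Mapping.single (braid_word i w) (t * q (w ! i) (w ! Suc i))"
  using assms by (simp add: braid_at_eq)

text \<open>Operators are compared on basis words. Writing them as compositions along a list of positions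
  lets one statement cover both sides of both braid relations.\<close>

lemma operators_eqI:
  assumes "u \<in> tensor_power X n"
    and "\<And>w. set w \<subseteq> X \<Longrightarrow> length w = n \<Longrightarrow>
      foldr (\<lambda>i. lin_ext (braid_at c i)) is (bas w) = foldr (\<lambda>i. lin_ext (braid_at c i)) js (bas w)"
  shows "foldr (\<lambda>i. lin_ext (braid_at c i)) is u = foldr (\<lambda>i. lin_ext (braid_at c i)) js u"
  by (subst (1 2) foldr_lin_ext)
    (rule lin_ext_cong, rule assms(2), use tensor_power_keys[OF assms(1)] in auto)

sublocale braid_operators n T "tensor_power X n" for n
proof
  fix i and u :: "'x list \<Rightarrow>\<^sub>0 'k" assume i: "Suc i < n" and u: "u \<in> tensor_power X n"
  show "T i u \<in> tensor_power X n"
  proof (rule lin_ext_in_subspace[OF subspace_tensor_power])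
    fix w assume "w \<in> supp u"
    then have "set w \<subseteq> X" "length w = n" using tensor_power_keys[OF u] by auto
    then show "braid_at c i w \<in> tensor_power X n"
      using i set_braid_word[of w i] by (auto simp: braid_at_eq tensor_power_def in_keys_iff lookup_single when_def)
  qed
next
  fix i j and u :: "'x list \<Rightarrow>\<^sub>0 'k"
  assume ij: "Suc i < j" "Suc j < n" and u: "u \<in> tensor_power X n"
  have "foldr (\<lambda>i. lin_ext (braid_at c i)) [i, j] u = foldr (\<lambda>i. lin_ext (braid_at c i)) [j, i] u"
  proof (rule operators_eqI[OF u])
    fix w assume w: "set w \<subseteq> X" "length w = n"
    have "braid_word i (braid_word j w) = braid_word j (braid_word i w)"
      by (rule nth_equalityI) (use ij w in \<open>auto simp: nth_braid_word\<close>)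
    then show "foldr (\<lambda>i. lin_ext (braid_at c i)) [i, j] (bas w)
        = foldr (\<lambda>i. lin_ext (braid_at c i)) [j, i] (bas w)"
      using ij w set_braid_word[of w i] set_braid_word[of w j]
      by (simp add: T_single nth_braid_word mult.commute del: lin_ext_single)
  qed
  then show "T i (T j u) = T j (T i u)" by simp
next
  fix i and u :: "'x list \<Rightarrow>\<^sub>0 'k"
  assume i: "Suc (Suc i) < n" and u: "u \<in> tensor_power X n"
  have "foldr (\<lambda>i. lin_ext (braid_at c i)) [i, Suc i, i] u
      = foldr (\<lambda>i. lin_ext (braid_at c i)) [Suc i, i, Suc i] u"
  proof (rule operators_eqI[OF u])
    fix w assume w: "set w \<subseteq> X" "length w = n"
    let ?a = "braid_word i w" let ?b = "braid_word (Suc i) w"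
    let ?a' = "braid_word (Suc i) ?a" let ?b' = "braid_word i ?b"
    have X: "w ! i \<in> X" "w ! Suc i \<in> X" "w ! Suc (Suc i) \<in> X" using w i by (auto dest: nth_mem)
    have sets: "set ?a \<subseteq> X" "set ?b \<subseteq> X" 
      using set_braid_word[of w i] set_braid_word[of w "Suc i"] w i by auto
    have sets': "set ?a' \<subseteq> X" "set ?b' \<subseteq> X"
      using set_braid_word[OF sets(1), of "Suc i"] set_braid_word[OF sets(2), of i] w i by auto
    have words: "braid_word i ?a' = braid_word (Suc i) ?b'"
      by (rule nth_equalityI) (use i w ra_distrib[OF X] in \<open>auto simp: nth_braid_word\<close>)
    have coeffs: "q (w ! i) (w ! Suc i) * q (w ! i) (w ! Suc (Suc i))
          * q (ra (w ! i) (w ! Suc i)) (ra (w ! i) (w ! Suc (Suc i)))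
        = q (w ! Suc i) (w ! Suc (Suc i)) * q (w ! i) (ra (w ! Suc i) (w ! Suc (Suc i))) * q (w ! i) (w ! Suc i)"
      using q_cocycle[OF X] by (simp add: mult.assoc mult.commute mult.left_commute)
    show "foldr (\<lambda>i. lin_ext (braid_at c i)) [i, Suc i, i] (bas w)
        = foldr (\<lambda>i. lin_ext (braid_at c i)) [Suc i, i, Suc i] (bas w)"
      using i w sets sets'
      by (simp add: T_single nth_braid_word del: lin_ext_single) (simp only: words coeffs)
  qed
  then show "T i (T (Suc i) (T i u)) = T (Suc i) (T i (T (Suc i) u))" by simp
qed

lemma matsumoto_reduced_expr:
  assumes "\<sigma> permutes {..<n}" "reduced_expr n \<sigma> is" "u \<in> tensor_power X n"
  shows "matsumoto c n \<sigma> u = foldr T is u"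
  unfolding matsumoto_eq_foldr
  by (rule reduced_expr_unique[OF assms(1) _ assms(2,3)]) (rule someI[of "reduced_expr n \<sigma>", OF assms(2)])

lemma matsumoto_closed:
  assumes "\<sigma> permutes {..<n}" "u \<in> tensor_power X n"
  shows "matsumoto c n \<sigma> u \<in> tensor_power X n"
proof -
  obtain "is" where "is": "reduced_expr n \<sigma> is" using reduced_expr_exists[OF assms(1)] reduced_expr_iff[OF assms(1)] by blast
  then show ?thesis
    using assms by (auto simp: matsumoto_reduced_expr[OF assms(1) "is"] reduced_expr_iff intro: expr_closed)
qed

lemma quantum_symmetrizer_closed:
  "u \<in> tensor_power X n \<Longrightarrow> quantum_symmetrizer c n u \<in> tensor_power X n"
  unfolding quantum_symmetrizer_def
  by (rule pm.subspace_sum[OF subspace_tensor_power]) (simp add: matsumoto_closed)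

text \<open>Lengths add in the parabolic decomposition; so do the corresponding braids.\<close>

lemma matsumoto_block_comp:
  assumes "k \<le> n" "\<pi> \<in> block_perms n k" "\<tau> \<in> coset_reps n k" "u \<in> tensor_power X n"
  shows "matsumoto c n (\<pi> \<circ> \<tau>) u = matsumoto c n \<pi> (matsumoto c n \<tau> u)"
proof -
  have p: "\<pi> permutes {..<n}" "\<tau> permutes {..<n}"
    using assms by (auto simp: block_perms_def coset_reps_def)
  have p': "\<pi> \<circ> \<tau> permutes {..<n}" by (rule permutes_compose[OF p(2,1)])
  obtain "is" js where e: "reduced_expr n \<pi> is" "reduced_expr n \<tau> js"
    using reduced_expr_exists p reduced_expr_iff by metis
  have "reduced_expr n (\<pi> \<circ> \<tau>) (is @ js)"
    using e p p' card_invs_block_comp[OF assms(1-3)]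
    by (auto simp: reduced_expr_iff perm_of_expr_append)
  then have "matsumoto c n (\<pi> \<circ> \<tau>) u = foldr T is (foldr T js u)"
    using matsumoto_reduced_expr[OF p'] assms(4) by simp
  also have "foldr T js u = matsumoto c n \<tau> u"
    using matsumoto_reduced_expr[OF p(2) e(2) assms(4)] by simp
  also have "foldr T is (matsumoto c n \<tau> u) = matsumoto c n \<pi> (matsumoto c n \<tau> u)"
    using matsumoto_reduced_expr[OF p(1) e(1) matsumoto_closed[OF p(2) assms(4)]] by simp
  finally show ?thesis .
qed

lemma foldr_conc_left:
  "\<forall>i\<in>set is. Suc i < k \<Longrightarrow> a \<in> tensor_power X k \<Longrightarrow>
     foldr T is (conc (tens a b)) = conc (tens (foldr T is a) b)"
proof (induction "is")
  case (Cons i "is")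
  have "foldr T is a \<in> tensor_power X k" using Cons.prems by (intro expr_closed) auto
  then have "T i (conc (tens (foldr T is a) b)) = conc (tens (T i (foldr T is a)) b)"
    using Cons.prems tensor_power_keys by (intro braid_conc_left) auto
  then show ?case using Cons by simp
qed simp

lemma foldr_conc_right:
  "a \<in> tensor_power X k \<Longrightarrow> foldr T (map ((+) k) js) (conc (tens a b)) = conc (tens a (foldr T js b))"
proof (induction js)
  case (Cons j js)
  have "T (k + j) (conc (tens a (foldr T js b))) = conc (tens a (T j (foldr T js b)))"
    using Cons.prems tensor_power_keys by (intro braid_conc_right) auto
  then show ?case using Cons by simp
qed simp

lemma conc_tens_closed:
  assumes "a \<in> tensor_power X k" "b \<in> tensor_power X m"
  shows "conc (tens a b) \<in> tensor_power X (k + m)"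
  unfolding conc_tens
  using tensor_power_keys[OF assms(1)] tensor_power_keys[OF assms(2)]
  by (intro lin_ext_in_subspace subspace_tensor_power) auto

lemma matsumoto_block_perm:
  assumes "\<alpha> permutes {..<k}" "\<beta> permutes {..<m}" "a \<in> tensor_power X k" "b \<in> tensor_power X m"
  shows "matsumoto c (k + m) (\<alpha> \<circ> shift_perm k \<beta>) (conc (tens a b))
    = conc (tens (matsumoto c k \<alpha> a) (matsumoto c m \<beta> b))"
proof -
  obtain "is" js where e: "reduced_expr k \<alpha> is" "reduced_expr m \<beta> js"
    using reduced_expr_exists assms(1,2) reduced_expr_iff by metis
  have v: "\<forall>i\<in>set is. Suc i < k" using e(1) assms(1) by (simp add: reduced_expr_iff)
  have "matsumoto c (k + m) (\<alpha> \<circ> shift_perm k \<beta>) (conc (tens a b))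
      = foldr T (is @ map ((+) k) js) (conc (tens a b))"
    by (rule matsumoto_reduced_expr[OF reduced_expr_block_perm[OF assms(1,2) e] conc_tens_closed[OF assms(3,4)]])
  also have "\<dots> = conc (tens (foldr T is a) (foldr T js b))"
    by (simp add: foldr_conc_right[OF assms(3)] foldr_conc_left[OF v assms(3)] del: foldr_map)
  finally show ?thesis
    using matsumoto_reduced_expr[OF assms(1) e(1) assms(3)] matsumoto_reduced_expr[OF assms(2) e(2) assms(4)]
    by simp
qed

lemma block_symmetrizer:
  assumes "a \<in> tensor_power X k" "b \<in> tensor_power X m"
  shows "(\<Sum>\<pi>\<in>block_perms (k + m) k. matsumoto c (k + m) \<pi> (conc (tens a b)))
    = conc (tens (quantum_symmetrizer c k a) (quantum_symmetrizer c m b))"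
proof -
  have "(\<Sum>\<pi>\<in>block_perms (k + m) k. matsumoto c (k + m) \<pi> (conc (tens a b)))
      = (\<Sum>(\<alpha>, \<beta>)\<in>perms k \<times> perms m. matsumoto c (k + m) (\<alpha> \<circ> shift_perm k \<beta>) (conc (tens a b)))"
    by (subst sum.reindex_bij_betw[OF bij_betw_block_perms, symmetric]) (simp add: case_prod_unfold)
  also have "\<dots> = (\<Sum>(\<alpha>, \<beta>)\<in>perms k \<times> perms m. conc (tens (matsumoto c k \<alpha> a) (matsumoto c m \<beta> b)))"
    using assms by (intro sum.cong) (auto simp: matsumoto_block_perm)
  also have "\<dots> = conc (tens (quantum_symmetrizer c k a) (quantum_symmetrizer c m b))"
    unfolding quantum_symmetrizer_def tens_sum_left
    unfolding tens_sum_right conc_def lin_ext_sum by (rule sum.cartesian_product[symmetric])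
  finally show ?thesis .
qed

text \<open>The quantum symmetrizer is the symmetrizer of \<open>S\<^sub>k \<times> S\<^sub>m\<close> composed with the sum over the coset
  representatives.\<close>

lemma symmetrizer_factor:
  assumes "k \<le> n" "u \<in> tensor_power X n"
  shows "\<exists>v\<in>tensor_power X n. quantum_symmetrizer c n u = (\<Sum>\<pi>\<in>block_perms n k. matsumoto c n \<pi> v)"
proof -
  let ?v = "\<Sum>\<tau>\<in>coset_reps n k. matsumoto c n \<tau> u"
  have "?v \<in> tensor_power X n"
    by (rule pm.subspace_sum[OF subspace_tensor_power])
      (use assms in \<open>auto simp: coset_reps_def intro: matsumoto_closed\<close>)
  moreover have "quantum_symmetrizer c n u
      = (\<Sum>(\<pi>, \<tau>)\<in>block_perms n k \<times> coset_reps n k. matsumoto c n (\<pi> \<circ> \<tau>) u)"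
    unfolding quantum_symmetrizer_def
    by (subst sum.reindex_bij_betw[OF bij_betw_block_coset[OF assms(1)], symmetric]) (simp add: case_prod_unfold)
  moreover have "\<dots> = (\<Sum>(\<pi>, \<tau>)\<in>block_perms n k \<times> coset_reps n k. matsumoto c n \<pi> (matsumoto c n \<tau> u))"
    using assms by (intro sum.cong) (auto simp: matsumoto_block_comp)
  moreover have "\<dots> = (\<Sum>\<pi>\<in>block_perms n k. matsumoto c n \<pi> ?v)"
  proof -
    have "matsumoto c n \<pi> ?v = (\<Sum>\<tau>\<in>coset_reps n k. matsumoto c n \<pi> (matsumoto c n \<tau> u))" for \<pi>
      by (subst (1 2) matsumoto_lin_ext) (simp add: lin_ext_sum)
    then show ?thesis by (simp add: sum.cartesian_product)
  qed
  ultimately show ?thesis by metis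
qed

lemma symmetrizer_in_nichols: "u \<in> tensor_power X n \<Longrightarrow> quantum_symmetrizer c n u \<in> nichols c X"
  unfolding nichols_def by (rule pm.span_base) blast

lemma subspace_nichols: "pm.subspace (nichols c X)"
  unfolding nichols_def by (rule pm.subspace_span)

text \<open>Cutting all words after \<open>k\<close> letters turns the image of the symmetrizer of \<open>S\<^sub>k \<times> S\<^sub>m\<close> into the
  tensor product of the images of the two quantum symmetrizers. Summed over \<open>k\<close>, this makes the
  Nichols algebra a subcoalgebra of the words with deconcatenation.\<close>

lemma symmetrizer_cut:
  assumes "k \<le> n" "u \<in> tensor_power X n"
  shows "lin_ext (\<lambda>w. bas (take k w, drop k w)) (quantum_symmetrizer c n u)
    \<in> pm.span {tens a b | a b. a \<in> nichols c X \<and> b \<in> nichols c X}"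
proof -
  let ?D = "lin_ext (\<lambda>w. bas (take k w, drop k w)) :: _ \<Rightarrow> ('x list \<times> 'x list \<Rightarrow>\<^sub>0 'k)"
  have n: "n = k + (n - k)" using assms(1) by simp
  obtain v where v: "v \<in> tensor_power X n"
    and eq: "quantum_symmetrizer c n u = (\<Sum>\<pi>\<in>block_perms n k. matsumoto c n \<pi> v)"
    using symmetrizer_factor[OF assms] by blast
  have "?D (quantum_symmetrizer c n u)
      = lin_ext (\<lambda>w. ?D (\<Sum>\<pi>\<in>block_perms n k. matsumoto c n \<pi> (bas w))) v"
    unfolding eq by (subst matsumoto_lin_ext) (simp add: lin_ext_sum_fun[symmetric] lin_ext_lin_ext)
  also have "\<dots> \<in> pm.span {tens a b | a b. a \<in> nichols c X \<and> b \<in> nichols c X}"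
  proof (rule lin_ext_in_subspace[OF pm.subspace_span])
    fix w assume "w \<in> supp v"
    then have w: "set w \<subseteq> X" "length w = n" using tensor_power_keys[OF v] by auto
    let ?a = "bas (take k w) :: 'x list \<Rightarrow>\<^sub>0 'k" let ?b = "bas (drop k w) :: 'x list \<Rightarrow>\<^sub>0 'k"
    have ab: "?a \<in> tensor_power X k" "?b \<in> tensor_power X (n - k)"
      using w assms(1) set_take_subset[of k w] set_drop_subset[of k w] by auto
    have "(\<Sum>\<pi>\<in>block_perms n k. matsumoto c n \<pi> (bas w))
        = conc (tens (quantum_symmetrizer c k ?a) (quantum_symmetrizer c (n - k) ?b))"
      using block_symmetrizer[OF ab] n by (simp add: conc_def)
    moreover have "?D (conc (tens a b)) = tens a b" if "a \<in> tensor_power X k" for a b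
    proof -
      have "?D (conc (tens a b)) = lin_ext (\<lambda>u. lin_ext (\<lambda>w. bas (u, w)) b) a"
        unfolding conc_tens lin_ext_lin_ext
        by (intro lin_ext_cong) (use tensor_power_keys[OF that] in simp)
      then show ?thesis by (simp add: tens_def)
    qed
    ultimately have "?D (\<Sum>\<pi>\<in>block_perms n k. matsumoto c n \<pi> (bas w))
        = tens (quantum_symmetrizer c k ?a) (quantum_symmetrizer c (n - k) ?b)"
      using quantum_symmetrizer_closed[OF ab(1)] by simp
    then show "?D (\<Sum>\<pi>\<in>block_perms n k. matsumoto c n \<pi> (bas w))
        \<in> pm.span {tens a b | a b. a \<in> nichols c X \<and> b \<in> nichols c X}"
      using symmetrizer_in_nichols[OF ab(1)] symmetrizer_in_nichols[OF ab(2)]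
      by (auto intro!: pm.span_base)
  qed
  finally show ?thesis .
qed

lemma nichols_coproduct:
  assumes "b \<in> nichols c X"
  shows "lin_ext (\<lambda>w. \<Sum>i\<le>length w. bas (take i w, drop i w)) b
    \<in> pm.span {tens a b | a b. a \<in> nichols c X \<and> b \<in> nichols c X}"
proof (rule lin_ext_span[OF _ pm.subspace_span])
  show "b \<in> pm.span (\<Union>n. quantum_symmetrizer c n ` tensor_power X n)"
    using assms by (simp add: nichols_def)
  fix a :: "'x list \<Rightarrow>\<^sub>0 'k" assume "a \<in> (\<Union>n. quantum_symmetrizer c n ` tensor_power X n)"
  then obtain n u where u: "u \<in> tensor_power X n" and a: "a = quantum_symmetrizer c n u" by blast
  have "lin_ext (\<lambda>w. \<Sum>i\<le>length w. bas (take i w, drop i w)) a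
      = lin_ext (\<lambda>w. \<Sum>i\<le>n. bas (take i w, drop i w)) a"
    using tensor_power_keys[OF quantum_symmetrizer_closed[OF u]] a by (intro lin_ext_cong) simp
  also have "\<dots> = (\<Sum>i\<le>n. lin_ext (\<lambda>w. bas (take i w, drop i w)) a)"
    by (rule lin_ext_sum_fun)
  also have "\<dots> \<in> pm.span {tens a b | a b. a \<in> nichols c X \<and> b \<in> nichols c X}"
    unfolding a by (rule pm.span_sum) (simp add: symmetrizer_cut[OF _ u])
  finally show "lin_ext (\<lambda>w. \<Sum>i\<le>length w. bas (take i w, drop i w)) a
    \<in> pm.span {tens a b | a b. a \<in> nichols c X \<and> b \<in> nichols c X}" .
qed

lemma nichols_keys:
  assumes "b \<in> nichols c X" "w \<in> supp b"
  shows "set w \<subseteq> X"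
proof -
  have "lin_ext bas b \<in> {u. supp u \<subseteq> {w. set w \<subseteq> X}}"
    using assms(1) unfolding nichols_def
  proof (rule lin_ext_span[OF _ subspace_keys_subset])
    fix a :: "'x list \<Rightarrow>\<^sub>0 'k" assume "a \<in> (\<Union>n. quantum_symmetrizer c n ` tensor_power X n)"
    then obtain n u where "u \<in> tensor_power X n" "a = quantum_symmetrizer c n u" by blast
    then show "lin_ext bas a \<in> {u. supp u \<subseteq> {w. set w \<subseteq> X}}"
      using quantum_symmetrizer_closed[of u n] by (auto simp: tensor_power_def)
  qed
  then show ?thesis using assms(2) by auto
qed

text \<open>The braiding maps a word to a multiple of a word, so a function on words that it leaves invariant
  is constant on the support of every symmetrized word, and these elements span the Nichols
  algebra.\<close>

lemma nichols_graded:
  assumes inv: "\<And>w i. set w \<subseteq> X \<Longrightarrow> Suc i < length w \<Longrightarrow> deg (braid_word i w) = deg w"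
    and b: "b \<in> nichols c X"
  shows "part (\<lambda>w. deg w = z) b \<in> nichols c X"
proof -
  let ?S = "\<Union>n. (\<lambda>w. quantum_symmetrizer c n (bas w)) ` {w. set w \<subseteq> X \<and> length w = n}"
  have homog: "quantum_symmetrizer c n (bas w) \<in> {u. supp u \<subseteq> {w'. set w' \<subseteq> X \<and> length w' = n \<and> deg w' = deg w}}"
      (is "_ \<in> ?K n w") if w: "set w \<subseteq> X" "length w = n" for n w
    unfolding quantum_symmetrizer_def
  proof (rule pm.subspace_sum[OF subspace_keys_subset])
    fix \<sigma> assume "\<sigma> \<in> perms n"
    then have \<sigma>: "\<sigma> permutes {..<n}" by simp
    obtain "is" where e: "reduced_expr n \<sigma> is"
      using reduced_expr_exists[OF \<sigma>] reduced_expr_iff[OF \<sigma>] by blast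
    have "\<forall>i\<in>set is. Suc i < n" using e \<sigma> by (simp add: reduced_expr_iff)
    then have "foldr T is (bas w) \<in> ?K n w"
    proof (induction "is")
      case (Cons i "is")
      have "T i (foldr T is (bas w)) \<in> ?K n w"
      proof (rule lin_ext_in_subspace[OF subspace_keys_subset])
        fix w' assume "w' \<in> supp (foldr T is (bas w))"
        then have w': "set w' \<subseteq> X" "length w' = n" "deg w' = deg w" using Cons by auto
        then show "braid_at c i w' \<in> ?K n w"
          using Cons.prems inv[of w' i] set_braid_word[of w' i] by (auto simp: braid_at_eq)
      qed
      then show ?case by simp
    qed (use w in auto)
    then show "matsumoto c n \<sigma> (bas w) \<in> ?K n w"
      using matsumoto_reduced_expr[OF \<sigma> e, of "bas w"] w by simp
  qed
  have "nichols c X = pm.span ?S"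
  proof
    have "quantum_symmetrizer c n u \<in> pm.span ?S" if u: "u \<in> tensor_power X n" for n u
      by (subst quantum_symmetrizer_lin_ext, rule lin_ext_in_subspace[OF pm.subspace_span])
        (use tensor_power_keys[OF u] in \<open>blast intro: pm.span_base\<close>)
    then show "nichols c X \<subseteq> pm.span ?S"
      unfolding nichols_def by (intro pm.span_minimal pm.subspace_span) auto
    show "pm.span ?S \<subseteq> nichols c X"
      by (intro pm.span_minimal subspace_nichols) (auto intro!: symmetrizer_in_nichols)
  qed
  moreover have "part (\<lambda>w. deg w = z) b \<in> pm.span ?S"
  proof (rule part_span_homogeneous)
    show "b \<in> pm.span ?S" using b calculation by simp
    fix a :: "'x list \<Rightarrow>\<^sub>0 'k" and p p'
    assume "a \<in> ?S" and p: "p \<in> supp a" "p' \<in> supp a"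
    then obtain n w where "set w \<subseteq> X" "length w = n" "a = quantum_symmetrizer c n (bas w)" by blast
    then have "p \<in> {w'. deg w' = deg w}" "p' \<in> {w'. deg w' = deg w}" using homog[of w n] p by blast+
    then show "deg p = deg p'" by simp
  qed
  ultimately show ?thesis by simp
qed

lemma perms_short: "n \<le> 1 \<Longrightarrow> perms n = {id}"
proof
  assume "n \<le> 1"
  then show "perms n \<subseteq> {id}"
    using increasing_permutes_id[of _ n] by (intro subsetI) force
qed (auto simp: permutes_id)

lemma matsumoto_id: "u \<in> tensor_power X n \<Longrightarrow> matsumoto c n id u = u"
  using matsumoto_reduced_expr[of id n "[]" u] by (simp add: permutes_id reduced_expr_iff invs_id)

lemma short_word_in_nichols:
  assumes "set w \<subseteq> X" "length w \<le> 1"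
  shows "bas w \<in> nichols c X"
proof -
  have "quantum_symmetrizer c (length w) (bas w) = bas w"
    unfolding quantum_symmetrizer_def perms_short[OF assms(2)] using assms(1) by (simp add: matsumoto_id)
  then show ?thesis using symmetrizer_in_nichols[of "bas w" "length w"] assms(1) by simp
qed

lemma perms_2: "perms 2 = {id, adj 0}"
proof
  show "perms 2 \<subseteq> {id, adj 0}"
  proof
    fix \<sigma> assume "\<sigma> \<in> perms 2"
    then obtain "is" where "is": "\<forall>i\<in>set is. Suc i < 2" "perm_of_expr is = \<sigma>" "length is = card (invs 2 \<sigma>)"
      using reduced_expr_exists by blast
    have "invs 2 \<sigma> \<subseteq> {(0, 1)}" by (auto simp: invs_def)
    then have "card (invs 2 \<sigma>) \<le> card {(0::nat, 1::nat)}" by (intro card_mono) auto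
    then have "length is \<le> 1" using "is" by simp
    then consider "is = []" | i where "is = [i]" by (cases "is") auto
    then show "\<sigma> \<in> {id, adj 0}" using "is" by cases auto
  qed
  show "{id, adj 0} \<subseteq> perms 2" using adj_permutes[of 0 2] by (simp add: permutes_id)
qed

lemma quantum_symmetrizer_2:
  assumes "x \<in> X" "y \<in> X"
  shows "quantum_symmetrizer c 2 (bas [x, y]) = bas [x, y] + Poly_Mapping.single [ra x y, x] (q x y)"
proof -
  have "pinv (adj 0) (Suc 0) < pinv (adj 0) 0" by simp
  then have "reduced_expr 2 (adj 0) [0]"
    using reduced_expr_ConsI[of "adj 0" 2 0 "[]"] adj_permutes[of 0 2]
    by (simp add: reduced_expr_iff permutes_id invs_id)
  then have "matsumoto c 2 (adj 0) (bas [x, y]) = T 0 (bas [x, y])"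
    using matsumoto_reduced_expr[of "adj 0" 2 "[0]" "bas [x, y]"] assms adj_permutes[of 0 2] by simp
  also have "\<dots> = Poly_Mapping.single [ra x y, x] (q x y)"
    using assms T_single[of "[x, y]" 0 1] by (simp add: braid_word_def del: lin_ext_single)
  finally have 1: "matsumoto c 2 (adj 0) (bas [x, y]) = Poly_Mapping.single [ra x y, x] (q x y)" .
  have "adj 0 0 \<noteq> id (0::nat)" by simp
  then have "id \<noteq> adj 0" by metis
  then show ?thesis
    unfolding quantum_symmetrizer_def perms_2 using 1 matsumoto_id[of "bas [x, y]" 2] assms by simp
qed

end

section \<open>Minimal elements\<close>

text \<open>Minimality without reference to source and target, so that it applies to words as well as to
  paths.\<close>

definition min_elem :: "('p \<Rightarrow>\<^sub>0 'k::field) set \<Rightarrow> ('p \<Rightarrow>\<^sub>0 'k) \<Rightarrow> bool" where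
  "min_elem B u \<longleftrightarrow> u \<in> B \<and> card (supp u) \<ge> 2 \<and>
     (\<forall>I. I \<noteq> {} \<and> I \<subset> supp u \<longrightarrow> part (\<lambda>p. p \<in> I) u \<notin> B)"

lemma minimal_iff: "minimal Q B x y b \<longleftrightarrow> min_elem B b \<and> supp b \<subseteq> paths Q x y"
proof -
  have "(\<Sum>p\<in>I. Poly_Mapping.single p (coef b p)) = part (\<lambda>p. p \<in> I) b"
    if "I \<subset> supp b" for I
    using that by (intro part_eq_sum) auto
  then show ?thesis unfolding minimal_def min_elem_def hom_space_def by auto
qed

text \<open>Otherwise the component of the degree of \<open>p\<close> would be a proper partial sum in \<open>B\<close>.\<close>

lemma min_elem_homogeneous:
  assumes "min_elem B u" "\<And>z. part (\<lambda>p. d p = z) u \<in> B"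
    and "p \<in> supp u" "p' \<in> supp u"
  shows "d p = d p'"
proof -
  let ?I = "{p' \<in> supp u. d p' = d p}"
  have "part (\<lambda>p'. p' \<in> ?I) u = part (\<lambda>p'. d p' = d p) u"
    by (rule poly_mapping_eqI) (auto simp: lookup_part in_keys_iff)
  then have "part (\<lambda>p'. p' \<in> ?I) u \<in> B" using assms(2)[of "d p"] by (simp only:)
  moreover have "?I \<noteq> {}" using assms(3) by blast
  moreover have "I \<noteq> {} \<and> I \<subset> supp u \<longrightarrow> part (\<lambda>p. p \<in> I) u \<notin> B" for I
    using assms(1) by (simp add: min_elem_def)
  ultimately have "\<not> ?I \<subset> supp u" by metis
  then have "?I = supp u" by blast
  then have "p' \<in> ?I" using assms(4) by (simp only:)
  then show ?thesis by simp
qed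

lemma keys_single_subset: "card (supp u) = 1 \<Longrightarrow> \<exists>p t. t \<noteq> 0 \<and> u = Poly_Mapping.single p t"
proof -
  assume "card (supp u) = 1"
  then obtain p where p: "supp u = {p}" by (rule card_1_singletonE)
  have "u = Poly_Mapping.single p (coef u p)"
  proof (rule poly_mapping_eqI)
    fix r
    show "coef u r = coef (Poly_Mapping.single p (coef u p)) r"
    proof (cases "r = p")
      case False
      then have "r \<notin> supp u" using p by simp
      then show ?thesis using False by (simp add: in_keys_iff lookup_single when_def)
    qed simp
  qed
  moreover have "coef u p \<noteq> 0" using p in_keys_iff[of p u] by simp
  ultimately show ?thesis by blast
qed

text \<open>A non-minimal element that is not a monomial splits into two elements with smaller support.\<close>

lemma span_minimal_elements:
  assumes B: "pm.subspace B" and "u \<in> B"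
  shows "u \<in> pm.span {v \<in> B. supp v \<subseteq> supp u \<and> ((\<exists>p. v = bas p) \<or> min_elem B v)}"
    (is "_ \<in> pm.span (?M u)")
  using assms(2)
proof (induction "card (supp u)" arbitrary: u rule: less_induct)
  case less
  have "min_elem B u \<or> (\<exists>I. I \<noteq> {} \<and> I \<subset> supp u \<and> part (\<lambda>p. p \<in> I) u \<in> B)"
    if "2 \<le> card (supp u)"
    using that less.prems unfolding min_elem_def by metis
  moreover have "card (supp u) = 0 \<or> card (supp u) = 1 \<or> 2 \<le> card (supp u)"
    by linarith
  ultimately consider "card (supp u) = 0" | "card (supp u) = 1" | "min_elem B u"
    | I where "I \<noteq> {}" "I \<subset> supp u" "part (\<lambda>p. p \<in> I) u \<in> B"
    by metis
  then show ?case
  proof cases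
    case 1
    then have "u = 0" by simp
    then show ?thesis by (simp add: pm.span_zero)
  next
    case 2
    then obtain p t where pt: "t \<noteq> 0" "u = Poly_Mapping.single p t" using keys_single_subset by blast
    have "pm_scale (inverse t) u \<in> B" using B less.prems by (rule pm.subspace_scale)
    then have "bas p \<in> ?M u" using pt by (simp, blast)
    then have "pm_scale t (bas p) \<in> pm.span (?M u)" by (intro pm.span_scale pm.span_base)
    then show ?thesis using pt by simp
  next
    case 3
    then show ?thesis using less.prems by (intro pm.span_base) simp
  next
    case 4
    let ?v = "part (\<lambda>p. p \<in> I) u" let ?w = "part (\<lambda>p. p \<notin> I) u"
    have u: "u = ?v + ?w" by (rule poly_mapping_eqI) (simp add: lookup_add lookup_part)
    then have "?w = u - ?v" by (metis add_diff_cancel_left')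
    then have w: "?w \<in> B" using pm.subspace_diff[OF B less.prems 4(3)] by simp
    have kv: "supp ?v \<subset> supp u" "supp ?w \<subset> supp u"
      using 4(1,2) by (auto simp: keys_part)
    then have "?v \<in> pm.span (?M ?v)" "?w \<in> pm.span (?M ?w)"
      using 4(3) w by (auto intro!: less.hyps psubset_card_mono)
    moreover have "?M ?v \<subseteq> ?M u" "?M ?w \<subseteq> ?M u" using kv by auto
    ultimately have "?v \<in> pm.span (?M u)" "?w \<in> pm.span (?M u)" using pm.span_mono by blast+
    then have "?v + ?w \<in> pm.span (?M u)" by (rule pm.span_add)
    then show ?thesis by (simp only: u[symmetric])
  qed
qed

lemma min_elem_relabel:
  assumes inj: "inj_on h S" and keys: "supp u \<subseteq> S"
    and iff: "\<And>v. supp v \<subseteq> S \<Longrightarrow> lin_ext (\<lambda>p. bas (h p)) v \<in> B' \<longleftrightarrow> v \<in> B"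
  shows "min_elem B' (lin_ext (\<lambda>p. bas (h p)) u) \<longleftrightarrow> min_elem B u"
proof -
  let ?L = "lin_ext (\<lambda>p. bas (h p))"
  have inju: "inj_on h (supp u)" by (rule inj_on_subset[OF inj keys])
  have ku: "supp (?L u) = h ` supp u" by (rule keys_lin_ext_inj[OF inju])
  have part: "part (\<lambda>p. p \<in> h ` J) (?L u) = ?L (part (\<lambda>p. p \<in> J) u)" if J: "J \<subseteq> supp u" for J
  proof -
    have "part (\<lambda>p. p \<in> h ` J) (?L u) = lin_ext (\<lambda>p. if h p \<in> h ` J then bas (h p) else 0) u"
      unfolding part_def lin_ext_lin_ext by (rule lin_ext_cong) simp
    also have "\<dots> = lin_ext (\<lambda>p. if p \<in> J then bas (h p) else 0) u"
    proof (rule lin_ext_cong)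
      fix p assume "p \<in> supp u"
      then show "(if h p \<in> h ` J then bas (h p) else 0) = (if p \<in> J then bas (h p) else 0)"
        using inj_on_image_mem_iff[OF inju _ J] by simp
    qed
    also have "\<dots> = ?L (part (\<lambda>p. p \<in> J) u)"
      unfolding part_def lin_ext_lin_ext by (rule lin_ext_cong) simp
    finally show ?thesis .
  qed
  have member: "part (\<lambda>p. p \<in> h ` J) (?L u) \<in> B' \<longleftrightarrow> part (\<lambda>p. p \<in> J) u \<in> B"
    if "J \<subseteq> supp u" for J
    using part[OF that] iff[of "part (\<lambda>p. p \<in> J) u"] keys by (auto simp: keys_part)
  have "(\<forall>I. I \<noteq> {} \<and> I \<subset> h ` supp u \<longrightarrow> part (\<lambda>p. p \<in> I) (?L u) \<notin> B')
      \<longleftrightarrow> (\<forall>J. J \<noteq> {} \<and> J \<subset> supp u \<longrightarrow> part (\<lambda>p. p \<in> J) u \<notin> B)" (is "?lhs \<longleftrightarrow> ?rhs")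
  proof
    assume lhs: ?lhs
    show ?rhs
    proof (intro allI impI)
      fix J assume J: "J \<noteq> {} \<and> J \<subset> supp u"
      then have "h ` J \<noteq> {} \<and> h ` J \<subset> h ` supp u"
        using inj_on_image_eq_iff[OF inju, of J "supp u"] by auto
      then have "part (\<lambda>p. p \<in> h ` J) (?L u) \<notin> B'" by (rule lhs[rule_format])
      then show "part (\<lambda>p. p \<in> J) u \<notin> B" using member[OF psubset_imp_subset] J by blast
    qed
  next
    assume rhs: ?rhs
    show ?lhs
    proof (intro allI impI)
      fix I assume I: "I \<noteq> {} \<and> I \<subset> h ` supp u"
      then obtain J where J: "J \<subseteq> supp u" "I = h ` J" by (meson subset_imageE psubset_imp_subset)
      then have J': "J \<noteq> {} \<and> J \<subset> supp u" using I by auto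
      then have "part (\<lambda>p. p \<in> J) u \<notin> B" by (rule rhs[rule_format])
      then show "part (\<lambda>p. p \<in> I) (?L u) \<notin> B'" using member[OF J(1)] J(2) by simp
    qed
  qed
  moreover have "card (supp (?L u)) = card (supp u)"
    unfolding ku by (rule card_image[OF inju])
  ultimately show ?thesis unfolding min_elem_def ku iff[OF keys] by simp
qed

section \<open>Paths in the loop quiver\<close>

lemma loop_quiver_simps [simp]:
  "verts (loop_quiver X) = {()}" "arcs (loop_quiver X) = X"
  "tail (loop_quiver X) a = ()" "head (loop_quiver X) a = ()"
  by (simp_all add: loop_quiver_def)

lemma paths_loop_quiver: "paths (loop_quiver X) x y = {(x, w). set w \<subseteq> X}"
proof -
  have "pre_digraph.cas (loop_quiver X) x w y" for x y w
    by (induction w arbitrary: x) (auto simp: pre_digraph.cas.simps)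
  then show ?thesis by (auto simp: paths_def pre_digraph.awalk_def)
qed

definition path_word :: "((unit, 'x) path \<Rightarrow>\<^sub>0 'k::field) \<Rightarrow> ('x list \<Rightarrow>\<^sub>0 'k)" where
  "path_word = lin_ext (\<lambda>p. bas (snd p))"

lemma path_word_word_path [simp]: "path_word (word_path u) = u"
  by (simp add: path_word_def word_path_def lin_ext_lin_ext)

lemma word_path_path_word [simp]: "word_path (path_word b) = b"
proof -
  have "((), snd p) = p" for p :: "(unit, 'a) path" by (cases p) simp
  then show ?thesis by (simp add: path_word_def word_path_def lin_ext_lin_ext)
qed

lemma keys_word_path: "supp (word_path u) = (\<lambda>w. ((), w)) ` supp u"
  unfolding word_path_def by (rule keys_lin_ext_inj) (simp add: inj_on_def)

lemma in_nichols_paths_iff: "b \<in> nichols_paths c X \<longleftrightarrow> path_word b \<in> nichols c X"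
  unfolding nichols_paths_def using path_word_word_path word_path_path_word by (metis image_iff)

lemma word_path_in_nichols_paths [simp]: "word_path u \<in> nichols_paths c X \<longleftrightarrow> u \<in> nichols c X"
  by (simp add: in_nichols_paths_iff)

lemma min_elem_word_path_image: "min_elem (word_path ` N) (word_path u) \<longleftrightarrow> min_elem N u"
proof -
  have "word_path v \<in> word_path ` N \<longleftrightarrow> v \<in> N" for v
    using path_word_word_path by (metis image_iff)
  then show ?thesis
    unfolding word_path_def by (intro min_elem_relabel[of _ UNIV]) (auto simp: inj_on_def)
qed

lemma min_elem_word_path: "min_elem (nichols_paths c X) (word_path u) \<longleftrightarrow> min_elem (nichols c X) u"
  unfolding nichols_paths_def by (rule min_elem_word_path_image)

section \<open>The enveloping group as a grading group\<close>

lemma (in generator_map) word_degree_braid_word: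
  assumes "rack_type_braiding X ra q c"
    and rel: "\<And>x y. x \<in> X \<Longrightarrow> y \<in> X \<Longrightarrow> d (ra x y) \<otimes> d x = d x \<otimes> d y"
    and w: "set w \<subseteq> X" "Suc i < length w"
  shows "word_degree H d (rack_type_braiding.braid_word ra i w) = word_degree H d w"
proof -
  interpret rack_type_braiding X ra q c by fact
  let ?u = "take i w" and ?x = "w ! i" and ?y = "w ! Suc i" and ?v = "drop (Suc (Suc i)) w"
  have X: "?x \<in> X" "?y \<in> X" "set ?u \<subseteq> X" "set ?v \<subseteq> X"
    using w set_take_subset[of i w] set_drop_subset[of "Suc (Suc i)" w] by (auto dest: nth_mem)
  have 1: "w = ?u @ [?x, ?y] @ ?v"
    using w(2) by (metis Cons_nth_drop_Suc Suc_lessD append_Cons append_Nil append_take_drop_id)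
  have "braid_word (length u) (u @ [a, b] @ v) = u @ [ra a b, a] @ v" for u a b v
    by (simp add: braid_word_def list_update_append nth_append)
  from this[of ?u ?x ?y ?v] have 2: "braid_word i w = ?u @ [ra ?x ?y, ?x] @ ?v"
    using w(2) by (simp only: 1[symmetric]) simp
  have "word_degree H d (?u @ [a, b] @ ?v)
      = word_degree H d ?u \<otimes> ((d a \<otimes> d b) \<otimes> word_degree H d ?v)" if "a \<in> X" "b \<in> X" for a b
    using that X by (simp add: word_degree_append d_closed word_degree_closed m_assoc)
  then have "word_degree H d (braid_word i w) = word_degree H d (?u @ [?x, ?y] @ ?v)"
    unfolding 2 using X rel[of ?x ?y] by (simp add: ra_closed del: append_Cons append_Nil)
  then show ?thesis using 1 by simp
qed

lemma hom_comp: "f \<in> hom A B \<Longrightarrow> g \<in> hom B C \<Longrightarrow> (\<lambda>x. g (f x)) \<in> hom A C"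
  by (auto simp: hom_def Pi_def)

lemma hom_ident: "(\<lambda>x. x) \<in> hom A A"
  by (simp add: hom_def)

lemma iso_of_inverse_homs:
  assumes "f \<in> hom A B" "g \<in> hom B A"
    and "\<And>x. x \<in> carrier A \<Longrightarrow> g (f x) = x" "\<And>y. y \<in> carrier B \<Longrightarrow> f (g y) = y"
  shows "f \<in> iso A B"
  unfolding iso_def using assms
  by (auto simp: hom_def intro!: bij_betw_byWitness[where f' = g])

text \<open>The standing assumptions: a Yetter-Drinfeld module whose degrees are distinct, form a union
  of conjugacy classes and generate the group.\<close>

locale rack_yd_module = group G for G (structure) +
  fixes X :: "'a set" and D :: "('a, 'a, 'k::field) yd_struct"
    and c :: "'a \<Rightarrow> 'a \<Rightarrow> ('a \<times> 'a \<Rightarrow>\<^sub>0 'k)" and q :: "'a \<Rightarrow> 'a \<Rightarrow> 'k"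
  assumes X_closed: "X \<subseteq> carrier G" and finite_X: "finite X"
    and conj_closed: "g \<in> carrier G \<Longrightarrow> x \<in> X \<Longrightarrow> conjugate G g x \<in> X"
    and generates: "generate G X = carrier G"
    and yd: "yetter_drinfeld G X D"
    and coact: "x \<in> X \<Longrightarrow> yd_coact D x = bas (x, x)"
    and c_braiding: "c = yd_braiding D"
    and q_nonzero: "x \<in> X \<Longrightarrow> y \<in> X \<Longrightarrow> q x y \<noteq> 0"
    and c_rack: "x \<in> X \<Longrightarrow> y \<in> X \<Longrightarrow> c x y = Poly_Mapping.single (conjugate G x y, x) (q x y)"
begin

lemma conjugate_mult: "g \<in> carrier G \<Longrightarrow> y \<in> carrier G \<Longrightarrow> conjugate G g y \<otimes> g = g \<otimes> y"
  by (simp add: conjugate_def m_assoc)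

lemma act_generator:
  assumes "x \<in> X" "y \<in> X"
  shows "yd_act D x y = Poly_Mapping.single (conjugate G x y) (q x y)"
proof (rule poly_mapping_eqI)
  fix z
  have "c x y = lin_ext (\<lambda>y'. bas (y', x)) (yd_act D x y)"
    unfolding c_braiding yd_braiding_def by (simp add: coact[OF assms(1)])
  then have "coef (yd_act D x y) z = coef (c x y) (z, x)"
    using lookup_lin_ext_inj[of "\<lambda>y'. (y', x)" "yd_act D x y" z] by (simp add: inj_on_def)
  then show "coef (yd_act D x y) z
      = coef (Poly_Mapping.single (conjugate G x y) (q x y)) z"
    using c_rack[OF assms] by (simp add: lookup_single when_def)
qed

sublocale rack_type_braiding X "conjugate G" q c
proof
  show "conjugate G x y \<in> X" if "x \<in> X" "y \<in> X" for x y using that X_closed conj_closed by blast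
  show "c x y = Poly_Mapping.single (conjugate G x y, x) (q x y)" if "x \<in> X" "y \<in> X" for x y
    using that by (rule c_rack)
  \<comment> \<open>Both remaining conditions come from letting \<open>x y = (x \<triangleright> y) x\<close> act on \<open>v\<^sub>z\<close>.\<close>
  fix x y z assume X: "x \<in> X" "y \<in> X" "z \<in> X"
  then have cl: "x \<in> carrier G" "y \<in> carrier G" "z \<in> carrier G" using X_closed by auto
  have X': "conjugate G x y \<in> X" "conjugate G x z \<in> X" "conjugate G y z \<in> X" using X cl conj_closed by auto
  have act_mult: "yd_act D (g \<otimes> h) z = lin_ext (yd_act D g) (yd_act D h z)"
    if "g \<in> carrier G" "h \<in> carrier G" for g h
    using yd that X(3) unfolding yetter_drinfeld_def by blast
  have "yd_act D (x \<otimes> y) z = yd_act D (conjugate G x y \<otimes> x) z"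
    using cl by (simp add: conjugate_mult)
  then have "lin_ext (yd_act D x) (yd_act D y z) = lin_ext (yd_act D (conjugate G x y)) (yd_act D x z)"
    using act_mult cl X' X_closed by (metis subsetD)
  then have e: "Poly_Mapping.single (conjugate G x (conjugate G y z)) (q y z * q x (conjugate G y z))
      = Poly_Mapping.single (conjugate G (conjugate G x y) (conjugate G x z)) (q x z * q (conjugate G x y) (conjugate G x z))"
    using X X' by (simp add: act_generator)
  have nz: "q y z * q x (conjugate G y z) \<noteq> 0" "q x z * q (conjugate G x y) (conjugate G x z) \<noteq> 0"
    using X X' q_nonzero by auto
  have "supp (Poly_Mapping.single (conjugate G x (conjugate G y z)) (q y z * q x (conjugate G y z)))
      = supp (Poly_Mapping.single (conjugate G (conjugate G x y) (conjugate G x z)) (q x z * q (conjugate G x y) (conjugate G x z)))"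
    using e by (rule arg_cong)
  then show ra: "conjugate G x (conjugate G y z) = conjugate G (conjugate G x y) (conjugate G x z)"
    unfolding keys_single using nz by (simp split: if_splits)
  have "coef (Poly_Mapping.single (conjugate G x (conjugate G y z)) (q y z * q x (conjugate G y z))) (conjugate G x (conjugate G y z))
      = coef (Poly_Mapping.single (conjugate G (conjugate G x y) (conjugate G x z)) (q x z * q (conjugate G x y) (conjugate G x z))) (conjugate G x (conjugate G y z))"
    using e by (rule arg_cong)
  then show "q x z * q (conjugate G x y) (conjugate G x z) = q y z * q x (conjugate G y z)"
    unfolding ra by simp
qed

lemma rack_type: "rack_type_braiding X (conjugate G) q c" by (rule rack_type_braiding_axioms)

lemma rack_braiding_inj: "inj_on (rack_braiding G) (X \<times> X)"
proof (rule inj_onI)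
  fix p p' assume "p \<in> X \<times> X" "p' \<in> X \<times> X" and e: "rack_braiding G p = rack_braiding G p'"
  then obtain x y y' where p: "p = (x, y)" "p' = (x, y')" "x \<in> X" "y \<in> X" "y' \<in> X"
      and "conjugate G x y = conjugate G x y'"
    by (auto simp: rack_braiding_def)
  then have "x \<otimes> y = x \<otimes> y'" using conjugate_mult X_closed by (metis subsetD)
  then show "p = p'" using p subsetD[OF X_closed] by auto
qed

lemma rack_braiding_closed: "p \<in> X \<times> X \<Longrightarrow> rack_braiding G p \<in> X \<times> X"
  by (auto simp: rack_braiding_def ra_closed)

lemma orbit_closed: "p \<in> X \<times> X \<Longrightarrow> orbit (rack_braiding G) p \<subseteq> X \<times> X"
proof
  fix z assume p: "p \<in> X \<times> X" and "z \<in> orbit (rack_braiding G) p"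
  from this(2) show "z \<in> X \<times> X"
  proof induction
    case base
    show ?case by (rule rack_braiding_closed[OF p])
  next
    case (step z)
    then show ?case by (intro rack_braiding_closed)
  qed
qed

text \<open>The braiding of the rack is injective on the finite set \<open>X \<times> X\<close>; hence orbits are cycles, and
  they contain their starting point although the latter is not put into them by definition.\<close>

lemma orbit_image:
  assumes "p \<in> X \<times> X"
  shows "p \<in> orbit (rack_braiding G) p" "rack_braiding G ` orbit (rack_braiding G) p = orbit (rack_braiding G) p"
proof -
  let ?O = "orbit (rack_braiding G) p" let ?O1 = "insert p ?O"
  have sub: "?O1 \<subseteq> X \<times> X" using assms orbit_closed by blast
  have fin: "finite ?O1" by (rule finite_subset[OF sub]) (simp add: finite_X)
  have im: "rack_braiding G ` ?O1 \<subseteq> ?O" by (auto intro: orbit.intros)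
  have "card (rack_braiding G ` ?O1) = card ?O1"
    by (rule card_image[OF inj_on_subset[OF rack_braiding_inj sub]])
  moreover have "card (rack_braiding G ` ?O1) \<le> card ?O" using im fin by (intro card_mono) auto
  ultimately have "card ?O1 \<le> card ?O" by simp
  then have O: "?O1 = ?O" using card_seteq[of ?O1 ?O] fin by blast
  then show "p \<in> ?O" by blast
  show "rack_braiding G ` ?O = ?O"
  proof (rule card_seteq)
    show "finite ?O" using fin by simp
    show "rack_braiding G ` ?O \<subseteq> ?O" using im by blast
    have "?O \<subseteq> X \<times> X" using sub by blast
    then show "card ?O \<le> card (rack_braiding G ` ?O)"
      using card_image[OF inj_on_subset[OF rack_braiding_inj]] by simp
  qed
qed

text \<open>A kernel vector \<open>u\<close> of \<open>1 + c\<close> on an orbit has full support, because \<open>c\<close> permutes the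
  lines spanned by the basis vectors of the orbit cyclically. The functional with values
  \<open>1 / u\<^sub>p\<close> on the orbit therefore vanishes on the image of \<open>1 + c\<close>, so no basis vector of the
  orbit lies in the Nichols algebra.\<close>

lemma orbit_monomial_not_in_nichols:
  assumes full: "full_quadratic_relations G X c"
    and xy: "x \<in> X" "y \<in> X" "(conjugate G x y, x) \<noteq> (x, y)"
    and ab: "(a, b) \<in> orbit (rack_braiding G) (x, y)" and t: "t \<noteq> 0"
  shows "Poly_Mapping.single [a, b] t \<notin> nichols c X"
proof -
  let ?f = "rack_braiding G" let ?O = "orbit ?f (x, y)"
  have p: "(x, y) \<in> X \<times> X" using xy by simp
  have OX: "?O \<subseteq> X \<times> X" by (rule orbit_closed[OF p])
  have "?O \<noteq> {(z, z)}" for z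
  proof
    assume "?O = {(z, z)}"
    then have "?f (x, y) = (z, z)" "(x, y) = (z, z)" using orbit.base[of ?f "(x, y)"] orbit_image(1)[OF p] by auto
    then show False using xy(3) by (simp add: rack_braiding_def)
  qed
  then have "{u. u + lin_ext (\<lambda>(x, y). c x y) u = 0} \<inter> {u. supp u \<subseteq> ?O} \<noteq> {0}"
    using full p unfolding full_quadratic_relations_def by blast
  moreover have "0 \<in> {u. u + lin_ext (\<lambda>(x, y). c x y) u = 0} \<inter> {u. supp u \<subseteq> ?O}" by simp
  ultimately obtain u where u: "u + lin_ext (\<lambda>(x, y). c x y) u = 0" "supp u \<subseteq> ?O" "u \<noteq> 0"
    by blast
  let ?a = "coef u"
  have rec: "?a (?f z) = - q (fst z) (snd z) * ?a z" if z: "z \<in> X \<times> X" for z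
  proof -
    have "coef (lin_ext (\<lambda>(x, y). c x y) u) (?f z)
        = (\<Sum>z'\<in>supp u. if z' = z then ?a z * q (fst z) (snd z) else 0)"
      unfolding lookup_lin_ext
    proof (rule sum.cong)
      fix z' assume "z' \<in> supp u"
      then have z': "z' \<in> X \<times> X" using u(2) OX by blast
      then have "?f z' = ?f z \<longleftrightarrow> z' = z" using inj_on_eq_iff[OF rack_braiding_inj z' z] by simp
      moreover have "(case z' of (x, y) \<Rightarrow> c x y) = Poly_Mapping.single (?f z') (q (fst z') (snd z'))"
        using z' by (auto simp: c_rack rack_braiding_def)
      ultimately show "?a z' * coef (case z' of (x, y) \<Rightarrow> c x y) (?f z)
          = (if z' = z then ?a z * q (fst z) (snd z) else 0)"
        by (simp add: lookup_single when_def)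
    qed simp
    also have "\<dots> = ?a z * q (fst z) (snd z)" by (simp add: in_keys_iff)
    finally have "?a (?f z) + ?a z * q (fst z) (snd z) = coef (u + lin_ext (\<lambda>(x, y). c x y) u) (?f z)"
      by (simp add: lookup_add)
    then show ?thesis using u(1) by (simp add: eq_neg_iff_add_eq_0 mult.commute)
  qed
  have rec_iff: "?a (?f z) \<noteq> 0 \<longleftrightarrow> ?a z \<noteq> 0" if "z \<in> X \<times> X" for z
    using rec[OF that] q_nonzero[of "fst z" "snd z"] that by auto
  have iff: "?a z \<noteq> 0 \<longleftrightarrow> ?a (x, y) \<noteq> 0" if "z \<in> ?O" for z
    using that
  proof induction
    case base
    show ?case by (rule rec_iff[OF p])
  next
    case (step z)
    then show ?case using rec_iff[of z] OX by blast
  qed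
  obtain z0 where "z0 \<in> supp u" using u(3) by (metis all_not_in_conv keys_eq_empty)
  then have nz: "?a z \<noteq> 0" if "z \<in> ?O" for z
    using iff[of z0] iff[OF that] u(2) by (auto simp: in_keys_iff)
  \<comment> \<open>The functional, extended by zero to the words outside the orbit.\<close>
  define \<psi> where "\<psi> w = (if length w = 2 \<and> (w ! 0, w ! 1) \<in> ?O then inverse (?a (w ! 0, w ! 1)) else 0)" for w
  let ?\<Psi> = "lin_ext (\<lambda>w. Poly_Mapping.single () (\<psi> w))"
  have zero: "?\<Psi> v = 0" if "v \<in> nichols c X" for v
  proof -
    have "?\<Psi> v \<in> {0}"
    proof (rule lin_ext_span[OF that[unfolded nichols_def]])
      fix s :: "'a list \<Rightarrow>\<^sub>0 'k" assume "s \<in> (\<Union>n. quantum_symmetrizer c n ` tensor_power X n)"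
      then obtain n v where v: "v \<in> tensor_power X n" and s: "s = quantum_symmetrizer c n v" by blast
      show "?\<Psi> s \<in> {0}"
      proof (cases "n = 2")
        case False
        have "?\<Psi> s = lin_ext (\<lambda>w. 0) s"
          using tensor_power_keys[OF quantum_symmetrizer_closed[OF v]] False s
          by (intro lin_ext_cong) (auto simp: \<psi>_def)
        then show ?thesis by simp
      next
        case True
        have "?\<Psi> s = lin_ext (\<lambda>w. ?\<Psi> (quantum_symmetrizer c 2 (bas w))) v"
          unfolding s True by (subst quantum_symmetrizer_lin_ext) (rule lin_ext_lin_ext)
        also have "\<dots> = lin_ext (\<lambda>w. 0) v"
        proof (rule lin_ext_cong)
          fix w assume "w \<in> supp v"
          then have "set w \<subseteq> X" "length w = 2" using tensor_power_keys[OF v] True by auto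
          then obtain x' y' where w: "w = [x', y']" and X': "x' \<in> X" "y' \<in> X"
            by (auto simp: length_Suc_conv numeral_2_eq_2)
          have z: "(x', y') \<in> X \<times> X" using X' by simp
          have "?f (x', y') \<in> ?O \<longleftrightarrow> (x', y') \<in> ?O"
            using orbit_image(2)[OF p] inj_on_image_mem_iff[OF rack_braiding_inj z OX] by simp
          then have "\<psi> [x', y'] + q x' y' * \<psi> [conjugate G x' y', x'] = 0"
            using rec[OF z] nz[of "(x', y')"] q_nonzero[OF X'] by (auto simp: \<psi>_def rack_braiding_def field_simps)
          then show "?\<Psi> (quantum_symmetrizer c 2 (bas w)) = 0"
            unfolding w quantum_symmetrizer_2[OF X'] by (simp add: lin_ext_add single_add[symmetric])
        qed
        finally show ?thesis by simp
      qed
    qed (simp add: pm.subspace_single_0)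
    then show ?thesis by simp
  qed
  have "t * \<psi> [a, b] \<noteq> 0" using nz[OF ab] ab t by (simp add: \<psi>_def)
  then have "coef (?\<Psi> (Poly_Mapping.single [a, b] t)) () \<noteq> 0" by simp
  then have "?\<Psi> (Poly_Mapping.single [a, b] t) \<noteq> 0" by (metis lookup_zero)
  then show ?thesis using zero by blast
qed

text \<open>Proper partial sums of the two-term element \<open>(1 + c)(v\<^sub>x \<otimes> v\<^sub>y)\<close> are monomials of the orbit.\<close>

lemma quadratic_min_elem:
  assumes full: "full_quadratic_relations G X c"
    and xy: "x \<in> X" "y \<in> X" "(conjugate G x y, x) \<noteq> (x, y)"
  shows "\<exists>v. min_elem (nichols c X) v \<and> [x, y] \<in> supp v \<and> [conjugate G x y, x] \<in> supp v"
proof -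
  let ?w = "[x, y]" and ?w' = "[conjugate G x y, x]"
  let ?v = "quantum_symmetrizer c 2 (bas ?w)"
  have v: "?v = bas ?w + Poly_Mapping.single ?w' (q x y)" by (rule quantum_symmetrizer_2[OF xy(1,2)])
  have ne: "?w \<noteq> ?w'" using xy(3) by auto
  have keys: "supp ?v = {?w, ?w'}"
    unfolding v using ne q_nonzero[OF xy(1,2)] by (auto simp: in_keys_iff lookup_add lookup_single when_def split: if_splits)
  have "?v \<in> nichols c X" using xy by (intro symmetrizer_in_nichols) simp
  moreover have "part (\<lambda>w. w \<in> I) ?v \<notin> nichols c X" if I: "I \<noteq> {}" "I \<subset> {?w, ?w'}" for I
  proof -
    have "(x, y) \<in> orbit (rack_braiding G) (x, y)" using xy orbit_image(1) by blast
    moreover have "(conjugate G x y, x) \<in> orbit (rack_braiding G) (x, y)"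
      using orbit.base[of "rack_braiding G" "(x, y)"] by (simp add: rack_braiding_def)
    ultimately have no: "Poly_Mapping.single ?w 1 \<notin> nichols c X" "Poly_Mapping.single ?w' (q x y) \<notin> nichols c X"
      using orbit_monomial_not_in_nichols[OF full xy] q_nonzero[OF xy(1,2)] by simp_all
    consider "I = {?w}" | "I = {?w'}" using I by blast
    then show ?thesis
    proof cases
      case 1
      have "part (\<lambda>w. w \<in> I) ?v = bas ?w"
        unfolding v 1 using ne by (intro poly_mapping_eqI) (auto simp: lookup_part lookup_add lookup_single when_def)
      then show ?thesis using no by simp
    next
      case 2
      have "part (\<lambda>w. w \<in> I) ?v = Poly_Mapping.single ?w' (q x y)"
        unfolding v 2 using ne by (intro poly_mapping_eqI) (auto simp: lookup_part lookup_add lookup_single when_def)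
      then show ?thesis using no by simp
    qed
  qed
  ultimately have "min_elem (nichols c X) ?v" unfolding min_elem_def keys using ne by simp
  then show ?thesis using keys by blast
qed

lemma enveloping_relators_closed: "enveloping_relators G X \<subseteq> carrier (free_group X)"
proof -
  interpret F: group "free_group X" by (rule group_free_group)
  show ?thesis unfolding enveloping_relators_def
    by (auto simp del: free_group_simps intro!: F.m_closed F.inv_closed pos_word_carrier simp: ra_closed)
qed

sublocale E: presentation X "enveloping_relators G X"
  by unfold_locales (rule enveloping_relators_closed)

abbreviation "GX \<equiv> enveloping_group G X"
abbreviation "gx \<equiv> enveloping_gen G X"

lemma GX_eq: "GX = E.P" and gx_eq: "gx = E.gen"
  by (simp_all add: enveloping_group_def enveloping_gen_def)

sublocale GX: group GX unfolding GX_eq by (rule E.P.is_group)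

sublocale gx: generator_map GX X gx
  unfolding GX_eq gx_eq by (rule E.gen.generator_map_axioms)

lemma hom_eq_on_gx:
  "group H \<Longrightarrow> f \<in> hom GX H \<Longrightarrow> f' \<in> hom GX H \<Longrightarrow> (\<And>x. x \<in> X \<Longrightarrow> f (gx x) = f' (gx x)) \<Longrightarrow>
     g \<in> carrier GX \<Longrightarrow> f g = f' g"
  unfolding GX_eq gx_eq by (rule E.hom_eq_on_gen)

lemma word_value_relator:
  assumes "generator_map H X d" "\<And>x y. x \<in> X \<Longrightarrow> y \<in> X \<Longrightarrow> d x \<otimes>\<^bsub>H\<^esub> d y = d (conjugate G x y) \<otimes>\<^bsub>H\<^esub> d x"
    and s: "s \<in> enveloping_relators G X"
  shows "word_value H d s = \<one>\<^bsub>H\<^esub>"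
proof -
  interpret H: generator_map H X d by fact
  interpret h: group_hom "free_group X" H "word_value H d"
    by (intro group_hom.intro group_hom_axioms.intro group_free_group H.is_group H.word_value_hom)
  obtain x y where xy: "x \<in> X" "y \<in> X"
    and s: "s = pos_word [x, y] \<otimes>\<^bsub>free_group X\<^esub> inv\<^bsub>free_group X\<^esub> pos_word [conjugate G x y, x]"
    using s unfolding enveloping_relators_def by blast
  have X: "set [x, y] \<subseteq> X" "set [conjugate G x y, x] \<subseteq> X" using xy ra_closed by auto
  have "word_value H d s = word_degree H d [x, y] \<otimes>\<^bsub>H\<^esub> inv\<^bsub>H\<^esub> word_degree H d [conjugate G x y, x]"
    unfolding s using pos_word_carrier[OF X(1)] pos_word_carrier[OF X(2)]
    by (simp add: word_value_pos_word del: free_group_simps)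
  moreover have "word_degree H d [x, y] = word_degree H d [conjugate G x y, x]"
    using assms(2)[OF xy] xy X by (simp add: H.d_closed)
  moreover have "word_degree H d [conjugate G x y, x] \<in> carrier H" by (rule H.word_degree_closed[OF X(2)])
  ultimately show ?thesis by simp
qed

lemma gx_relation:
  assumes "x \<in> X" "y \<in> X"
  shows "gx x \<otimes>\<^bsub>GX\<^esub> gx y = gx (conjugate G x y) \<otimes>\<^bsub>GX\<^esub> gx x"
proof -
  interpret h: group_hom "free_group X" GX "word_value GX gx"
    by (intro group_hom.intro group_hom_axioms.intro group_free_group GX.is_group gx.word_value_hom)
  have X: "set [x, y] \<subseteq> X" "set [conjugate G x y, x] \<subseteq> X" using assms ra_closed by auto
  have "pos_word [x, y] \<otimes>\<^bsub>free_group X\<^esub> inv\<^bsub>free_group X\<^esub> pos_word [conjugate G x y, x] \<in> enveloping_relators G X"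
    unfolding enveloping_relators_def using assms by blast
  then have "word_value GX gx (pos_word [x, y] \<otimes>\<^bsub>free_group X\<^esub> inv\<^bsub>free_group X\<^esub> pos_word [conjugate G x y, x]) = \<one>\<^bsub>GX\<^esub>"
    unfolding GX_eq gx_eq by (rule E.relator_value)
  then have "word_degree GX gx [x, y] \<otimes>\<^bsub>GX\<^esub> inv\<^bsub>GX\<^esub> word_degree GX gx [conjugate G x y, x] = \<one>\<^bsub>GX\<^esub>"
    using pos_word_carrier[OF X(1)] pos_word_carrier[OF X(2)]
    by (simp add: word_value_pos_word del: free_group_simps)
  then have "\<one>\<^bsub>GX\<^esub> = word_degree GX gx [x, y] \<otimes>\<^bsub>GX\<^esub> inv\<^bsub>GX\<^esub> word_degree GX gx [conjugate G x y, x]"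
    by (rule sym)
  then have "word_degree GX gx [x, y] = \<one>\<^bsub>GX\<^esub> \<otimes>\<^bsub>GX\<^esub> word_degree GX gx [conjugate G x y, x]"
    by (subst (asm) GX.inv_solve_right[OF GX.one_closed gx.word_degree_closed[OF X(1)] gx.word_degree_closed[OF X(2)]])
  then show ?thesis
    using assms ra_closed gx.word_degree_closed[OF X(2)] by (simp add: gx.d_closed)
qed

lemma enveloping_map_hom:
  assumes "generator_map H X d" "\<And>x y. x \<in> X \<Longrightarrow> y \<in> X \<Longrightarrow> d x \<otimes>\<^bsub>H\<^esub> d y = d (conjugate G x y) \<otimes>\<^bsub>H\<^esub> d x"
  shows "presented_map H d \<in> hom GX H"
  unfolding GX_eq by (rule E.presented_map_hom[OF assms(1)], rule word_value_relator[OF assms])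

lemma enveloping_map_gen:
  assumes "generator_map H X d" "\<And>x y. x \<in> X \<Longrightarrow> y \<in> X \<Longrightarrow> d x \<otimes>\<^bsub>H\<^esub> d y = d (conjugate G x y) \<otimes>\<^bsub>H\<^esub> d x"
    and "x \<in> X"
  shows "presented_map H d (gx x) = d x"
  unfolding gx_eq
  by (rule E.presented_map_gen[OF assms(1)], rule word_value_relator[OF assms(1,2)]) (use assms(3) in auto)

lemma nichols_homogeneous:
  assumes "generator_map H X d" "\<And>x y. x \<in> X \<Longrightarrow> y \<in> X \<Longrightarrow> d x \<otimes>\<^bsub>H\<^esub> d y = d (conjugate G x y) \<otimes>\<^bsub>H\<^esub> d x"
    and "b \<in> nichols c X"
  shows "part (\<lambda>w. word_degree H d w = z) b \<in> nichols c X"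
  by (rule nichols_graded[OF _ assms(3)])
    (rule generator_map.word_degree_braid_word[OF assms(1) rack_type], simp_all add: assms(2))

lemma min_elem_word_degree:
  assumes "min_elem (nichols c X) b" "w \<in> supp b" "w' \<in> supp b"
  shows "word_degree GX gx w = word_degree GX gx w'"
proof (rule min_elem_homogeneous[OF assms(1) _ assms(2,3)])
  have "b \<in> nichols c X" using assms(1) by (simp add: min_elem_def)
  then show "part (\<lambda>w. word_degree GX gx w = z) b \<in> nichols c X" for z
    by (intro nichols_homogeneous[OF gx.generator_map_axioms] gx_relation)
qed

section \<open>The covering group is the enveloping group\<close>

lemma path_equiv_nichols:
  "path_equiv (loop_quiver X) (nichols_paths c X) p p' \<longleftrightarrow>
     (\<exists>v. min_elem (nichols c X) v \<and> snd p \<in> supp v \<and> snd p' \<in> supp v)"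
proof
  assume "path_equiv (loop_quiver X) (nichols_paths c X) p p'"
  then obtain b where b: "min_elem (nichols_paths c X) b" "p \<in> supp b" "p' \<in> supp b"
    unfolding path_equiv_def minimal_iff by blast
  have e: "b = word_path (path_word b)" by simp
  have "min_elem (nichols c X) (path_word b)" using b(1) e min_elem_word_path by metis
  moreover have "snd p \<in> supp (path_word b)" "snd p' \<in> supp (path_word b)"
    using b(2,3) keys_word_path[of "path_word b"] by auto
  ultimately show "\<exists>v. min_elem (nichols c X) v \<and> snd p \<in> supp v \<and> snd p' \<in> supp v"
    by blast
next
  assume "\<exists>v. min_elem (nichols c X) v \<and> snd p \<in> supp v \<and> snd p' \<in> supp v"
  then obtain v where v: "min_elem (nichols c X) v" "snd p \<in> supp v" "snd p' \<in> supp v"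
    by blast
  have "v \<in> nichols c X" using v(1) by (simp add: min_elem_def)
  then have "supp (word_path v) \<subseteq> paths (loop_quiver X) () ()"
    using nichols_keys by (auto simp: keys_word_path paths_loop_quiver)
  then have "minimal (loop_quiver X) (nichols_paths c X) () () (word_path v)"
    using v(1) by (simp add: minimal_iff min_elem_word_path)
  moreover have "p \<in> supp (word_path v)" "p' \<in> supp (word_path v)"
    using v(2,3) by (auto simp: keys_word_path image_iff prod_eq_iff)
  ultimately show "path_equiv (loop_quiver X) (nichols_paths c X) p p'" unfolding path_equiv_def by blast
qed

lemma covering_relators_eq:
  "covering_relators X (nichols_paths c X) =
    {inv\<^bsub>free_group X\<^esub> pos_word w \<otimes>\<^bsub>free_group X\<^esub> pos_word w' | w w'.
       \<exists>v. min_elem (nichols c X) v \<and> w \<in> supp v \<and> w' \<in> supp v}"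
  unfolding covering_relators_def path_equiv_nichols
  by (auto simp del: free_group_simps)

lemma min_elem_words: "min_elem (nichols c X) v \<Longrightarrow> w \<in> supp v \<Longrightarrow> set w \<subseteq> X"
  by (rule nichols_keys) (auto simp: min_elem_def)

lemma covering_presentation: "presentation X (covering_relators X (nichols_paths c X))"
proof
  show "covering_relators X (nichols_paths c X) \<subseteq> carrier (free_group X)"
    unfolding covering_relators_eq
    by (auto simp del: free_group_simps intro!: E.F.m_closed E.F.inv_closed pos_word_carrier dest: min_elem_words)
qed

theorem covering_group_iso:
  assumes full: "full_quadratic_relations G X c"
  shows "\<exists>\<phi>\<in>iso (covering_group X (nichols_paths c X)) GX.
    \<forall>x\<in>X. \<phi> (covering_gen X (nichols_paths c X) x) = gx x"
proof -
  let ?R = "covering_relators X (nichols_paths c X)"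
  interpret C: presentation X ?R by (rule covering_presentation)
  interpret h: group_hom "free_group X" GX "word_value GX gx"
    by (intro group_hom.intro group_hom_axioms.intro group_free_group GX.is_group gx.word_value_hom)
  interpret k: group_hom "free_group X" C.P "word_value C.P C.gen"
    by (intro group_hom.intro group_hom_axioms.intro group_free_group C.P.is_group C.gen.word_value_hom)
  \<comment> \<open>Minimal elements are homogeneous for the grading by the enveloping group.\<close>
  have kills: "word_value GX gx s = \<one>\<^bsub>GX\<^esub>" if sR: "s \<in> ?R" for s
  proof -
    obtain w w' v where s: "s = inv\<^bsub>free_group X\<^esub> pos_word w \<otimes>\<^bsub>free_group X\<^esub> pos_word w'"
      and v: "min_elem (nichols c X) v" "w \<in> supp v" "w' \<in> supp v"
      using sR unfolding covering_relators_eq by blast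
    have X: "set w \<subseteq> X" "set w' \<subseteq> X" using v min_elem_words by blast+
    have "word_value GX gx s = inv\<^bsub>GX\<^esub> word_degree GX gx w \<otimes>\<^bsub>GX\<^esub> word_degree GX gx w'"
      unfolding s using pos_word_carrier[OF X(1)] pos_word_carrier[OF X(2)]
      by (simp add: word_value_pos_word del: free_group_simps)
    then show ?thesis using min_elem_word_degree[OF v] gx.word_degree_closed[OF X(2)] by simp
  qed
  \<comment> \<open>The relations of the enveloping group come from the quadratic minimal elements.\<close>
  have rel: "C.gen x \<otimes>\<^bsub>C.P\<^esub> C.gen y = C.gen (conjugate G x y) \<otimes>\<^bsub>C.P\<^esub> C.gen x" if xy: "x \<in> X" "y \<in> X" for x y
  proof (cases "(conjugate G x y, x) = (x, y)")
    case True
    then have e: "conjugate G x y = x" "x = y" by auto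
    show ?thesis unfolding e(1) using e(2) by simp
  next
    case False
    let ?w = "[x, y]" and ?w' = "[conjugate G x y, x]"
    have X: "set ?w \<subseteq> X" "set ?w' \<subseteq> X" using xy ra_closed by auto
    obtain v where "min_elem (nichols c X) v" "?w \<in> supp v" "?w' \<in> supp v"
      using quadratic_min_elem[OF full xy False] by blast
    then have "inv\<^bsub>free_group X\<^esub> pos_word ?w \<otimes>\<^bsub>free_group X\<^esub> pos_word ?w' \<in> ?R"
      unfolding covering_relators_eq by blast
    then have "word_value C.P C.gen (inv\<^bsub>free_group X\<^esub> pos_word ?w \<otimes>\<^bsub>free_group X\<^esub> pos_word ?w') = \<one>\<^bsub>C.P\<^esub>"
      by (rule C.relator_value)
    then have "\<one>\<^bsub>C.P\<^esub> = inv\<^bsub>C.P\<^esub> word_degree C.P C.gen ?w \<otimes>\<^bsub>C.P\<^esub> word_degree C.P C.gen ?w'"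
      using pos_word_carrier[OF X(1)] pos_word_carrier[OF X(2)]
      by (simp add: word_value_pos_word del: free_group_simps)
    then have "word_degree C.P C.gen ?w' = word_degree C.P C.gen ?w \<otimes>\<^bsub>C.P\<^esub> \<one>\<^bsub>C.P\<^esub>"
      by (subst (asm) C.P.inv_solve_left[OF C.P.one_closed C.gen.word_degree_closed[OF X(1)] C.gen.word_degree_closed[OF X(2)]])
    then show ?thesis
      using xy ra_closed C.gen.word_degree_closed[OF X(1)] by (simp add: C.gen.d_closed)
  qed
  let ?\<phi> = "presented_map GX gx" and ?\<psi> = "presented_map C.P C.gen"
  have \<phi>: "?\<phi> \<in> hom C.P GX" "\<And>x. x \<in> X \<Longrightarrow> ?\<phi> (C.gen x) = gx x"
    using C.presented_map_hom[OF gx.generator_map_axioms kills]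
      C.presented_map_gen[OF gx.generator_map_axioms kills] by blast+
  have \<psi>: "?\<psi> \<in> hom GX C.P" "\<And>x. x \<in> X \<Longrightarrow> ?\<psi> (gx x) = C.gen x"
    using enveloping_map_hom[OF C.gen.generator_map_axioms rel]
      enveloping_map_gen[OF C.gen.generator_map_axioms rel] by blast+
  have "?\<phi> \<in> iso C.P GX"
  proof (rule iso_of_inverse_homs[OF \<phi>(1) \<psi>(1)])
    show "?\<psi> (?\<phi> x) = x" if "x \<in> carrier C.P" for x
      by (rule C.hom_eq_on_gen[OF C.P.is_group hom_comp[OF \<phi>(1) \<psi>(1)] hom_ident _ that]) (simp add: \<phi>(2) \<psi>(2))
    show "?\<phi> (?\<psi> y) = y" if "y \<in> carrier GX" for y
      by (rule hom_eq_on_gx[OF GX.is_group hom_comp[OF \<psi>(1) \<phi>(1)] hom_ident _ that]) (simp add: \<phi>(2) \<psi>(2))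
  qed
  then show ?thesis using \<phi>(2) unfolding covering_group_def covering_gen_def by blast
qed

end

section \<open>Coverings of the loop quiver\<close>

lemma lin_ext_image_span: "lin_ext f ` pm.span A = pm.span (lin_ext f ` A)"
proof -
  have "module_hom pm_scale pm_scale (lin_ext f)"
    by unfold_locales (simp_all add: lin_ext_add lin_ext_scale)
  then show ?thesis using module_hom.span_image by metis
qed

lemma connected_iff:
  "connected Q \<longleftrightarrow> verts Q \<noteq> {} \<and>
     (\<forall>u\<in>verts Q. \<forall>v\<in>verts Q. (u, v) \<in> rtrancl_on (verts Q) (parcs (mk_symmetric Q)))"
  by (simp add: connected_def strongly_connected_def reachable_def)

lemma connected_closed_set:
  assumes "connected Q" "U \<subseteq> verts Q" "U \<noteq> {}"
    and "\<And>a. a \<in> arcs Q \<Longrightarrow> tail Q a \<in> U \<longleftrightarrow> head Q a \<in> U"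
  shows "U = verts Q"
proof
  obtain u where u: "u \<in> U" using assms(3) by blast
  show "verts Q \<subseteq> U"
  proof
    fix v assume "v \<in> verts Q"
    then have "(u, v) \<in> rtrancl_on (verts Q) (parcs (mk_symmetric Q))"
      using assms(1,2) u unfolding connected_iff by blast
    then show "v \<in> U"
    proof (induction rule: rtrancl_on_induct)
      case base
      show ?case by (rule u)
    next
      case (step y z)
      then show ?case using assms(4) by (auto simp: parcs_mk_symmetric)
    qed
  qed
qed (rule assms(2))

lemma connectedI:
  assumes "u \<in> verts Q" "\<And>v. v \<in> verts Q \<Longrightarrow> (u, v) \<in> rtrancl_on (verts Q) (parcs (mk_symmetric Q))"
  shows "connected Q"
proof -
  let ?R = "rtrancl_on (verts Q) (parcs (mk_symmetric Q))"
  have "sym (parcs (mk_symmetric Q))" by (auto simp: parcs_mk_symmetric intro!: symI)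
  then have sym: "sym ?R" by (rule rtrancl_on_sym)
  have "(v, w) \<in> ?R" if "v \<in> verts Q" "w \<in> verts Q" for v w
    using rtrancl_on_trans[OF symD[OF sym assms(2)[OF that(1)]] assms(2)[OF that(2)]] .
  then show ?thesis unfolding connected_iff using assms(1) by blast
qed

text \<open>A quiver whose arrows carry labels such that every vertex is the source of exactly one arrow
  and the target of exactly one arrow with a given label. Words then lift uniquely to paths. Words
  are read from right to left, so that the last letter is the label of the first arrow.\<close>

locale loop_cover = wf_digraph Q for Q :: "('v, 'e) pre_digraph" +
  fixes X :: "'x set" and l :: "'e \<Rightarrow> 'x"
  assumes label: "a \<in> arcs Q \<Longrightarrow> l a \<in> X"
    and unique_out: "v \<in> verts Q \<Longrightarrow> x \<in> X \<Longrightarrow> \<exists>!a. a \<in> arcs Q \<and> tail Q a = v \<and> l a = x"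
    and unique_in: "v \<in> verts Q \<Longrightarrow> x \<in> X \<Longrightarrow> \<exists>!a. a \<in> arcs Q \<and> head Q a = v \<and> l a = x"
begin

definition arc_from :: "'v \<Rightarrow> 'x \<Rightarrow> 'e" where
  "arc_from v x = (THE a. a \<in> arcs Q \<and> tail Q a = v \<and> l a = x)"

abbreviation act :: "'x \<Rightarrow> 'v \<Rightarrow> 'v" where
  "act x v \<equiv> head Q (arc_from v x)"

fun endpt :: "'v \<Rightarrow> 'x list \<Rightarrow> 'v" where
  "endpt v [] = v" |
  "endpt v (x # w) = act x (endpt v w)"

fun lift :: "'v \<Rightarrow> 'x list \<Rightarrow> 'e list" where
  "lift v [] = []" |
  "lift v (x # w) = arc_from (endpt v w) x # lift v w"

abbreviation proj :: "('v, 'e, unit, 'x) quiver_map" where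
  "proj \<equiv> ((\<lambda>_. ()), l)"

lemma arc_from:
  assumes "v \<in> verts Q" "x \<in> X"
  shows "arc_from v x \<in> arcs Q" "tail Q (arc_from v x) = v" "l (arc_from v x) = x" "act x v \<in> verts Q"
  using theI'[OF unique_out[OF assms]] by (auto simp: arc_from_def)

lemma arc_from_tail: "a \<in> arcs Q \<Longrightarrow> arc_from (tail Q a) (l a) = a"
  unfolding arc_from_def by (rule the1_equality[OF unique_out]) (auto simp: label)

lemma act_bij: "x \<in> X \<Longrightarrow> bij_betw (act x) (verts Q) (verts Q)"
proof (rule bij_betw_imageI)
  assume x: "x \<in> X"
  show "inj_on (act x) (verts Q)"
  proof (rule inj_onI)
    fix u v assume uv: "u \<in> verts Q" "v \<in> verts Q" "act x u = act x v"
    then have "arc_from u x = arc_from v x"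
      using unique_in[of "act x v" x] arc_from[OF _ x] x by metis
    then show "u = v" using arc_from(2)[OF _ x] uv by metis
  qed
  show "act x ` verts Q = verts Q"
  proof
    show "act x ` verts Q \<subseteq> verts Q" using arc_from(4)[OF _ x] by blast
    show "verts Q \<subseteq> act x ` verts Q"
    proof
      fix v assume "v \<in> verts Q"
      then obtain a where a: "a \<in> arcs Q" "head Q a = v" "l a = x" using unique_in x by metis
      then have "act x (tail Q a) = v" using arc_from_tail[OF a(1)] by simp
      then show "v \<in> act x ` verts Q" using a by force
    qed
  qed
qed

lemma endpt_closed: "v \<in> verts Q \<Longrightarrow> set w \<subseteq> X \<Longrightarrow> endpt v w \<in> verts Q"
  by (induction w) (auto simp: arc_from)

lemma endpt_append: "endpt v (u @ w) = endpt (endpt v w) u"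
  by (induction u) auto

lemma lift_append: "lift v (u @ w) = lift (endpt v w) u @ lift v w"
  by (induction u) (auto simp: endpt_append)

lemma length_lift [simp]: "length (lift v w) = length w"
  by (induction w) auto

lemma labels_lift: "v \<in> verts Q \<Longrightarrow> set w \<subseteq> X \<Longrightarrow> map l (lift v w) = w"
  by (induction w) (auto simp: arc_from endpt_closed)

lemma awalk_lift: "v \<in> verts Q \<Longrightarrow> set w \<subseteq> X \<Longrightarrow> awalk v (rev (lift v w)) (endpt v w)"
proof (induction w)
  case (Cons x w)
  have "awalk (endpt v w) [arc_from (endpt v w) x] (act x (endpt v w))"
    using Cons.prems arc_from[of "endpt v w" x] endpt_closed[of v w] by (simp add: awalk_def)
  then show ?case using Cons by (simp add: awalk_appendI)
qed (simp add: awalk_def)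

lemma awlast_lift: "v \<in> verts Q \<Longrightarrow> set w \<subseteq> X \<Longrightarrow> awlast v (rev (lift v w)) = endpt v w"
  using awalk_lift awlast_of_awalk by (metis awalk_def awlast_if_cas)

lemma awalk_is_lift:
  "awalk v (rev as) y \<Longrightarrow> as = lift v (map l as) \<and> y = endpt v (map l as) \<and> set (map l as) \<subseteq> X"
proof (induction as arbitrary: y)
  case (Cons a as)
  then have "awalk v (rev as @ [a]) y" by simp
  then have 1: "awalk v (rev as) (awlast v (rev as))" and 2: "awalk (awlast v (rev as)) [a] y"
    unfolding awalk_append_iff by blast+
  have IH: "as = lift v (map l as)" "awlast v (rev as) = endpt v (map l as)" "set (map l as) \<subseteq> X"
    using Cons.IH[OF 1] by blast+
  have a: "a \<in> arcs Q" "tail Q a = endpt v (map l as)" "y = head Q a"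
    using 2 IH(2) by (auto simp: awalk_def)
  then show ?case using IH arc_from_tail[OF a(1)] label by auto
qed (auto simp: awalk_def)

lemma paths_eq: "v \<in> verts Q \<Longrightarrow> paths Q v y = {(v, lift v w) | w. set w \<subseteq> X \<and> endpt v w = y}"
proof (intro equalityI subsetI)
  assume v: "v \<in> verts Q"
  fix p assume "p \<in> paths Q v y"
  then obtain as where "p = (v, as)" "awalk v (rev as) y" by (auto simp: paths_def)
  then show "p \<in> {(v, lift v w) | w. set w \<subseteq> X \<and> endpt v w = y}" using awalk_is_lift[of v as y] by blast
next
  assume v: "v \<in> verts Q"
  fix p assume "p \<in> {(v, lift v w) | w. set w \<subseteq> X \<and> endpt v w = y}"
  then show "p \<in> paths Q v y" using awalk_lift[OF v] by (auto simp: paths_def)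
qed

lemma all_paths_eq: "all_paths Q = {(v, lift v w) | v w. v \<in> verts Q \<and> set w \<subseteq> X}"
  unfolding all_paths_def using endpt_closed by (auto simp: paths_eq)

lemma lift_inj: "v \<in> verts Q \<Longrightarrow> inj_on (\<lambda>w. (v, lift v w)) {w. set w \<subseteq> X}"
  by (rule inj_onI) (metis labels_lift mem_Collect_eq snd_conv)

lemma lift_path_eq:
  assumes "v \<in> verts Q" "set w \<subseteq> X"
  shows "lift_path Q proj v ((), w) = (v, lift v w)"
  unfolding lift_path_def
proof (rule the_equality)
  show "(v, lift v w) \<in> all_paths Q \<and> fst (v, lift v w) = v \<and> path_map proj (v, lift v w) = ((), w)"
    using assms by (auto simp: all_paths_eq path_map_def labels_lift)
next
  fix p assume "p \<in> all_paths Q \<and> fst p = v \<and> path_map proj p = ((), w)"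
  then obtain w' where "p = (v, lift v w')" "set w' \<subseteq> X" "map l (lift v w') = w"
    by (auto simp: all_paths_eq path_map_def)
  then show "p = (v, lift v w)" using assms(1) by (simp add: labels_lift)
qed

definition lift_lin :: "'v \<Rightarrow> ('x list \<Rightarrow>\<^sub>0 'k::field) \<Rightarrow> (('v, 'e) path \<Rightarrow>\<^sub>0 'k)" where
  "lift_lin v = lin_ext (\<lambda>w. bas (v, lift v w))"

lemma lift_elem_eq:
  assumes "v \<in> verts Q" "\<And>w. w \<in> supp u \<Longrightarrow> set w \<subseteq> X"
  shows "lift_elem Q proj v (word_path u) = lift_lin v u"
  unfolding lift_elem_def lift_lin_def word_path_def lin_ext_lin_ext
  by (rule lin_ext_cong) (simp add: lift_path_eq assms)

lemma proj_lift_lin: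
  assumes "v \<in> verts Q" "\<And>w. w \<in> supp u \<Longrightarrow> set w \<subseteq> X"
  shows "path_lin proj (lift_lin v u) = word_path u"
  unfolding path_lin_def lift_lin_def word_path_def lin_ext_lin_ext
  by (rule lin_ext_cong) (simp add: path_map_def labels_lift assms)

lemma keys_lift_lin:
  assumes "v \<in> verts Q" "\<And>w. w \<in> supp u \<Longrightarrow> set w \<subseteq> X"
  shows "supp (lift_lin v u) = (\<lambda>w. (v, lift v w)) ` supp u"
  unfolding lift_lin_def
  by (rule keys_lin_ext_inj, rule inj_on_subset[OF lift_inj[OF assms(1)]]) (use assms(2) in auto)

lemma hom_element_is_lift:
  assumes "v \<in> verts Q" "supp b \<subseteq> paths Q v y"
  obtains u where "b = lift_lin v u" "\<And>w. w \<in> supp u \<Longrightarrow> set w \<subseteq> X \<and> endpt v w = y"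
proof
  let ?u = "lin_ext (\<lambda>p. bas (map l (snd p))) b"
  have p: "p = (v, lift v (map l (snd p))) \<and> set (map l (snd p)) \<subseteq> X \<and> endpt v (map l (snd p)) = y"
    if "p \<in> supp b" for p
  proof -
    have "p \<in> paths Q v y" using that assms(2) by blast
    then obtain w where w: "p = (v, lift v w)" "set w \<subseteq> X" "endpt v w = y"
      unfolding paths_eq[OF assms(1)] by blast
    then show ?thesis using labels_lift[OF assms(1) w(2)] by simp
  qed
  have "lift_lin v ?u = lin_ext bas b"
    unfolding lift_lin_def lin_ext_lin_ext by (rule lin_ext_cong) (use p in simp)
  then show "b = lift_lin v ?u" by simp
  fix w assume "w \<in> supp ?u"
  then obtain p' where "p' \<in> supp b" "w = map l (snd p')"
    using keys_lin_ext[of "\<lambda>p. bas (map l (snd p))" b] by auto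
  then show "set w \<subseteq> X \<and> endpt v w = y" using p[of p'] by simp
qed

lemma path_coprod_lift:
  assumes "v \<in> verts Q" "set w \<subseteq> X"
  shows "path_coprod Q (v, lift v w) = (\<Sum>i\<le>length w.
    bas ((endpt v (drop i w), lift (endpt v (drop i w)) (take i w)), (v, lift v (drop i w))))"
proof -
  have "drop i (lift v w) = lift v (drop i w)" "take i (lift v w) = lift (endpt v (drop i w)) (take i w)"
    if "i \<le> length w" for i
    using lift_append[of v "take i w" "drop i w"] that by (auto simp: append_eq_append_conv)
  moreover have "awlast v (rev (lift v (drop i w))) = endpt v (drop i w)" for i
    using assms set_drop_subset[of i w] by (intro awlast_lift) auto
  ultimately show ?thesis
    unfolding path_coprod_def case_prod_conv length_lift by (intro sum.cong refl) simp
qed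

end

locale coalgebra_cover = loop_cover Q X l
  for Q :: "('v, 'e) pre_digraph" and X :: "'x set" and l :: "'e \<Rightarrow> 'x" +
  fixes N :: "('x list \<Rightarrow>\<^sub>0 'k::field) set"
  assumes subspace_N: "pm.subspace N"
    and N_words: "u \<in> N \<Longrightarrow> w \<in> supp u \<Longrightarrow> set w \<subseteq> X"
begin

abbreviation "B \<equiv> word_path ` N"

definition lifted :: "(('v, 'e) path \<Rightarrow>\<^sub>0 'k) set" where
  "lifted = pm.span {lift_lin v u | v u. v \<in> verts Q \<and> u \<in> N}"

lemma word_path_in_B [simp]: "word_path u \<in> B \<longleftrightarrow> u \<in> N"
  using path_word_word_path by (metis image_iff)

lemma lift_lin_in_lifted: "v \<in> verts Q \<Longrightarrow> u \<in> N \<Longrightarrow> lift_lin v u \<in> lifted"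
  unfolding lifted_def by (rule pm.span_base) blast

lemma subspace_B: "pm.subspace B"
proof -
  have "B = pm.span (word_path ` N)"
    using lin_ext_image_span[of "\<lambda>w. bas ((), w)" N] pm.span_eq_iff[THEN iffD2, OF subspace_N]
    by (simp add: word_path_def)
  then show ?thesis using pm.subspace_span by metis
qed

lemma proj_lifted: "b \<in> lifted \<Longrightarrow> path_lin proj b \<in> B"
  unfolding lifted_def path_lin_def
proof (rule lin_ext_span[OF _ subspace_B])
  fix b assume "b \<in> {lift_lin v u | v u. v \<in> verts Q \<and> u \<in> N}"
  then obtain v u where "b = lift_lin v u" "v \<in> verts Q" "u \<in> N" by blast
  then show "lin_ext (\<lambda>p. bas (path_map proj p)) b \<in> B"
    using proj_lift_lin[of v u] N_words by (auto simp: path_lin_def)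
qed

lemma lift_lin_in_lifted_iff:
  assumes "v \<in> verts Q" "\<And>w. w \<in> supp u \<Longrightarrow> set w \<subseteq> X"
  shows "lift_lin v u \<in> lifted \<longleftrightarrow> u \<in> N"
  using proj_lifted[of "lift_lin v u"] proj_lift_lin[OF assms] lift_lin_in_lifted[OF assms(1)] by auto

text \<open>Lifting only monomials and minimal elements loses nothing because every element is a linear
  combination of such elements.\<close>

lemma lifted_coalgebra_eq: "lifted_coalgebra Q proj (loop_quiver X) B = lifted"
proof -
  have keys: "set w \<subseteq> X" if "u \<in> N" "w \<in> supp u" for u w using that by (rule N_words)
  let ?S = "{lift_elem Q proj x' b | x' b. x' \<in> verts Q \<and> (\<exists>y.
        (\<exists>p\<in>paths (loop_quiver X) (fst proj x') y. b = bas p \<and> b \<in> B) \<or> minimal (loop_quiver X) B (fst proj x') y b)}"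
  have "pm.span ?S \<subseteq> lifted"
  proof (rule pm.span_minimal)
    show "?S \<subseteq> lifted"
    proof
      fix z assume "z \<in> ?S"
      then obtain v b where v: "v \<in> verts Q" "z = lift_elem Q proj v b" "b \<in> B"
        by (auto simp: minimal_iff min_elem_def)
      then obtain u where "u \<in> N" "b = word_path u" by blast
      then show "z \<in> lifted" using v lift_elem_eq[of v u] keys lift_lin_in_lifted by simp
    qed
  qed (simp add: lifted_def)
  moreover have "lifted \<subseteq> pm.span ?S"
    unfolding lifted_def
  proof (rule pm.span_minimal[OF _ pm.subspace_span], rule subsetI)
    fix z assume "z \<in> {lift_lin v u | v u. v \<in> verts Q \<and> u \<in> N}"
    then obtain v u where v: "v \<in> verts Q" and u: "u \<in> N" "z = lift_lin v u" by blast
    have "lift_lin v u \<in> pm.span ?S"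
      unfolding lift_lin_def
    proof (rule lin_ext_span[OF span_minimal_elements[OF subspace_N u(1)] pm.subspace_span])
      fix s assume s: "s \<in> {s \<in> N. supp s \<subseteq> supp u \<and> ((\<exists>p. s = bas p) \<or> min_elem N s)}"
      have "lift_elem Q proj v (word_path s) \<in> ?S"
      proof (cases "\<exists>p. s = bas p")
        case True
        then obtain w where w: "s = bas w" by blast
        then have "word_path s = bas ((), w)" by (simp add: word_path_def)
        moreover have "((), w) \<in> paths (loop_quiver X) (fst proj v) ()"
          using s w keys[of s w] by (simp add: paths_loop_quiver)
        ultimately show ?thesis using v s word_path_in_B[of s] by auto
      next
        case False
        then have m: "min_elem N s" using s by blast
        have "min_elem B (word_path s)"
          using m unfolding min_elem_word_path_image .
        moreover have "supp (word_path s) \<subseteq> paths (loop_quiver X) (fst proj v) ()"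
          using s keys by (auto simp: keys_word_path paths_loop_quiver)
        ultimately have "minimal (loop_quiver X) B (fst proj v) () (word_path s)" by (simp add: minimal_iff)
        then show ?thesis using v by blast
      qed
      moreover have "lift_elem Q proj v (word_path s) = lift_lin v s" using s keys v by (intro lift_elem_eq) auto
      ultimately show "lin_ext (\<lambda>w. bas (v, lift v w)) s \<in> pm.span ?S"
        by (simp add: lift_lin_def pm.span_base)
    qed
    then show "z \<in> pm.span ?S" using u by simp
  qed
  ultimately show ?thesis unfolding lifted_coalgebra_def by blast
qed

lemma min_elem_lift_lin:
  assumes "v \<in> verts Q" "\<And>w. w \<in> supp u \<Longrightarrow> set w \<subseteq> X"
  shows "min_elem lifted (lift_lin v u) \<longleftrightarrow> min_elem N u"
proof -
  have "lin_ext (\<lambda>w. bas (v, lift v w)) u' \<in> lifted \<longleftrightarrow> u' \<in> N"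
    if "supp u' \<subseteq> {w. set w \<subseteq> X}" for u'
    unfolding lift_lin_def[symmetric] by (rule lift_lin_in_lifted_iff[OF assms(1)]) (use that in auto)
  then show ?thesis
    unfolding lift_lin_def
    by (intro min_elem_relabel[OF lift_inj[OF assms(1)]]) (use assms(2) in auto)
qed

end

text \<open>Lifts of minimal elements have a common target in a coalgebra covering. This suffices for
  the lifted coalgebra to be a subcoalgebra: in the coproduct of a lift the second tensor factors
  may be taken minimal, and then determine the source of the first tensor factors.\<close>

locale target_coalgebra_cover = coalgebra_cover +
  assumes common_target: "v \<in> verts Q \<Longrightarrow> min_elem N u \<Longrightarrow> w \<in> supp u \<Longrightarrow>
      w' \<in> supp u \<Longrightarrow> endpt v w = endpt v w'"
    and short_words: "set w \<subseteq> X \<Longrightarrow> length w \<le> 1 \<Longrightarrow> bas w \<in> N"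
    and N_coproduct: "u \<in> N \<Longrightarrow> lin_ext (\<lambda>w. \<Sum>i\<le>length w. bas (take i w, drop i w)) u
      \<in> pm.span {tens a b | a b. a \<in> N \<and> b \<in> N}"
begin

lemma lift_lin_coproduct:
  assumes v: "v \<in> verts Q" and u: "u \<in> N"
  shows "lin_ext (path_coprod Q) (lift_lin v u) \<in> pm.span {tens a b | a b. a \<in> lifted \<and> b \<in> lifted}"
    (is "_ \<in> ?T")
proof -
  let ?\<Phi> = "\<lambda>(w1, w2). bas ((endpt v w2, lift (endpt v w2) w1), (v, lift v w2))"
  \<comment> \<open>The lift of \<open>w1 \<otimes> w2\<close>: the path over \<open>w1\<close> starts where the path over \<open>w2\<close> ends.\<close>
  let ?M = "{b \<in> N. (\<exists>p. b = bas p) \<or> min_elem N b}"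
  have "lin_ext (path_coprod Q) (lift_lin v u)
      = lin_ext ?\<Phi> (lin_ext (\<lambda>w. \<Sum>i\<le>length w. bas (take i w, drop i w)) u)"
    unfolding lift_lin_def lin_ext_lin_ext
    by (rule lin_ext_cong) (use N_words[OF u] in \<open>simp add: path_coprod_lift[OF v] lin_ext_sum\<close>)
  also have "\<dots> \<in> ?T"
  proof (rule lin_ext_span[OF _ pm.subspace_span])
    have "tens a b \<in> pm.span {tens a b | a b. a \<in> N \<and> b \<in> ?M}" if "a \<in> N" "b \<in> N" for a b
    proof (rule tens_in_span[OF pm.span_base[OF that(1)]])
      show "b \<in> pm.span ?M"
        by (rule subsetD[OF pm.span_mono span_minimal_elements[OF subspace_N that(2)]]) auto
    qed
    then have "pm.span {tens a b | a b. a \<in> N \<and> b \<in> N} \<subseteq> pm.span {tens a b | a b. a \<in> N \<and> b \<in> ?M}"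
      by (intro pm.span_minimal pm.subspace_span) blast
    then show "lin_ext (\<lambda>w. \<Sum>i\<le>length w. bas (take i w, drop i w)) u
        \<in> pm.span {tens a b | a b. a \<in> N \<and> b \<in> ?M}" using N_coproduct[OF u] by blast
    fix z assume "z \<in> {tens a b | a b. a \<in> N \<and> b \<in> ?M}"
    then obtain a b where z: "z = tens a b" and a: "a \<in> N" and b: "b \<in> ?M" by blast
    obtain y where y: "y \<in> verts Q" "\<And>w. w \<in> supp b \<Longrightarrow> endpt v w = y"
    proof (cases "supp b = {}")
      case True
      then show ?thesis using that v by blast
    next
      case False
      then obtain w0 where w0: "w0 \<in> supp b" by blast
      have "endpt v w = endpt v w0" if "w \<in> supp b" for w
        using b w0 that common_target[OF v, of b w w0] by auto
      moreover have "endpt v w0 \<in> verts Q" using endpt_closed[OF v N_words[of b w0]] b w0 by blast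
      ultimately show ?thesis using that by blast
    qed
    have "lin_ext ?\<Phi> z = lin_ext (\<lambda>w1. lin_ext (\<lambda>w2. bas ((y, lift y w1), (v, lift v w2))) b) a"
      unfolding z lin_ext_tens by (intro lin_ext_cong) (simp add: y(2) cong: lin_ext_cong)
    also have "\<dots> = tens (lift_lin y a) (lift_lin v b)"
      by (simp add: lift_lin_def tens_def lin_ext_lin_ext)
    finally show "lin_ext ?\<Phi> z \<in> ?T"
      using lift_lin_in_lifted[OF y(1) a] lift_lin_in_lifted[OF v, of b] b by (auto intro!: pm.span_base)
  qed
  finally show ?thesis .
qed

lemma full_subcoalgebra_lifted: "full_subcoalgebra Q lifted"
  unfolding full_subcoalgebra_def
proof (intro conjI ballI)
  show "pm.subspace lifted" unfolding lifted_def by (rule pm.subspace_span)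
  fix b assume b: "b \<in> lifted"
  show "supp b \<subseteq> all_paths Q"
  proof -
    have "lin_ext bas b \<in> {b. supp b \<subseteq> all_paths Q}"
      using b unfolding lifted_def
    proof (rule lin_ext_span[OF _ subspace_keys_subset])
      fix z assume "z \<in> {lift_lin v u | v u. v \<in> verts Q \<and> u \<in> N}"
      then obtain v u where vu: "v \<in> verts Q" "u \<in> N" "z = lift_lin v u" by blast
      then show "lin_ext bas z \<in> {b. supp b \<subseteq> all_paths Q}"
        using keys_lift_lin[of v u] N_words by (fastforce simp: all_paths_eq)
    qed
    then show ?thesis by simp
  qed
  show "lin_ext (path_coprod Q) b \<in> pm.span {tens b1 b2 | b1 b2. b1 \<in> lifted \<and> b2 \<in> lifted}"
    by (rule lin_ext_span[OF b[unfolded lifted_def] pm.subspace_span]) (auto intro: lift_lin_coproduct)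
next
  fix v assume v: "v \<in> verts Q"
  have "lift_lin v (bas []) \<in> lifted" by (intro lift_lin_in_lifted v short_words) auto
  then show "bas (v, []) \<in> lifted" by (simp add: lift_lin_def)
next
  fix a assume a: "a \<in> arcs Q"
  have "lift_lin (tail Q a) (bas [l a]) \<in> lifted"
    using a label by (intro lift_lin_in_lifted short_words) auto
  then show "bas (tail Q a, [a]) \<in> lifted" using arc_from_tail[OF a] by (simp add: lift_lin_def)
qed

lemma minimal_lift:
  assumes v: "v \<in> verts Q" and u: "min_elem N u"
  shows "\<exists>y\<in>verts Q. minimal Q lifted v y (lift_lin v u)"
proof -
  have uN: "u \<in> N" "card (supp u) \<ge> 2" using u by (auto simp: min_elem_def)
  then have "supp u \<noteq> {}" by auto
  then obtain w0 where w0: "w0 \<in> supp u" by blast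
  have k: "supp (lift_lin v u) = (\<lambda>w. (v, lift v w)) ` supp u"
    by (rule keys_lift_lin[OF v]) (rule N_words[OF uN(1)])
  have "(v, lift v w) \<in> paths Q v (endpt v w0)" if "w \<in> supp u" for w
    unfolding paths_eq[OF v] using N_words[OF uN(1) that] common_target[OF v u that w0] by blast
  then have "supp (lift_lin v u) \<subseteq> paths Q v (endpt v w0)"
    unfolding k by (rule image_subsetI)
  moreover have "min_elem lifted (lift_lin v u)"
    by (subst min_elem_lift_lin[OF v]) (use N_words[OF uN(1)] u in auto)
  ultimately show ?thesis
    using endpt_closed[OF v N_words[OF uN(1) w0]] by (auto simp: minimal_iff)
qed

lemma galois_coalgebra_covering_loop:
  assumes "galois_covering Q proj (loop_quiver X)" "full_subcoalgebra (loop_quiver X) B"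
  shows "galois_coalgebra_covering Q lifted proj (loop_quiver X) B"
  unfolding galois_coalgebra_covering_def
proof (intro conjI allI impI ballI)
  fix x y b v assume "minimal (loop_quiver X) B x y b" and v: "v \<in> verts Q"
  then have m: "min_elem B b" and b: "b \<in> B" by (auto simp: minimal_iff min_elem_def)
  then obtain u where u: "u \<in> N" "b = word_path u" by blast
  have "min_elem N u" using m unfolding u(2) min_elem_word_path_image .
  moreover have "path_lin proj (lift_lin v u) = b"
    unfolding u(2) by (rule proj_lift_lin[OF v]) (rule N_words[OF u(1)])
  ultimately show "\<exists>y'\<in>verts Q. \<exists>b'. minimal Q lifted v y' b' \<and> path_lin proj b' = b"
    using minimal_lift[OF v] by metis
qed (fact assms lifted_coalgebra_eq[symmetric])+

end

text \<open>The quiver below has one vertex, so the covering group is transitive on the vertices above and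
  moves an arrow with a given label to any prescribed source or target. Freeness gives uniqueness.\<close>

lemma galois_covering_loop_cover:
  assumes "galois_covering Q F (loop_quiver X)"
  shows "loop_cover Q X (snd F)"
proof -
  obtain \<Gamma> where wf: "wf_digraph Q" and mor: "quiver_morphism Q F (loop_quiver X)"
    and surj: "snd F ` arcs Q = X"
    and aut: "\<Gamma> \<subseteq> quiver_auts Q"
    and free: "\<forall>\<phi>\<in>\<Gamma>. (\<exists>x\<in>verts Q. fst \<phi> x = x) \<longrightarrow> \<phi> = \<one>\<^bsub>BijGroup (verts Q) \<times>\<times> BijGroup (arcs Q)\<^esub>"
    and tv: "\<forall>x\<in>verts Q. \<forall>y\<in>verts Q. fst F x = fst F y \<longleftrightarrow> (\<exists>\<phi>\<in>\<Gamma>. y = fst \<phi> x)"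
    and ta: "\<forall>a\<in>arcs Q. \<forall>b\<in>arcs Q. snd F a = snd F b \<longleftrightarrow> (\<exists>\<phi>\<in>\<Gamma>. b = snd \<phi> a)"
    using assms unfolding galois_covering_def by auto
  interpret wf_digraph Q by (rule wf)
  have morph: "snd \<phi> a \<in> arcs Q" "tail Q (snd \<phi> a) = fst \<phi> (tail Q a)" "head Q (snd \<phi> a) = fst \<phi> (head Q a)"
    if "\<phi> \<in> \<Gamma>" "a \<in> arcs Q" for \<phi> a
    using subsetD[OF aut that(1)] that(2) by (auto simp: quiver_auts_def quiver_morphism_def)
  have label: "snd F a \<in> X" if "a \<in> arcs Q" for a using mor that by (auto simp: quiver_morphism_def)
  have moved: "\<exists>\<phi>\<in>\<Gamma>. v = fst \<phi> u" if "u \<in> verts Q" "v \<in> verts Q" for u v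
    using tv that by simp
  have same: "a = b" if ab: "a \<in> arcs Q" "b \<in> arcs Q" "snd F a = snd F b"
    and ends: "tail Q a = tail Q b \<or> head Q a = head Q b" for a b
  proof -
    obtain \<phi> where \<phi>: "\<phi> \<in> \<Gamma>" "b = snd \<phi> a" using ta ab by blast
    have "fst \<phi> (tail Q a) = tail Q a \<or> fst \<phi> (head Q a) = head Q a"
      using morph[OF \<phi>(1) ab(1)] ends \<phi>(2) by auto
    then have "\<exists>x\<in>verts Q. fst \<phi> x = x"
      using tail_in_verts[OF ab(1)] head_in_verts[OF ab(1)] by blast
    then have "\<phi> = \<one>\<^bsub>BijGroup (verts Q) \<times>\<times> BijGroup (arcs Q)\<^esub>" using free \<phi>(1) by blast
    then show ?thesis using \<phi>(2) ab(1) by (simp add: BijGroup_def)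
  qed
  have same_label: "snd F (snd \<phi> a) = snd F a" if "\<phi> \<in> \<Gamma>" "a \<in> arcs Q" for \<phi> a
  proof -
    have "snd F a = snd F (snd \<phi> a)" using ta morph(1)[OF that] that by blast
    then show ?thesis by (rule sym)
  qed
  show ?thesis
  proof (unfold_locales, rule label, assumption)
    fix v x assume v: "v \<in> verts Q" and "x \<in> X"
    then obtain a0 where a0: "a0 \<in> arcs Q" "snd F a0 = x" using surj by blast
    obtain \<phi> where \<phi>: "\<phi> \<in> \<Gamma>" "v = fst \<phi> (tail Q a0)" using moved[OF tail_in_verts[OF a0(1)] v] by blast
    then have "snd \<phi> a0 \<in> arcs Q \<and> tail Q (snd \<phi> a0) = v \<and> snd F (snd \<phi> a0) = x"
      using morph[OF \<phi>(1) a0(1)] same_label[OF \<phi>(1) a0(1)] a0 by simp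
    then show "\<exists>!a. a \<in> arcs Q \<and> tail Q a = v \<and> snd F a = x" using same by (intro ex1I) auto
    obtain \<phi> where \<phi>: "\<phi> \<in> \<Gamma>" "v = fst \<phi> (head Q a0)" using moved[OF head_in_verts[OF a0(1)] v] by blast
    then have "snd \<phi> a0 \<in> arcs Q \<and> head Q (snd \<phi> a0) = v \<and> snd F (snd \<phi> a0) = x"
      using morph[OF \<phi>(1) a0(1)] same_label[OF \<phi>(1) a0(1)] a0 by simp
    then show "\<exists>!a. a \<in> arcs Q \<and> head Q a = v \<and> snd F a = x" using same by (intro ex1I) auto
  qed
qed

section \<open>The quiver of a group with a generating map\<close>

lemma degree_quiver_simps [simp]:
  "verts (degree_quiver H X d) = carrier H" "arcs (degree_quiver H X d) = X \<times> carrier H"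
  "tail (degree_quiver H X d) a = snd a"
  "head (degree_quiver H X d) a = d (fst a) \<otimes>\<^bsub>H\<^esub> snd a"
  by (simp_all add: degree_quiver_def case_prod_unfold)

context generator_map
begin

abbreviation "DQ \<equiv> degree_quiver H X d"

sublocale DQ: loop_cover DQ X fst
proof
  fix v x assume v: "v \<in> verts DQ" and x: "x \<in> X"
  then have c: "v \<in> carrier H" "d x \<in> carrier H" by (auto simp: d_closed)
  show "\<exists>!a. a \<in> arcs DQ \<and> tail DQ a = v \<and> fst a = x"
    using v x by (intro ex1I[of _ "(x, v)"]) auto
  show "\<exists>!a. a \<in> arcs DQ \<and> head DQ a = v \<and> fst a = x"
  proof (rule ex1I[of _ "(x, inv (d x) \<otimes> v)"])
    show "(x, inv (d x) \<otimes> v) \<in> arcs DQ \<and> head DQ (x, inv (d x) \<otimes> v) = v \<and> fst (x, inv (d x) \<otimes> v) = x"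
      using c x by (simp add: m_assoc[symmetric])
    fix a assume "a \<in> arcs DQ \<and> head DQ a = v \<and> fst a = x"
    then have "a = (x, snd a)" "snd a \<in> carrier H" "v = d x \<otimes> snd a" by auto
    then show "a = (x, inv (d x) \<otimes> v)" using c inv_solve_left[of "snd a" "d x" v] by metis
  qed
qed (auto simp: d_closed)

lemma DQ_arc_from: "h \<in> carrier H \<Longrightarrow> x \<in> X \<Longrightarrow> DQ.arc_from h x = (x, h)"
  using DQ.arc_from[of h x] by (cases "DQ.arc_from h x") auto

lemma DQ_endpt: "h \<in> carrier H \<Longrightarrow> set w \<subseteq> X \<Longrightarrow> DQ.endpt h w = word_degree H d w \<otimes> h"
proof (induction w)
  case (Cons x w)
  then show ?case
    using DQ_arc_from[of "DQ.endpt h w" x] word_degree_closed[of w]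
    by (simp add: m_assoc d_closed)
qed simp

definition translation where
  "translation s = (\<lambda>h\<in>carrier H. h \<otimes> s, \<lambda>a\<in>X \<times> carrier H. (fst a, snd a \<otimes> s))"

lemma translation_Bij:
  assumes s: "s \<in> carrier H"
  shows "translation s \<in> carrier (BijGroup (verts DQ) \<times>\<times> BijGroup (arcs DQ))"
proof -
  have "bij_betw (\<lambda>h\<in>carrier H. h \<otimes> s) (carrier H) (carrier H)"
    by (rule bij_betw_byWitness[where f' = "\<lambda>h. h \<otimes> inv s"]) (use s in \<open>auto simp: m_assoc\<close>)
  moreover have "bij_betw (\<lambda>a\<in>X \<times> carrier H. (fst a, snd a \<otimes> s)) (X \<times> carrier H) (X \<times> carrier H)"
    by (rule bij_betw_byWitness[where f' = "\<lambda>a. (fst a, snd a \<otimes> inv s)"]) (use s in \<open>auto simp: m_assoc\<close>)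
  ultimately show ?thesis by (simp add: translation_def BijGroup_def Bij_def)
qed

lemma translation_mult:
  assumes "s \<in> carrier H" "t \<in> carrier H"
  shows "translation s \<otimes>\<^bsub>BijGroup (verts DQ) \<times>\<times> BijGroup (arcs DQ)\<^esub> translation t = translation (t \<otimes> s)"
  using translation_Bij[OF assms(1)] translation_Bij[OF assms(2)] assms
  by (auto simp: translation_def BijGroup_def compose_def m_assoc intro!: restrict_ext)

lemma translation_one: "translation \<one> = \<one>\<^bsub>BijGroup (verts DQ) \<times>\<times> BijGroup (arcs DQ)\<^esub>"
  by (auto simp: translation_def BijGroup_def intro!: restrict_ext)

lemma translation_aut: "s \<in> carrier H \<Longrightarrow> translation s \<in> quiver_auts DQ"
  using translation_Bij[of s]
  by (auto simp: quiver_auts_def quiver_morphism_def translation_def d_closed m_assoc)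

lemma subgroup_translations:
  assumes "subgroup S H"
  shows "subgroup (translation ` S) (BijGroup (verts DQ) \<times>\<times> BijGroup (arcs DQ))"
proof -
  let ?B = "BijGroup (verts DQ) \<times>\<times> BijGroup (arcs DQ)"
  interpret B: group ?B by (intro DirProd_group group_BijGroup)
  have S: "s \<in> carrier H" if "s \<in> S" for s using subgroup.mem_carrier[OF assms that] .
  show ?thesis
  proof (rule B.subgroupI)
    show "translation ` S \<subseteq> carrier ?B" using S translation_Bij by blast
    show "translation ` S \<noteq> {}" using subgroup.one_closed[OF assms] by blast
    fix \<phi> assume "\<phi> \<in> translation ` S"
    then obtain s where s: "s \<in> S" "\<phi> = translation s" by blast
    have "translation (inv s) \<otimes>\<^bsub>?B\<^esub> \<phi> = \<one>\<^bsub>?B\<^esub>"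
      unfolding s(2) using S[OF s(1)] by (simp only: translation_mult inv_closed r_inv translation_one)
    then have "inv\<^bsub>?B\<^esub> \<phi> = translation (inv s)"
      using translation_Bij S[OF s(1)] s(2) by (intro B.inv_equality) auto
    then show "inv\<^bsub>?B\<^esub> \<phi> \<in> translation ` S" using subgroup.m_inv_closed[OF assms s(1)] by blast
    fix \<psi> assume "\<psi> \<in> translation ` S"
    then obtain t where t: "t \<in> S" "\<psi> = translation t" by blast
    then have "\<phi> \<otimes>\<^bsub>?B\<^esub> \<psi> = translation (t \<otimes> s)"
      unfolding s(2) t(2) using S s(1) t(1) by (intro translation_mult)
    then show "\<phi> \<otimes>\<^bsub>?B\<^esub> \<psi> \<in> translation ` S" using subgroup.m_closed[OF assms t(1) s(1)] by blast
  qed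
qed

text \<open>Right translations commute with the left multiplications by degrees that define the arrows, so
  they are automorphisms of the quiver, and they act freely.\<close>

lemma galois_covering_translations:
  assumes S: "subgroup S H" and Q: "wf_digraph Q" "connected DQ" "connected Q"
    and mor: "quiver_morphism DQ F Q" and surj: "fst F ` carrier H = verts Q" "snd F ` (X \<times> carrier H) = arcs Q"
    and fv: "\<And>h h'. h \<in> carrier H \<Longrightarrow> h' \<in> carrier H \<Longrightarrow> fst F h = fst F h' \<longleftrightarrow> (\<exists>s\<in>S. h' = h \<otimes> s)"
    and fa: "\<And>x h x' h'. x \<in> X \<Longrightarrow> h \<in> carrier H \<Longrightarrow> x' \<in> X \<Longrightarrow> h' \<in> carrier H \<Longrightarrow>
      snd F (x, h) = snd F (x', h') \<longleftrightarrow> x = x' \<and> (\<exists>s\<in>S. h' = h \<otimes> s)"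
  shows "galois_covering DQ F Q"
  unfolding galois_covering_def
proof (intro conjI exI[of _ "translation ` S"] ballI impI)
  have S_carrier: "s \<in> carrier H" if "s \<in> S" for s using subgroup.mem_carrier[OF S that] .
  show "subgroup (translation ` S) (BijGroup (verts DQ) \<times>\<times> BijGroup (arcs DQ))"
    by (rule subgroup_translations[OF S])
  show "translation ` S \<subseteq> quiver_auts DQ" using S_carrier translation_aut by blast
  show "\<phi> = \<one>\<^bsub>BijGroup (verts DQ) \<times>\<times> BijGroup (arcs DQ)\<^esub>"
    if \<phi>: "\<phi> \<in> translation ` S" "\<exists>h\<in>verts DQ. fst \<phi> h = h" for \<phi>
  proof -
    obtain s where s: "s \<in> S" "\<phi> = translation s" using \<phi>(1) by blast
    obtain h where h: "h \<in> carrier H" "fst \<phi> h = h" using \<phi>(2) by auto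
    then have "h \<otimes> s = h" by (simp add: s(2) translation_def)
    then have "s = \<one>" using S_carrier[OF s(1)] h(1) by simp
    then show ?thesis using s translation_one by simp
  qed
  show "fst F h = fst F h' \<longleftrightarrow> (\<exists>\<phi>\<in>translation ` S. h' = fst \<phi> h)"
    if "h \<in> verts DQ" "h' \<in> verts DQ" for h h'
    using fv[of h h'] that by (simp add: translation_def)
  show "snd F a = snd F b \<longleftrightarrow> (\<exists>\<phi>\<in>translation ` S. b = snd \<phi> a)"
    if "a \<in> arcs DQ" "b \<in> arcs DQ" for a b
    using fa[of "fst a" "snd a" "fst b" "snd b"] that by (auto simp: translation_def prod_eq_iff)
  show "wf_digraph DQ" by (rule DQ.wf_digraph)
qed (use Q mor surj in auto)

end

section \<open>The universal coalgebra covering\<close>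

context rack_yd_module
begin

text \<open>The degrees generate the enveloping group.\<close>

lemma connected_degree_quiver: "connected (degree_quiver GX X gx)"
proof (rule connectedI[of "\<one>\<^bsub>GX\<^esub>"])
  let ?Q = "degree_quiver GX X gx" let ?R = "rtrancl_on (verts ?Q) (parcs (mk_symmetric ?Q))"
  fix v assume "v \<in> verts ?Q"
  then have "v \<in> carrier E.P" by (simp add: GX_eq)
  then have "(\<one>\<^bsub>GX\<^esub>, v) \<in> ?R"
  proof (induction rule: E.generation_induct)
    case one
    then show ?case by (simp add: GX_eq[symmetric])
  next
    case (gen x C)
    then have C: "C \<in> carrier GX" "gx x \<otimes>\<^bsub>GX\<^esub> C \<in> carrier GX" by (simp_all add: GX_eq gx_eq E.gen_closed)
    have "(C, gx x \<otimes>\<^bsub>GX\<^esub> C) \<in> parcs (mk_symmetric ?Q)"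
      unfolding parcs_mk_symmetric by (rule UN_I[of "(x, C)"]) (simp_all add: gen(1) C(1))
    then have "(\<one>\<^bsub>GX\<^esub>, gx x \<otimes>\<^bsub>GX\<^esub> C) \<in> ?R"
      by (rule rtrancl_on_into_rtrancl_on[OF gen(3)]) (simp add: C(2))
    then show ?case by (simp only: GX_eq gx_eq)
  next
    case (inv x C)
    let ?D = "inv\<^bsub>GX\<^esub> gx x \<otimes>\<^bsub>GX\<^esub> C"
    have C: "C \<in> carrier GX" "?D \<in> carrier GX" using inv(1,2) gx.d_closed by (simp_all add: GX_eq)
    have "gx x \<otimes>\<^bsub>GX\<^esub> ?D = C" using C(1) gx.d_closed[OF inv(1)] by (simp add: GX.m_assoc[symmetric])
    then have "(C, ?D) \<in> parcs (mk_symmetric ?Q)"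
      unfolding parcs_mk_symmetric by (intro UN_I[of "(x, ?D)"]) (simp_all add: inv(1) C(2))
    then have "(\<one>\<^bsub>GX\<^esub>, ?D) \<in> ?R"
      by (rule rtrancl_on_into_rtrancl_on[OF inv(3)]) (simp add: C(2))
    then show ?case by (simp only: GX_eq gx_eq)
  qed
  then show "(\<one>\<^bsub>GX\<^esub>, v) \<in> ?R" .
qed simp

lemma nichols_target_cover:
  assumes "loop_cover Q X l"
    and "\<And>v u w w'. v \<in> verts Q \<Longrightarrow> min_elem (nichols c X) u \<Longrightarrow> w \<in> supp u \<Longrightarrow>
      w' \<in> supp u \<Longrightarrow> loop_cover.endpt Q l v w = loop_cover.endpt Q l v w'"
  shows "target_coalgebra_cover Q X l (nichols c X)"
proof -
  interpret loop_cover Q X l by (rule assms(1))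
  show ?thesis
  proof
    show "pm.subspace (nichols c X)" by (rule subspace_nichols)
    show "set w \<subseteq> X" if "u \<in> nichols c X" "w \<in> supp u" for u w
      by (rule nichols_keys[OF that])
    show "endpt v w = endpt v w'" if "v \<in> verts Q" "min_elem (nichols c X) u" "w \<in> supp u"
      "w' \<in> supp u" for v u w w'
      by (rule assms(2)[OF that])
    show "bas w \<in> nichols c X" if "set w \<subseteq> X" "length w \<le> 1" for w
      by (rule short_word_in_nichols[OF that])
    show "lin_ext (\<lambda>w. \<Sum>i\<le>length w. bas (take i w, drop i w)) u
        \<in> pm.span {tens a b | a b. a \<in> nichols c X \<and> b \<in> nichols c X}" if "u \<in> nichols c X" for u
      by (rule nichols_coproduct[OF that])
  qed
qed

lemma degree_cover: "target_coalgebra_cover (degree_quiver GX X gx) X fst (nichols c X)"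
proof (rule nichols_target_cover[OF gx.DQ.loop_cover_axioms])
  fix v u w w' assume v: "v \<in> verts gx.DQ" and u: "min_elem (nichols c X) u"
    and w: "w \<in> supp u" "w' \<in> supp u"
  show "gx.DQ.endpt v w = gx.DQ.endpt v w'"
    using v min_elem_words[OF u] w min_elem_word_degree[OF u w] by (simp add: gx.DQ_endpt)
qed

sublocale DC: target_coalgebra_cover "degree_quiver GX X gx" X fst "nichols c X"
  by (rule degree_cover)

text \<open>The loop quiver covers itself, and lifting along this covering changes nothing.\<close>

lemma full_subcoalgebra_nichols_paths: "full_subcoalgebra (loop_quiver X) (nichols_paths c X)"
proof -
  interpret L: loop_cover "loop_quiver X" X "\<lambda>x. x"
    by unfold_locales auto
  interpret L: target_coalgebra_cover "loop_quiver X" X "\<lambda>x. x" "nichols c X"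
    by (rule nichols_target_cover[OF L.loop_cover_axioms]) simp
  have arc: "L.arc_from () x = x" if "x \<in> X" for x using L.arc_from[of "()" x] that by simp
  have "L.lift () w = w" if "set w \<subseteq> X" for w using that by (induction w) (auto simp: arc)
  then have L: "L.lift_lin () u = word_path u" if "u \<in> nichols c X" for u
    unfolding L.lift_lin_def word_path_def using nichols_keys[OF that] by (intro lin_ext_cong) simp
  have "{L.lift_lin v u | v u. v \<in> verts (loop_quiver X) \<and> u \<in> nichols c X} = nichols_paths c X"
    unfolding nichols_paths_def using L by force
  then have "L.lifted = nichols_paths c X"
    unfolding L.lifted_def using pm.span_eq_iff L.subspace_B by (metis nichols_paths_def)
  then show ?thesis using L.full_subcoalgebra_lifted by simp
qed

text \<open>A minimal element in the covering above a given one is its unique lift with the same source;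
  its paths have a common target by definition.\<close>

lemma galois_covering_nichols:
  assumes "galois_coalgebra_covering Q B' F (loop_quiver X) (nichols_paths c X)"
  shows "target_coalgebra_cover Q X (snd F) (nichols c X)"
    and "B' = coalgebra_cover.lifted Q (snd F) (nichols c X)"
proof -
  have gal: "galois_covering Q F (loop_quiver X)" and B': "B' = lifted_coalgebra Q F (loop_quiver X) (nichols_paths c X)"
    and lifts: "\<And>x y b v. minimal (loop_quiver X) (nichols_paths c X) x y b \<Longrightarrow> v \<in> verts Q \<Longrightarrow> fst F v = x \<Longrightarrow>
      \<exists>y'\<in>verts Q. \<exists>b'. minimal Q B' v y' b' \<and> path_lin F b' = b"
    using assms unfolding galois_coalgebra_covering_def by auto
  interpret loop_cover Q X "snd F" by (rule galois_covering_loop_cover[OF gal])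
  have F: "F = proj" by (simp add: prod_eq_iff fun_eq_iff)
  show *: "target_coalgebra_cover Q X (snd F) (nichols c X)"
  proof (rule nichols_target_cover[OF loop_cover_axioms])
    fix v u w w' assume v: "v \<in> verts Q" and u: "min_elem (nichols c X) u"
      and w: "w \<in> supp u" "w' \<in> supp u"
    have "supp (word_path u) \<subseteq> paths (loop_quiver X) () ()"
      using min_elem_words[OF u] by (auto simp: keys_word_path paths_loop_quiver)
    then have m: "minimal (loop_quiver X) (nichols_paths c X) () () (word_path u)"
      using u by (simp add: minimal_iff min_elem_word_path)
    have "fst F v = ()" by simp
    then obtain y b where b: "minimal Q B' v y b" "path_lin F b = word_path u" using lifts[OF m v] by blast
    then obtain u' where u': "b = lift_lin v u'" "\<And>w. w \<in> supp u' \<Longrightarrow> set w \<subseteq> X \<and> endpt v w = y"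
      using hom_element_is_lift[OF v, of b y] by (auto simp: minimal_iff)
    have "word_path u = path_lin proj (lift_lin v u')" using b(2) u'(1) by (simp only: F[symmetric])
    also have "\<dots> = word_path u'" by (rule proj_lift_lin[OF v]) (use u'(2) in blast)
    finally have "u = u'" by (metis path_word_word_path)
    then show "endpt v w = endpt v w'" using u'(2) w by simp
  qed
  interpret target_coalgebra_cover Q X "snd F" "nichols c X" by (rule *)
  have "lifted_coalgebra Q F (loop_quiver X) (nichols_paths c X) = lifted"
    using lifted_coalgebra_eq by (simp only: F[symmetric] nichols_paths_def)
  then show "B' = lifted" using B' by simp
qed

end

text \<open>Let the Nichols algebra be lifted to a connected quiver. The arrows labelled \<open>x\<close> permute the
  vertices, and lifting the quadratic minimal elements shows that the enveloping group acts. The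
  covering by the degree quiver is the orbit map of a base point, and the covering group is its
  stabilizer.\<close>

locale nichols_cover = rack_yd_module G X D c q + C: target_coalgebra_cover Q X l "nichols c X"
  for G :: "('a, 'm) monoid_scheme" (structure) and X D c q and Q :: "('v, 'e) pre_digraph" and l +
  fixes y0
  assumes full: "full_quadratic_relations G X c" and connected: "connected Q" and y0: "y0 \<in> verts Q"
begin

abbreviation "V \<equiv> verts Q"

lemma act_relation:
  assumes "x \<in> X" "y \<in> X" "v \<in> V"
  shows "C.act x (C.act y v) = C.act (conjugate G x y) (C.act x v)"
proof (cases "(conjugate G x y, x) = (x, y)")
  case True
  then have e: "conjugate G x y = x" "x = y" by auto
  show ?thesis unfolding e(1) using e(2) by simp
next
  case False
  obtain u where "min_elem (nichols c X) u" "[x, y] \<in> supp u" "[conjugate G x y, x] \<in> supp u"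
    using quadratic_min_elem[OF full assms(1,2) False] by blast
  then have "C.endpt v [x, y] = C.endpt v [conjugate G x y, x]" by (rule C.common_target[OF assms(3)])
  then show ?thesis by simp
qed

definition perm :: "'a \<Rightarrow> 'v \<Rightarrow> 'v" where
  "perm x = (\<lambda>v\<in>V. C.act x v)"

lemma perm_closed: "x \<in> X \<Longrightarrow> perm x \<in> carrier (BijGroup V)"
  using C.act_bij[of x] by (simp add: perm_def BijGroup_def Bij_def bij_betw_restrict_eq)

lemma generator_map_perm: "generator_map (BijGroup V) X perm"
  by (intro generator_map.intro group_BijGroup generator_map_axioms.intro perm_closed)

lemma perm_relation:
  assumes "x \<in> X" "y \<in> X"
  shows "perm x \<otimes>\<^bsub>BijGroup V\<^esub> perm y = perm (conjugate G x y) \<otimes>\<^bsub>BijGroup V\<^esub> perm x"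
proof -
  have comp: "perm x \<otimes>\<^bsub>BijGroup V\<^esub> perm y = (\<lambda>v\<in>V. C.act x (C.act y v))" if "x \<in> X" "y \<in> X" for x y
    using perm_closed[OF that(1)] perm_closed[OF that(2)] C.arc_from(4)[OF _ that(2)]
    by (auto simp: BijGroup_def compose_def perm_def intro!: restrict_ext)
  show ?thesis
    unfolding comp[OF assms] comp[OF ra_closed[OF assms] assms(1)]
    by (rule restrict_ext) (rule act_relation[OF assms])
qed

definition \<rho> :: "('a \<times> bool) list set \<Rightarrow> 'v \<Rightarrow> 'v" where
  "\<rho> = presented_map (BijGroup V) perm"

lemma \<rho>_hom: "\<rho> \<in> hom GX (BijGroup V)"
  unfolding \<rho>_def by (rule enveloping_map_hom[OF generator_map_perm perm_relation])

lemma \<rho>_gx: "x \<in> X \<Longrightarrow> \<rho> (gx x) = perm x"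
  unfolding \<rho>_def by (rule enveloping_map_gen[OF generator_map_perm perm_relation])

lemma \<rho>_Bij: "h \<in> carrier GX \<Longrightarrow> \<rho> h \<in> Bij V"
  using hom_in_carrier[OF \<rho>_hom] by (simp add: BijGroup_def)

lemma \<rho>_closed: "h \<in> carrier GX \<Longrightarrow> v \<in> V \<Longrightarrow> \<rho> h v \<in> V"
  using Bij_imp_funcset[OF \<rho>_Bij] by blast

lemma \<rho>_mult: "h \<in> carrier GX \<Longrightarrow> h' \<in> carrier GX \<Longrightarrow> v \<in> V \<Longrightarrow> \<rho> (h \<otimes>\<^bsub>GX\<^esub> h') v = \<rho> h (\<rho> h' v)"
  using hom_mult[OF \<rho>_hom, of h h'] \<rho>_Bij[of h] \<rho>_Bij[of h'] by (simp add: BijGroup_def compose_def)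

lemma \<rho>_one: "v \<in> V \<Longrightarrow> \<rho> \<one>\<^bsub>GX\<^esub> v = v"
  using hom_one[OF \<rho>_hom GX.is_group group_BijGroup] by (simp add: BijGroup_def)

lemma \<rho>_inv:
  assumes "h \<in> carrier GX" "v \<in> V"
  shows "\<rho> (inv\<^bsub>GX\<^esub> h) (\<rho> h v) = v"
  using \<rho>_mult[of "inv\<^bsub>GX\<^esub> h" h v] assms by (simp add: \<rho>_one)

definition orb :: "('a \<times> bool) list set \<Rightarrow> 'v" where
  "orb h = \<rho> h y0"

lemma orb_closed: "h \<in> carrier GX \<Longrightarrow> orb h \<in> V"
  unfolding orb_def by (intro \<rho>_closed y0)

lemma orb_gx: "x \<in> X \<Longrightarrow> h \<in> carrier GX \<Longrightarrow> orb (gx x \<otimes>\<^bsub>GX\<^esub> h) = C.act x (orb h)"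
  using orb_closed[of h] y0 by (simp add: orb_def \<rho>_mult gx.d_closed \<rho>_gx perm_def)

text \<open>The orbit of the base point is closed under arrows in both directions, and the quiver is
  connected.\<close>

lemma orb_surj: "orb ` carrier GX = V"
proof (rule connected_closed_set[OF connected])
  show "orb ` carrier GX \<subseteq> V" using orb_closed by blast
  show "orb ` carrier GX \<noteq> {}" using GX.one_closed by blast
  fix a assume a: "a \<in> arcs Q"
  let ?x = "l a"
  have x: "?x \<in> X" by (rule C.label[OF a])
  have head: "head Q a = C.act ?x (tail Q a)" using C.arc_from_tail[OF a] by simp
  show "tail Q a \<in> orb ` carrier GX \<longleftrightarrow> head Q a \<in> orb ` carrier GX"
  proof
    assume "tail Q a \<in> orb ` carrier GX"
    then obtain h where h: "h \<in> carrier GX" "tail Q a = orb h" by blast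
    then have "head Q a = orb (gx ?x \<otimes>\<^bsub>GX\<^esub> h)" using head orb_gx[OF x h(1)] by simp
    then show "head Q a \<in> orb ` carrier GX" using h gx.d_closed[OF x] by blast
  next
    assume "head Q a \<in> orb ` carrier GX"
    then obtain h where h: "h \<in> carrier GX" "head Q a = orb h" by blast
    let ?h = "inv\<^bsub>GX\<^esub> gx ?x \<otimes>\<^bsub>GX\<^esub> h"
    have h': "?h \<in> carrier GX" using h gx.d_closed[OF x] by simp
    have "gx ?x \<otimes>\<^bsub>GX\<^esub> ?h = h" using h gx.d_closed[OF x] by (simp add: GX.m_assoc[symmetric])
    then have "C.act ?x (orb ?h) = C.act ?x (tail Q a)" using orb_gx[OF x h'] h head by simp
    then have "orb ?h = tail Q a"
      using C.act_bij[OF x] orb_closed[OF h'] C.tail_in_verts[OF a] by (auto simp: bij_betw_def dest: inj_onD)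
    then show "tail Q a \<in> orb ` carrier GX" using imageI[OF h', of orb] by simp
  qed
qed

definition stabilizer :: "('a \<times> bool) list set set" where
  "stabilizer = {s \<in> carrier GX. orb s = y0}"

lemma subgroup_stabilizer: "subgroup stabilizer GX"
proof (rule GX.subgroupI)
  show "stabilizer \<noteq> {}" using \<rho>_one[OF y0] by (auto simp: stabilizer_def orb_def)
  fix s assume s: "s \<in> stabilizer"
  then show "inv\<^bsub>GX\<^esub> s \<in> stabilizer" using \<rho>_inv[of s y0] y0 by (simp add: stabilizer_def orb_def)
  fix t assume "t \<in> stabilizer"
  then show "s \<otimes>\<^bsub>GX\<^esub> t \<in> stabilizer" using s y0 by (simp add: stabilizer_def orb_def \<rho>_mult)
qed (auto simp: stabilizer_def)

lemma orb_eq_iff: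
  assumes h: "h \<in> carrier GX" "h' \<in> carrier GX"
  shows "orb h = orb h' \<longleftrightarrow> (\<exists>s\<in>stabilizer. h' = h \<otimes>\<^bsub>GX\<^esub> s)"
proof
  assume e: "orb h = orb h'"
  let ?s = "inv\<^bsub>GX\<^esub> h \<otimes>\<^bsub>GX\<^esub> h'"
  have "orb ?s = \<rho> (inv\<^bsub>GX\<^esub> h) (orb h)" using h y0 e by (simp add: orb_def \<rho>_mult)
  then have "?s \<in> stabilizer" using h y0 \<rho>_inv[of h y0] by (simp add: stabilizer_def orb_def)
  moreover have "h' = h \<otimes>\<^bsub>GX\<^esub> ?s" using h by (simp add: GX.m_assoc[symmetric])
  ultimately show "\<exists>s\<in>stabilizer. h' = h \<otimes>\<^bsub>GX\<^esub> s" by blast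
next
  assume "\<exists>s\<in>stabilizer. h' = h \<otimes>\<^bsub>GX\<^esub> s"
  then show "orb h = orb h'" using h y0 by (auto simp: stabilizer_def orb_def \<rho>_mult)
qed

definition cover :: "(('a \<times> bool) list set, 'a \<times> ('a \<times> bool) list set, 'v, 'e) quiver_map" where
  "cover = (orb, \<lambda>(x, h). C.arc_from (orb h) x)"

lemma cover_simps [simp]: "fst cover = orb" "snd cover (x, h) = C.arc_from (orb h) x"
  by (simp_all add: cover_def)

lemma galois_covering_cover: "galois_covering gx.DQ cover Q"
proof (rule gx.galois_covering_translations[OF subgroup_stabilizer C.wf_digraph connected_degree_quiver connected])
  show "quiver_morphism gx.DQ cover Q"
    unfolding quiver_morphism_def using C.arc_from[OF orb_closed] by (auto simp: orb_closed orb_gx)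
  show "fst cover ` carrier GX = V" by (simp add: orb_surj)
  show "snd cover ` (X \<times> carrier GX) = arcs Q"
  proof
    show "snd cover ` (X \<times> carrier GX) \<subseteq> arcs Q" using C.arc_from(1)[OF orb_closed] by auto
    show "arcs Q \<subseteq> snd cover ` (X \<times> carrier GX)"
    proof
      fix a assume a: "a \<in> arcs Q"
      then obtain h where h: "h \<in> carrier GX" "tail Q a = orb h" using orb_surj C.tail_in_verts by blast
      then have "a = snd cover (l a, h)" using C.arc_from_tail[OF a] by simp
      then show "a \<in> snd cover ` (X \<times> carrier GX)" using C.label[OF a] h(1) by blast
    qed
  qed
  show "fst cover h = fst cover h' \<longleftrightarrow> (\<exists>s\<in>stabilizer. h' = h \<otimes>\<^bsub>GX\<^esub> s)"
    if "h \<in> carrier GX" "h' \<in> carrier GX" for h h' using orb_eq_iff[OF that] by simp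
  show "snd cover (x, h) = snd cover (x', h') \<longleftrightarrow> x = x' \<and> (\<exists>s\<in>stabilizer. h' = h \<otimes>\<^bsub>GX\<^esub> s)"
    if "x \<in> X" "h \<in> carrier GX" "x' \<in> X" "h' \<in> carrier GX" for x h x' h'
  proof -
    have "C.arc_from (orb h) x = C.arc_from (orb h') x' \<longleftrightarrow> x = x' \<and> orb h = orb h'"
      using C.arc_from(2,3)[OF orb_closed[OF that(2)] that(1)] C.arc_from(2,3)[OF orb_closed[OF that(4)] that(3)] by metis
    then show ?thesis using orb_eq_iff[OF that(2,4)] by simp
  qed
qed

lemma cover_lift:
  "h \<in> carrier GX \<Longrightarrow> set w \<subseteq> X \<Longrightarrow>
     orb (gx.DQ.endpt h w) = C.endpt (orb h) w \<and> map (snd cover) (gx.DQ.lift h w) = C.lift (orb h) w"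
proof (induction w)
  case (Cons x w)
  have "gx.DQ.endpt h w \<in> carrier GX" using gx.DQ.endpt_closed[of h w] Cons.prems by simp
  then show ?case using Cons by (simp add: gx.DQ_arc_from orb_gx)
qed simp

lemma lift_path_cover:
  assumes h: "h \<in> carrier GX" and w: "set w \<subseteq> X"
  shows "lift_path gx.DQ cover h (orb h, C.lift (orb h) w) = (h, gx.DQ.lift h w)"
  unfolding lift_path_def
proof (rule the_equality)
  show "(h, gx.DQ.lift h w) \<in> all_paths gx.DQ \<and> fst (h, gx.DQ.lift h w) = h \<and>
      path_map cover (h, gx.DQ.lift h w) = (orb h, C.lift (orb h) w)"
  proof (intro conjI)
    show "(h, gx.DQ.lift h w) \<in> all_paths gx.DQ" unfolding gx.DQ.all_paths_eq using assms by auto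
  qed (simp_all add: path_map_def cover_lift[OF assms])
next
  fix p assume p: "p \<in> all_paths gx.DQ \<and> fst p = h \<and> path_map cover p = (orb h, C.lift (orb h) w)"
  then have "p \<in> all_paths gx.DQ" "fst p = h" by blast+
  then obtain w' where w'12: "p = (h, gx.DQ.lift h w')" "set w' \<subseteq> X"
    unfolding gx.DQ.all_paths_eq by auto
  have "path_map cover p = (orb h, C.lift (orb h) w)" using p by blast
  then have "map (snd cover) (gx.DQ.lift h w') = C.lift (orb h) w"
    unfolding w'12(1) path_map_def by simp
  note w' = w'12 this
  have "C.lift (orb h) w' = C.lift (orb h) w"
    using conjunct2[OF cover_lift[OF h w'(2)]] w'(3) by (rule trans[OF sym])
  then have "map l (C.lift (orb h) w') = map l (C.lift (orb h) w)" by (simp only:)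
  then have "w' = w" using C.labels_lift[OF orb_closed[OF h] w] C.labels_lift[OF orb_closed[OF h] w'(2)] by simp
  then show "p = (h, gx.DQ.lift h w)" using w'(1) by simp
qed

lemma lift_elem_cover:
  assumes "h \<in> carrier GX" "\<And>w. w \<in> supp u \<Longrightarrow> set w \<subseteq> X"
  shows "lift_elem gx.DQ cover h (C.lift_lin (orb h) u) = gx.DQ.lift_lin h u"
  unfolding lift_elem_def C.lift_lin_def gx.DQ.lift_lin_def lin_ext_lin_ext
  by (rule lin_ext_cong) (simp add: lift_path_cover assms)

lemma path_lin_cover:
  assumes "h \<in> carrier GX" "\<And>w. w \<in> supp u \<Longrightarrow> set w \<subseteq> X"
  shows "path_lin cover (gx.DQ.lift_lin h u) = C.lift_lin (orb h) u"
  unfolding path_lin_def C.lift_lin_def gx.DQ.lift_lin_def lin_ext_lin_ext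
  by (rule lin_ext_cong) (simp add: path_map_def cover_lift assms)

lemma hom_element_in_nichols:
  assumes v: "v \<in> V" and b: "b \<in> C.lifted" "supp b \<subseteq> paths Q v y"
  obtains u where "b = C.lift_lin v u" "u \<in> nichols c X"
proof -
  obtain u where u: "b = C.lift_lin v u" "\<And>w. w \<in> supp u \<Longrightarrow> set w \<subseteq> X \<and> C.endpt v w = y"
    by (rule C.hom_element_is_lift[OF v b(2)]) (rule that)
  have "C.lift_lin v u \<in> C.lifted \<longleftrightarrow> u \<in> nichols c X"
    by (rule C.lift_lin_in_lifted_iff[OF v]) (use u(2) in blast)
  then have "u \<in> nichols c X" using u(1) b(1) by simp
  then show ?thesis using u(1) that by blast
qed

text \<open>An element with source \<open>orb h\<close> is itself a lift of a word combination \<open>u\<close>, and its lift to \<open>h\<close> is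
  the lift of \<open>u\<close> to \<open>h\<close>.\<close>

lemma lifted_coalgebra_cover: "lifted_coalgebra gx.DQ cover Q C.lifted = DC.lifted"
proof -
  let ?S = "{lift_elem gx.DQ cover h b | h b. h \<in> verts gx.DQ \<and> (\<exists>y.
        (\<exists>p\<in>paths Q (fst cover h) y. b = bas p \<and> b \<in> C.lifted) \<or> minimal Q C.lifted (fst cover h) y b)}"
  have "?S \<subseteq> DC.lifted"
  proof
    fix z assume "z \<in> ?S"
    then obtain h b y where h: "h \<in> carrier GX" and z: "z = lift_elem gx.DQ cover h b"
      and b: "b \<in> C.lifted" "supp b \<subseteq> paths Q (orb h) y"
      by (auto simp: minimal_iff min_elem_def)
    obtain u where u: "b = C.lift_lin (orb h) u" "u \<in> nichols c X"
      by (rule hom_element_in_nichols[OF orb_closed[OF h] b]) (rule that)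
    have "z = gx.DQ.lift_lin h u"
      unfolding z u(1) by (rule lift_elem_cover[OF h]) (rule nichols_keys[OF u(2)])
    then show "z \<in> DC.lifted" using DC.lift_lin_in_lifted[of h u] h u(2) by simp
  qed
  then have 1: "pm.span ?S \<subseteq> DC.lifted" unfolding DC.lifted_def by (intro pm.span_minimal pm.subspace_span)
  have "gx.DQ.lift_lin h u \<in> pm.span ?S" if h: "h \<in> carrier GX" and u: "u \<in> nichols c X" for h u
    unfolding gx.DQ.lift_lin_def
  proof (rule lin_ext_span[OF span_minimal_elements[OF subspace_nichols u] pm.subspace_span])
    fix s assume s: "s \<in> {s \<in> nichols c X. supp s \<subseteq> supp u \<and> ((\<exists>p. s = bas p) \<or> min_elem (nichols c X) s)}"
    have v: "orb h \<in> V" by (rule orb_closed[OF h])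
    have keys: "set w \<subseteq> X" if "w \<in> supp s" for w using nichols_keys[of s w] s that by blast
    have in_lifted: "C.lift_lin (orb h) s \<in> C.lifted" using C.lift_lin_in_lifted[OF v, of s] s by blast
    have "lift_elem gx.DQ cover h (C.lift_lin (orb h) s) \<in> ?S"
    proof (cases "\<exists>p. s = bas p")
      case True
      then obtain w where w: "s = bas w" by blast
      then have "set w \<subseteq> X" using keys by simp
      then have "(orb h, C.lift (orb h) w) \<in> paths Q (fst cover h) (C.endpt (orb h) w)"
        using C.paths_eq[OF v] by auto
      moreover have "C.lift_lin (orb h) s = bas (orb h, C.lift (orb h) w)" by (simp add: w C.lift_lin_def)
      ultimately show ?thesis using h in_lifted by auto
    next
      case False
      then have "min_elem (nichols c X) s" using s by blast
      then obtain y where "minimal Q C.lifted (orb h) y (C.lift_lin (orb h) s)" using C.minimal_lift[OF v] by blast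
      then show ?thesis using h by auto
    qed
    then have "lift_elem gx.DQ cover h (C.lift_lin (orb h) s) \<in> pm.span ?S" by (rule pm.span_base)
    moreover have "lift_elem gx.DQ cover h (C.lift_lin (orb h) s) = gx.DQ.lift_lin h s"
      by (rule lift_elem_cover[OF h keys])
    ultimately show "lin_ext (\<lambda>w. bas (h, gx.DQ.lift h w)) s \<in> pm.span ?S"
      by (simp only: gx.DQ.lift_lin_def)
  qed
  then have "DC.lifted \<subseteq> pm.span ?S"
    unfolding DC.lifted_def by (intro pm.span_minimal pm.subspace_span) auto
  then show ?thesis using 1 unfolding lifted_coalgebra_def by blast
qed

lemma galois_coalgebra_covering_cover: "galois_coalgebra_covering gx.DQ DC.lifted cover Q C.lifted"
  unfolding galois_coalgebra_covering_def
proof (intro conjI allI impI ballI)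
  show "full_subcoalgebra Q C.lifted" by (rule C.full_subcoalgebra_lifted)
  show "galois_covering gx.DQ cover Q" by (rule galois_covering_cover)
  show "DC.lifted = lifted_coalgebra gx.DQ cover Q C.lifted" by (rule lifted_coalgebra_cover[symmetric])
  fix v y b h assume b: "minimal Q C.lifted v y b" and "h \<in> verts gx.DQ" and v: "fst cover h = v"
  then have h: "h \<in> carrier GX" and v: "v = orb h" by auto
  have m: "min_elem C.lifted b" and k: "supp b \<subseteq> paths Q (orb h) y" using b v by (auto simp: minimal_iff)
  then have "b \<in> C.lifted" by (simp add: min_elem_def)
  then obtain u where u: "b = C.lift_lin (orb h) u" "u \<in> nichols c X"
    using hom_element_in_nichols[OF orb_closed[OF h] _ k] by blast
  have keys: "set w \<subseteq> X" if "w \<in> supp u" for w by (rule nichols_keys[OF u(2) that])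
  have "min_elem C.lifted (C.lift_lin (orb h) u) \<longleftrightarrow> min_elem (nichols c X) u"
    by (rule C.min_elem_lift_lin[OF orb_closed[OF h] keys])
  then have "min_elem (nichols c X) u" using m u(1) by simp
  then obtain y' where "y' \<in> verts gx.DQ" "minimal gx.DQ DC.lifted h y' (gx.DQ.lift_lin h u)"
    using DC.minimal_lift[of h u] h by auto
  moreover have "path_lin cover (gx.DQ.lift_lin h u) = b" unfolding u(1) by (rule path_lin_cover[OF h keys])
  ultimately show "\<exists>y'\<in>verts gx.DQ. \<exists>b'. minimal gx.DQ DC.lifted h y' b' \<and> path_lin cover b' = b" by blast
qed

lemma proj_cover:
  assumes "b \<in> DC.lifted"
  shows "path_lin degree_proj b = path_lin C.proj (path_lin cover b)"
  unfolding path_lin_def lin_ext_lin_ext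
proof (rule lin_ext_span_eq[OF assms[unfolded DC.lifted_def]])
  fix z assume "z \<in> {gx.DQ.lift_lin v u | v u. v \<in> verts gx.DQ \<and> u \<in> nichols c X}"
  then obtain h u where h: "h \<in> carrier GX" and u: "u \<in> nichols c X" and z: "z = gx.DQ.lift_lin h u" by auto
  have keys: "set w \<subseteq> X" if "w \<in> supp u" for w by (rule nichols_keys[OF u that])
  have "path_lin degree_proj z = word_path u"
    using gx.DQ.proj_lift_lin[of h u] h keys unfolding z degree_proj_def by simp
  moreover have "path_lin cover z = C.lift_lin (orb h) u"
    unfolding z by (rule path_lin_cover[OF h keys])
  moreover have "path_lin C.proj (C.lift_lin (orb h) u) = word_path u"
    by (rule C.proj_lift_lin[OF orb_closed[OF h] keys])
  ultimately show "lin_ext (\<lambda>p. bas (path_map degree_proj p)) z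
      = lin_ext (\<lambda>p. lin_ext (\<lambda>p. bas (path_map C.proj p)) (bas (path_map cover p))) z"
    unfolding lin_ext_lin_ext[symmetric] unfolding path_lin_def[symmetric] by simp
qed

end

context rack_yd_module
begin

lemma galois_covering_degree_proj: "galois_covering gx.DQ degree_proj (loop_quiver X)"
proof (rule gx.galois_covering_translations[OF GX.subgroup_self])
  show "wf_digraph (loop_quiver X)" by unfold_locales auto
  show "connected (loop_quiver X)" by (rule connectedI[of "()"]) auto
  show "\<And>h h'. h \<in> carrier GX \<Longrightarrow> h' \<in> carrier GX \<Longrightarrow> fst degree_proj h = fst degree_proj h' \<longleftrightarrow> (\<exists>s\<in>carrier GX. h' = h \<otimes>\<^bsub>GX\<^esub> s)"
    and "\<And>x h x' h'. x \<in> X \<Longrightarrow> h \<in> carrier GX \<Longrightarrow> x' \<in> X \<Longrightarrow> h' \<in> carrier GX \<Longrightarrow>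
      snd degree_proj (x, h) = snd degree_proj (x', h') \<longleftrightarrow> x = x' \<and> (\<exists>s\<in>carrier GX. h' = h \<otimes>\<^bsub>GX\<^esub> s)"
  proof -
    have ex: "\<exists>s\<in>carrier GX. h' = h \<otimes>\<^bsub>GX\<^esub> s" if "h \<in> carrier GX" "h' \<in> carrier GX" for h h'
      using that by (intro bexI[of _ "inv\<^bsub>GX\<^esub> h \<otimes>\<^bsub>GX\<^esub> h'"]) (simp_all add: GX.m_assoc[symmetric])
    show "\<And>h h'. h \<in> carrier GX \<Longrightarrow> h' \<in> carrier GX \<Longrightarrow> fst degree_proj h = fst degree_proj h' \<longleftrightarrow> (\<exists>s\<in>carrier GX. h' = h \<otimes>\<^bsub>GX\<^esub> s)"
      using ex by (simp add: degree_proj_def)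
    show "\<And>x h x' h'. x \<in> X \<Longrightarrow> h \<in> carrier GX \<Longrightarrow> x' \<in> X \<Longrightarrow> h' \<in> carrier GX \<Longrightarrow>
        snd degree_proj (x, h) = snd degree_proj (x', h') \<longleftrightarrow> x = x' \<and> (\<exists>s\<in>carrier GX. h' = h \<otimes>\<^bsub>GX\<^esub> s)"
      using ex by (simp add: degree_proj_def)
  qed
qed (use connected_degree_quiver GX.one_closed in \<open>auto simp: degree_proj_def quiver_morphism_def\<close>)

lemma smash_path_smash:
  assumes "b \<in> nichols c X" "g \<in> carrier GX"
  shows "smash_path GX X gx (smash b g) = gx.DQ.lift_lin g b"
  unfolding smash_path_def smash_def lin_ext_lin_ext gx.DQ.lift_lin_def
  by (rule lin_ext_cong) (use gx.DQ.lift_path_eq nichols_keys[OF assms(1)] assms(2) in \<open>simp add: degree_proj_def\<close>)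

lemma smash_path_bosonization:
  "smash_path GX X gx ` bspace (bosonization c X GX Y) = DC.lifted"
proof -
  let ?A = "{smash r h | r h. r \<in> nichols c X \<and> h \<in> carrier GX}"
  have "smash_path GX X gx ` ?A = {gx.DQ.lift_lin v u | v u. v \<in> verts gx.DQ \<and> u \<in> nichols c X}"
  proof (intro equalityI subsetI)
    fix z assume "z \<in> smash_path GX X gx ` ?A"
    then obtain r h where "r \<in> nichols c X" "h \<in> carrier GX" "z = smash_path GX X gx (smash r h)" by blast
    then show "z \<in> {gx.DQ.lift_lin v u | v u. v \<in> verts gx.DQ \<and> u \<in> nichols c X}"
      using smash_path_smash by auto
  next
    fix z assume "z \<in> {gx.DQ.lift_lin v u | v u. v \<in> verts gx.DQ \<and> u \<in> nichols c X}"
    then obtain h u where "h \<in> carrier GX" "u \<in> nichols c X" "z = gx.DQ.lift_lin h u" by auto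
    then show "z \<in> smash_path GX X gx ` ?A" using smash_path_smash[of u h] by force
  qed
  then show ?thesis
    unfolding DC.lifted_def bosonization_def bialg.simps
    by (simp only: smash_path_def lin_ext_image_span)
qed

theorem universal_coalgebra_covering_degree_quiver:
  assumes full: "full_quadratic_relations G X c"
  shows "universal_coalgebra_covering u w gx.DQ DC.lifted degree_proj (loop_quiver X) (nichols_paths c X)"
  unfolding universal_coalgebra_covering_def
proof (intro conjI allI impI)
  show "galois_coalgebra_covering gx.DQ DC.lifted degree_proj (loop_quiver X) (nichols_paths c X)"
    using DC.galois_coalgebra_covering_loop galois_covering_degree_proj full_subcoalgebra_nichols_paths
    by (simp add: degree_proj_def nichols_paths_def)
  fix Q' :: "('v, 'e) pre_digraph" and B' F'
  assume gal: "galois_coalgebra_covering Q' B' F' (loop_quiver X) (nichols_paths c X)"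
  then have "connected Q'" unfolding galois_coalgebra_covering_def galois_covering_def by (elim conjE)
  then obtain y0 where "y0 \<in> verts Q'" unfolding connected_iff by blast
  note C = galois_covering_nichols[OF gal]
  interpret C: target_coalgebra_cover Q' X "snd F'" "nichols c X" by (rule C(1))
  interpret nichols_cover G X D c q Q' "snd F'" y0
    by unfold_locales fact+
  have F': "F' = C.proj" by (simp add: prod_eq_iff fun_eq_iff)
  have "galois_coalgebra_covering gx.DQ DC.lifted cover Q' B'"
    unfolding C(2) by (rule galois_coalgebra_covering_cover)
  moreover have "\<forall>b\<in>DC.lifted. path_lin degree_proj b = path_lin F' (path_lin cover b)"
    by (subst F') (use proj_cover in blast)
  ultimately show "\<exists>E. galois_coalgebra_covering gx.DQ DC.lifted E Q' B' \<and>
      (\<forall>b\<in>DC.lifted. path_lin degree_proj b = path_lin F' (path_lin E b))"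
    by blast
qed

end

section \<open>Yetter-Drinfeld modules with homogeneous basis\<close>

lemma epi_of_generators:
  assumes "group K" "group L" "f \<in> hom K L" "generate L S = carrier L" "S \<subseteq> f ` carrier K"
  shows "f \<in> epi K L"
proof -
  interpret group_hom K L f using assms by (intro group_hom.intro group_hom_axioms.intro)
  have "generate L S \<subseteq> f ` carrier K"
    by (rule H.generate_subgroup_incl[OF assms(5) img_is_subgroup])
  moreover have "f ` carrier K \<subseteq> carrier L" by auto
  ultimately show ?thesis using assms(3,4) by (auto simp: epi_def)
qed

locale yd_module =
  fixes H :: "('h, 'm) monoid_scheme" and X :: "'x set" and DH :: "('h, 'x, 'k::field) yd_struct"
  assumes yd: "yetter_drinfeld H X DH"
begin

sublocale group H using yd by (simp add: yetter_drinfeld_def)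

lemma act_keys: "h \<in> carrier H \<Longrightarrow> x \<in> X \<Longrightarrow> y \<in> supp (yd_act DH h x) \<Longrightarrow> y \<in> X"
  using yd unfolding yetter_drinfeld_def by blast

lemma act_one: "x \<in> X \<Longrightarrow> yd_act DH \<one>\<^bsub>H\<^esub> x = bas x"
  using yd unfolding yetter_drinfeld_def by blast

lemma act_mult: "g \<in> carrier H \<Longrightarrow> h \<in> carrier H \<Longrightarrow> x \<in> X \<Longrightarrow>
    yd_act DH (g \<otimes>\<^bsub>H\<^esub> h) x = lin_ext (yd_act DH g) (yd_act DH h x)"
  using yd unfolding yetter_drinfeld_def by blast

lemma coact_keys: "x \<in> X \<Longrightarrow> (h, y) \<in> supp (yd_coact DH x) \<Longrightarrow> h \<in> carrier H \<and> y \<in> X"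
  using yd unfolding yetter_drinfeld_def by blast

lemma coact_counit: "x \<in> X \<Longrightarrow> lin_ext (\<lambda>(h, y). bas y) (yd_coact DH x) = bas x"
  using yd unfolding yetter_drinfeld_def by blast

lemma coact_coassoc: "x \<in> X \<Longrightarrow> lin_ext (\<lambda>(h, y). bas (h, h, y)) (yd_coact DH x) =
    lin_ext (\<lambda>(h, y). lin_ext (\<lambda>(h', z). bas (h, h', z)) (yd_coact DH y)) (yd_coact DH x)"
  using yd unfolding yetter_drinfeld_def by blast

lemma act_coact: "g \<in> carrier H \<Longrightarrow> x \<in> X \<Longrightarrow> lin_ext (yd_coact DH) (yd_act DH g x) =
    lin_ext (\<lambda>(h, y). lin_ext (\<lambda>z. bas (conjugate H g h, z)) (yd_act DH g y)) (yd_coact DH x)"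
  using yd unfolding yetter_drinfeld_def by blast

lemma act_inverse:
  assumes "h \<in> carrier H" "x \<in> X"
  shows "lin_ext (yd_act DH h) (yd_act DH (inv\<^bsub>H\<^esub> h) x) = bas x"
  using act_mult[of h "inv\<^bsub>H\<^esub> h" x] assms by (simp add: act_one)

lemma act_inverse_lin:
  assumes h: "h \<in> carrier H" and u: "supp u \<subseteq> X"
  shows "lin_ext (yd_act DH (inv\<^bsub>H\<^esub> h)) (lin_ext (yd_act DH h) u) = u"
proof -
  have "lin_ext (yd_act DH (inv\<^bsub>H\<^esub> h)) (lin_ext (yd_act DH h) u) = lin_ext bas u"
    unfolding lin_ext_lin_ext
  proof (rule lin_ext_cong)
    fix x assume "x \<in> supp u"
    then show "lin_ext (yd_act DH (inv\<^bsub>H\<^esub> h)) (yd_act DH h x) = bas x"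
      using act_mult[of "inv\<^bsub>H\<^esub> h" h x] h u by (auto simp: act_one)
  qed
  then show ?thesis by simp
qed

end

locale homogeneous_yd_module = yd_module H X DH + rack_type_braiding X ra q c
  for H :: "('h, 'm) monoid_scheme" and X :: "'x set" and DH :: "('h, 'x, 'k::field) yd_struct"
    and ra :: "'x \<Rightarrow> 'x \<Rightarrow> 'x" and q :: "'x \<Rightarrow> 'x \<Rightarrow> 'k"
    and c :: "'x \<Rightarrow> 'x \<Rightarrow> ('x \<times> 'x \<Rightarrow>\<^sub>0 'k)" +
  fixes d :: "'x \<Rightarrow> 'h"
  assumes d_closed: "x \<in> X \<Longrightarrow> d x \<in> carrier H"
    and coact: "x \<in> X \<Longrightarrow> yd_coact DH x = bas (d x, x)"
    and braiding: "x \<in> X \<Longrightarrow> y \<in> X \<Longrightarrow> yd_braiding DH x y = c x y"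
    and q_nonzero: "x \<in> X \<Longrightarrow> y \<in> X \<Longrightarrow> q x y \<noteq> 0"
begin

sublocale generator_map H X d by unfold_locales (rule d_closed)

text \<open>The compatibility of action and coaction compares \<open>d z \<otimes> v\<^sub>z\<close> with \<open>h (d x) h\<^sup>-\<^sup>1 \<otimes> v\<^sub>z\<close> for each
  \<open>v\<^sub>z\<close> that occurs in \<open>h.v\<^sub>x\<close>.\<close>

lemma act_degree:
  assumes "h \<in> carrier H" "x \<in> X" "z \<in> supp (yd_act DH h x)"
  shows "d z = conjugate H h (d x)"
proof -
  let ?u = "yd_act DH h x"
  have "lin_ext (yd_coact DH) ?u = lin_ext (\<lambda>z. bas (d z, z)) ?u"
    by (rule lin_ext_cong) (use coact act_keys assms in blast)
  moreover have "lin_ext (yd_coact DH) ?u = lin_ext (\<lambda>z. bas (conjugate H h (d x), z)) ?u"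
    unfolding act_coact[OF assms(1,2)] coact[OF assms(2)] by simp
  ultimately have "supp (lin_ext (\<lambda>z. bas (d z, z)) ?u)
      = supp (lin_ext (\<lambda>z. bas (conjugate H h (d x), z)) ?u)" by simp
  then have "(\<lambda>z. (d z, z)) ` supp ?u = (\<lambda>z. (conjugate H h (d x), z)) ` supp ?u"
    by (subst (asm) (1 2) keys_lin_ext_inj) (auto simp: inj_on_def)
  then show ?thesis using assms(3) by blast
qed

lemma act_degree_generator:
  assumes "x \<in> X" "y \<in> X"
  shows "yd_act DH (d x) y = Poly_Mapping.single (ra x y) (q x y)"
proof (rule poly_mapping_eqI)
  fix z
  have "c x y = lin_ext (\<lambda>y'. bas (y', x)) (yd_act DH (d x) y)"
    unfolding braiding[OF assms, symmetric] yd_braiding_def by (simp add: coact[OF assms(1)])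
  then have "coef (yd_act DH (d x) y) z = coef (c x y) (z, x)"
    using lookup_lin_ext_inj[of "\<lambda>y'. (y', x)" "yd_act DH (d x) y" z] by (simp add: inj_on_def)
  then show "coef (yd_act DH (d x) y) z
      = coef (Poly_Mapping.single (ra x y) (q x y)) z"
    using c_eq[OF assms] by (simp add: lookup_single when_def)
qed

lemma degree_relation:
  assumes "x \<in> X" "y \<in> X"
  shows "d (ra x y) \<otimes>\<^bsub>H\<^esub> d x = d x \<otimes>\<^bsub>H\<^esub> d y"
proof -
  have "d (ra x y) = conjugate H (d x) (d y)"
    using act_degree[OF d_closed[OF assms(1)] assms(2)] act_degree_generator[OF assms] q_nonzero[OF assms] by simp
  then show ?thesis using d_closed assms by (simp add: conjugate_def m_assoc)
qed

lemma coact_word_eq: "set w \<subseteq> X \<Longrightarrow> coact_word H DH w = bas (word_degree H d w, w)"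
  by (induction w) (simp_all add: coact_word_def coact)

lemma homogeneous_span:
  assumes "b \<in> nichols c X"
  shows "b \<in> pm.span {b \<in> nichols c X. \<exists>z\<in>carrier H. \<forall>w\<in>supp b. word_degree H d w = z}" (is "_ \<in> pm.span ?M")
proof -
  have "{v \<in> nichols c X. supp v \<subseteq> supp b \<and> ((\<exists>p. v = bas p) \<or> min_elem (nichols c X) v)} \<subseteq> ?M"
  proof
    fix v assume v: "v \<in> {v \<in> nichols c X. supp v \<subseteq> supp b \<and> ((\<exists>p. v = bas p) \<or> min_elem (nichols c X) v)}"
    then have N: "v \<in> nichols c X" by blast
    have "word_degree H d w = word_degree H d w'" if w: "w \<in> supp v" "w' \<in> supp v" for w w'
    proof (cases "\<exists>p. v = bas p")
      case True
      then show ?thesis using w by auto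
    next
      case False
      then have "min_elem (nichols c X) v" using v by blast
      then show ?thesis
      proof (rule min_elem_homogeneous[OF _ _ w])
        show "part (\<lambda>w. word_degree H d w = z) v \<in> nichols c X" for z
          by (rule nichols_graded[OF _ N])
            (rule word_degree_braid_word[OF rack_type_braiding_axioms], simp_all add: degree_relation)
      qed
    qed
    moreover have "word_degree H d w \<in> carrier H" if "w \<in> supp v" for w
      by (rule word_degree_closed[OF nichols_keys[OF N that]])
    ultimately show "v \<in> ?M" using N by (cases "supp v = {}") blast+
  qed
  then show ?thesis using span_minimal_elements[OF subspace_nichols assms] pm.span_mono by blast
qed

text \<open>Monomials and minimal elements are homogeneous, so the second tensor factors in the coproduct may
  be taken homogeneous. The coaction on such a factor contributes a single group element.\<close>

lemma nichols_coproduct_homogeneous: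
  assumes "r \<in> nichols c X"
  obtains ts where
    "\<And>a b. (a, b) \<in> set ts \<Longrightarrow> a \<in> nichols c X \<and> b \<in> nichols c X \<and>
       (\<exists>z\<in>carrier H. \<forall>w\<in>supp b. word_degree H d w = z)"
    "lin_ext (\<lambda>w. \<Sum>i\<le>length w. bas (take i w, drop i w)) r = (\<Sum>(a, b)\<leftarrow>ts. tens a b)"
proof -
  let ?M = "{b \<in> nichols c X. \<exists>z\<in>carrier H. \<forall>w\<in>supp b. word_degree H d w = z}"
  have "tens a b \<in> pm.span {tens a b | a b. a \<in> nichols c X \<and> b \<in> ?M}" if "a \<in> nichols c X" "b \<in> nichols c X" for a b
    by (rule tens_in_span[OF pm.span_base[OF that(1)] homogeneous_span[OF that(2)]])
  then have "pm.span {tens a b | a b. a \<in> nichols c X \<and> b \<in> nichols c X} \<subseteq> pm.span {tens a b | a b. a \<in> nichols c X \<and> b \<in> ?M}"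
    by (intro pm.span_minimal pm.subspace_span) blast
  then have "lin_ext (\<lambda>w. \<Sum>i\<le>length w. bas (take i w, drop i w)) r \<in> pm.span {tens a b | a b. a \<in> nichols c X \<and> b \<in> ?M}"
    using nichols_coproduct[OF assms] by blast
  then have "\<exists>ts. set ts \<subseteq> nichols c X \<times> ?M \<and>
      lin_ext (\<lambda>w. \<Sum>i\<le>length w. bas (take i w, drop i w)) r = (\<Sum>(a, b)\<leftarrow>ts. tens a b)"
  proof (induction rule: pm.span_induct_alt)
    case base
    show ?case by (rule exI[of _ "[]"]) simp
  next
    case (step t z y)
    then obtain a b ts where z: "z = tens a b" "a \<in> nichols c X" "b \<in> ?M"
      and ts: "set ts \<subseteq> nichols c X \<times> ?M" "y = (\<Sum>(a, b)\<leftarrow>ts. tens a b)" by auto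
    have "pm_scale t a \<in> nichols c X" by (rule pm.subspace_scale[OF subspace_nichols z(2)])
    then show ?case using z ts by (intro exI[of _ "(pm_scale t a, b) # ts"]) (simp add: tens_scale_left)
  qed
  then show ?thesis using that by (auto simp: subset_iff)
qed

end

section \<open>Bosonizations\<close>

lemma bosonization_simps:
  "bspace (bosonization c X H D) = pm.span {smash r h | r h. r \<in> nichols c X \<and> h \<in> carrier H}"
  "bprod (bosonization c X H D) = (\<lambda>a b. lin_ext (\<lambda>(u, g). lin_ext (\<lambda>(w, h).
     lin_ext (\<lambda>w'. smash (quantum_shuffle c u w') (g \<otimes>\<^bsub>H\<^esub> h)) (act_word D g w)) b) a)"
  "bunit (bosonization c X H D) = bas ([], \<one>\<^bsub>H\<^esub>)"
  "bcoprod (bosonization c X H D) = lin_ext (\<lambda>(w, h). \<Sum>i\<le>length w.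
     lin_ext (\<lambda>(g, w'). bas ((take i w, g \<otimes>\<^bsub>H\<^esub> h), (w', h))) (coact_word H D (drop i w)))"
  "bcounit (bosonization c X H D) = (\<lambda>a. \<Sum>p\<in>supp a. if fst p = [] then coef a p else 0)"
  by (simp_all add: bosonization_def)

lemma smash_map_smash [simp]: "smash_map f (smash r h) = smash r (f h)"
  by (simp add: smash_map_def smash_def lin_ext_lin_ext)

lemma smash_map_add: "smash_map f (a + b) = smash_map f a + smash_map f b"
  by (simp add: smash_map_def lin_ext_add)

lemma smash_map_scale: "smash_map f (pm_scale t a) = pm_scale t (smash_map f a)"
  by (simp add: smash_map_def lin_ext_scale)

lemma smash_in_bspace:
  "r \<in> nichols c X \<Longrightarrow> h \<in> carrier H \<Longrightarrow> smash r h \<in> bspace (bosonization c X H D)"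
  unfolding bosonization_simps by (rule pm.span_base) blast

lemma (in rack_type_braiding) bspace_keys:
  assumes "a \<in> bspace (bosonization c X H D)" "(w, h) \<in> supp a"
  shows "set w \<subseteq> X" "h \<in> carrier H"
proof -
  have "lin_ext bas a \<in> {u. supp u \<subseteq> {w. set w \<subseteq> X} \<times> carrier H}"
  proof (rule lin_ext_span[OF assms(1)[unfolded bosonization_simps] subspace_keys_subset])
    fix b assume "b \<in> {smash r h | r h. r \<in> nichols c X \<and> h \<in> carrier H}"
    then obtain r h where r: "r \<in> nichols c X" "h \<in> carrier H" "b = smash r h" by blast
    then show "lin_ext bas b \<in> {u. supp u \<subseteq> {w. set w \<subseteq> X} \<times> carrier H}"
      using keys_lin_ext[of "\<lambda>w. bas (w, h)" r] nichols_keys[OF r(1)] by (auto simp: smash_def)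
  qed
  then show "set w \<subseteq> X" "h \<in> carrier H" using assms(2) by auto
qed

lemma lin_ext_sum_list: "lin_ext f (\<Sum>x\<leftarrow>xs. g x) = (\<Sum>x\<leftarrow>xs. lin_ext f (g x))"
  by (induction xs) (simp_all add: lin_ext_add)

text \<open>A homomorphism of the grading groups that is compatible with degrees and actions induces a
  Hopf algebra map of the bosonizations.\<close>

locale yd_change_of_group =
  A: homogeneous_yd_module H X DH ra q c d + A': homogeneous_yd_module H' X DH' ra q c d'
  for H :: "('h, 'm) monoid_scheme" and X :: "'x set" and DH :: "('h, 'x, 'k::field) yd_struct"
    and ra :: "'x \<Rightarrow> 'x \<Rightarrow> 'x" and q :: "'x \<Rightarrow> 'x \<Rightarrow> 'k"
    and c :: "'x \<Rightarrow> 'x \<Rightarrow> ('x \<times> 'x \<Rightarrow>\<^sub>0 'k)" and d and H' :: "('g, 'n) monoid_scheme" and DH' :: "('g, 'x, 'k) yd_struct" and d' +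
  fixes f :: "'h \<Rightarrow> 'g"
  assumes f_hom: "f \<in> hom H H'"
    and f_degree: "x \<in> X \<Longrightarrow> f (d x) = d' x"
    and f_act: "h \<in> carrier H \<Longrightarrow> x \<in> X \<Longrightarrow> yd_act DH h x = yd_act DH' (f h) x"
begin

abbreviation "bos \<equiv> bosonization c X H DH"
abbreviation "bos' \<equiv> bosonization c X H' DH'"

lemma f_closed: "h \<in> carrier H \<Longrightarrow> f h \<in> carrier H'"
  by (rule hom_in_carrier[OF f_hom])

lemma f_one: "f \<one>\<^bsub>H\<^esub> = \<one>\<^bsub>H'\<^esub>"
  by (rule hom_one[OF f_hom A.is_group A'.is_group])

lemma f_word_degree: "set w \<subseteq> X \<Longrightarrow> f (word_degree H d w) = word_degree H' d' w"
  by (induction w) (simp_all add: f_one hom_mult[OF f_hom] A.d_closed A.word_degree_closed f_degree)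

lemma act_word_eq: "h \<in> carrier H \<Longrightarrow> set w \<subseteq> X \<Longrightarrow> act_word DH h w = act_word DH' (f h) w"
  by (induction w) (simp_all add: act_word_def f_act)

lemma smash_map_closed: "a \<in> bspace bos \<Longrightarrow> smash_map f a \<in> bspace bos'"
  unfolding bosonization_simps smash_map_def
proof (rule lin_ext_span[OF _ pm.subspace_span])
  fix b assume "b \<in> {smash r h | r h. r \<in> nichols c X \<and> h \<in> carrier H}"
  then obtain r h where "r \<in> nichols c X" "h \<in> carrier H" "b = smash r h" by blast
  then have "smash_map f b \<in> {smash r h | r h. r \<in> nichols c X \<and> h \<in> carrier H'}" using f_closed by auto
  then show "lin_ext (\<lambda>(w, h). bas (w, f h)) b \<in> pm.span {smash r h | r h. r \<in> nichols c X \<and> h \<in> carrier H'}"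
    unfolding smash_map_def by (rule pm.span_base)
qed

lemma smash_map_prod:
  assumes "a \<in> bspace bos" "b \<in> bspace bos"
  shows "smash_map f (bprod bos a b) = bprod bos' (smash_map f a) (smash_map f b)"
proof -
  let ?L = "\<lambda>u g w h. lin_ext (\<lambda>w'. smash (quantum_shuffle c u w') (g \<otimes>\<^bsub>H\<^esub> h)) (act_word DH g w)"
  let ?R = "\<lambda>u g w h. lin_ext (\<lambda>w'. smash (quantum_shuffle c u w') (g \<otimes>\<^bsub>H'\<^esub> h)) (act_word DH' g w)"
  have "smash_map f (bprod bos a b)
      = lin_ext (\<lambda>(u, g). lin_ext (\<lambda>(w, h). smash_map f (?L u g w h)) b) a"
    unfolding bosonization_simps smash_map_def by (simp add: lin_ext_lin_ext case_prod_unfold)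
  also have "\<dots> = lin_ext (\<lambda>(u, g). lin_ext (\<lambda>(w, h). ?R u (f g) w (f h)) b) a"
  proof (rule lin_ext_cong, clarify, rule lin_ext_cong, clarify)
    fix u g w h assume "(u, g) \<in> supp a" "(w, h) \<in> supp b"
    then have gh: "g \<in> carrier H" "h \<in> carrier H" "set w \<subseteq> X"
      using A.bspace_keys[OF assms(1)] A.bspace_keys[OF assms(2)] by blast+
    have "smash_map f (?L u g w h) = lin_ext (\<lambda>w'. smash_map f (smash (quantum_shuffle c u w') (g \<otimes>\<^bsub>H\<^esub> h))) (act_word DH g w)"
      by (simp only: smash_map_def lin_ext_lin_ext)
    then show "smash_map f (?L u g w h) = ?R u (f g) w (f h)"
      using gh by (simp add: hom_mult[OF f_hom] act_word_eq)
  qed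
  also have "\<dots> = bprod bos' (smash_map f a) (smash_map f b)"
    unfolding bosonization_simps smash_map_def by (simp add: lin_ext_lin_ext case_prod_unfold)
  finally show ?thesis .
qed

lemma bcoprod_smash:
  assumes "r \<in> nichols c X"
  shows "bcoprod bos (smash r h) = lin_ext (\<lambda>(w1, w2). bas ((w1, word_degree H d w2 \<otimes>\<^bsub>H\<^esub> h), (w2, h)))
    (lin_ext (\<lambda>w. \<Sum>i\<le>length w. bas (take i w, drop i w)) r)"
  unfolding bosonization_simps smash_def lin_ext_lin_ext
proof (rule lin_ext_cong)
  fix w assume "w \<in> supp r"
  then have "set w \<subseteq> X" by (rule A.nichols_keys[OF assms])
  then have "coact_word H DH (drop i w) = bas (word_degree H d (drop i w), drop i w)" for i
    using set_drop_subset[of i w] by (intro A.coact_word_eq) auto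
  then show "lin_ext (\<lambda>(w, h). \<Sum>i\<le>length w. lin_ext (\<lambda>(g, w'). bas ((take i w, g \<otimes>\<^bsub>H\<^esub> h), (w', h))) (coact_word H DH (drop i w))) (bas (w, h))
      = lin_ext (\<lambda>(w1, w2). bas ((w1, word_degree H d w2 \<otimes>\<^bsub>H\<^esub> h), (w2, h))) (\<Sum>i\<le>length w. bas (take i w, drop i w))"
    by (simp add: lin_ext_sum)
qed

lemma coprod_tens:
  assumes "\<And>w. w \<in> supp b \<Longrightarrow> word_degree H d w = z"
  shows "lin_ext (\<lambda>(w1, w2). bas ((w1, word_degree H d w2 \<otimes>\<^bsub>H\<^esub> h), (w2, h))) (tens a b)
    = tens (smash a (z \<otimes>\<^bsub>H\<^esub> h)) (smash b h)"
proof -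
  have "lin_ext (\<lambda>(w1, w2). bas ((w1, word_degree H d w2 \<otimes>\<^bsub>H\<^esub> h), (w2, h))) (tens a b)
      = lin_ext (\<lambda>w1. lin_ext (\<lambda>w2. bas ((w1, z \<otimes>\<^bsub>H\<^esub> h), (w2, h))) b) a"
    unfolding lin_ext_tens by (intro lin_ext_cong) (simp add: assms cong: lin_ext_cong)
  then show ?thesis by (simp add: smash_def tens_def lin_ext_lin_ext)
qed

text \<open>The identity is such a change of groups; this makes the facts about one side of the map
  available for its other side.\<close>

lemma reflexive_change: "yd_change_of_group H' X DH' ra q c d' H' DH' d' (\<lambda>x. x)"
  by unfold_locales (simp_all add: hom_ident)

lemma smash_map_coprod:
  assumes "a \<in> bspace bos"
  shows "\<exists>ts. set ts \<subseteq> bspace bos \<times> bspace bos \<and>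
    bcoprod bos a = (\<Sum>(b, b')\<leftarrow>ts. tens b b') \<and>
    bcoprod bos' (smash_map f a) = (\<Sum>(b, b')\<leftarrow>ts. tens (smash_map f b) (smash_map f b'))"
  using assms[unfolded bosonization_simps(1)]
proof (induction rule: pm.span_induct_alt)
  case base
  show ?case by (rule exI[of _ "[]"]) (simp add: bosonization_simps smash_map_def)
next
  case (step t s y)
  then obtain r h where r: "r \<in> nichols c X" and h: "h \<in> carrier H" and s: "s = smash r h" by blast
  obtain us where us: "\<And>a b. (a, b) \<in> set us \<Longrightarrow> a \<in> nichols c X \<and> b \<in> nichols c X \<and>
       (\<exists>z\<in>carrier H. \<forall>w\<in>supp b. word_degree H d w = z)"
    "lin_ext (\<lambda>w. \<Sum>i\<le>length w. bas (take i w, drop i w)) r = (\<Sum>(a, b)\<leftarrow>us. tens a b)"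
    using A.nichols_coproduct_homogeneous[OF r] by blast
  obtain ys where ys: "set ys \<subseteq> bspace bos \<times> bspace bos" "bcoprod bos y = (\<Sum>(b, b')\<leftarrow>ys. tens b b')"
    "bcoprod bos' (smash_map f y) = (\<Sum>(b, b')\<leftarrow>ys. tens (smash_map f b) (smash_map f b'))"
    using step by blast
  define z where "z b = (SOME z. z \<in> carrier H \<and> (\<forall>w\<in>supp b. word_degree H d w = z))" for b :: "'x list \<Rightarrow>\<^sub>0 'k"
  have z: "z b \<in> carrier H \<and> (\<forall>w\<in>supp b. word_degree H d w = z b)" if "(a, b) \<in> set us" for a b
  proof -
    have "\<exists>z. z \<in> carrier H \<and> (\<forall>w\<in>supp b. word_degree H d w = z)" using us(1)[OF that] by blast
    then show ?thesis unfolding z_def by (rule someI_ex)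
  qed
  let ?g = "\<lambda>(a, b). (pm_scale t (smash a (z b \<otimes>\<^bsub>H\<^esub> h)), smash b h)"
  interpret R: yd_change_of_group H' X DH' ra q c d' H' DH' d' "\<lambda>x. x" by (rule reflexive_change)
  have 1: "bcoprod bos (smash r h) = (\<Sum>(a, b)\<leftarrow>us. tens (smash a (z b \<otimes>\<^bsub>H\<^esub> h)) (smash b h))"
    unfolding bcoprod_smash[OF r] us(2) lin_ext_sum_list
    by (rule arg_cong[of _ _ sum_list], rule map_cong) (use z in \<open>auto intro!: coprod_tens\<close>)
  have 2: "bcoprod bos' (smash r (f h)) = (\<Sum>(a, b)\<leftarrow>us. tens (smash a (f (z b \<otimes>\<^bsub>H\<^esub> h))) (smash b (f h)))"
    unfolding R.bcoprod_smash[OF r] us(2) lin_ext_sum_list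
  proof (rule arg_cong[of _ _ sum_list], rule map_cong, rule refl, clarify)
    fix a b assume ab: "(a, b) \<in> set us"
    have "word_degree H' d' w = f (z b)" if "w \<in> supp b" for w
      using f_word_degree[OF A.nichols_keys[OF _ that]] us(1)[OF ab] z[OF ab] that by auto
    then show "lin_ext (\<lambda>(w1, w2). bas ((w1, word_degree H' d' w2 \<otimes>\<^bsub>H'\<^esub> f h), w2, f h)) (tens a b)
        = tens (smash a (f (z b \<otimes>\<^bsub>H\<^esub> h))) (smash b (f h))"
      using R.coprod_tens[of b "f (z b)" "f h" a] z[OF ab] h by (simp add: hom_mult[OF f_hom])
  qed
  have scale: "pm_scale t (\<Sum>(a, b)\<leftarrow>us. tens (p a b) (p' a b)) = (\<Sum>(a, b)\<leftarrow>us. tens (pm_scale t (p a b)) (p' a b))"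
    for p p' :: "('x list \<Rightarrow>\<^sub>0 'k) \<Rightarrow> ('x list \<Rightarrow>\<^sub>0 'k) \<Rightarrow> ('i \<Rightarrow>\<^sub>0 'k)"
    by (induction us) (auto simp: pm.scale_right_distrib tens_scale_left)
  have "set (map ?g us @ ys) \<subseteq> bspace bos \<times> bspace bos"
  proof -
    have "?g (a, b) \<in> bspace bos \<times> bspace bos" if "(a, b) \<in> set us" for a b
    proof -
      have "smash a (z b \<otimes>\<^bsub>H\<^esub> h) \<in> bspace bos" "smash b h \<in> bspace bos"
        using us(1)[OF that] z[OF that] h by (auto intro!: smash_in_bspace)
      then show ?thesis unfolding bosonization_simps by (simp add: pm.span_scale)
    qed
    then show ?thesis using ys(1) by auto
  qed
  moreover have "bcoprod bos (pm_scale t s + y) = (\<Sum>(b, b')\<leftarrow>map ?g us @ ys. tens b b')"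
  proof -
    have "bcoprod bos (pm_scale t s + y) = pm_scale t (bcoprod bos s) + bcoprod bos y"
      unfolding bosonization_simps by (simp only: lin_ext_add lin_ext_scale)
    then show ?thesis unfolding s 1 ys(2) scale by (simp add: case_prod_unfold comp_def)
  qed
  moreover have "bcoprod bos' (smash_map f (pm_scale t s + y))
      = (\<Sum>(b, b')\<leftarrow>map ?g us @ ys. tens (smash_map f b) (smash_map f b'))"
  proof -
    have F: "smash_map f (pm_scale t s + y) = pm_scale t (smash r (f h)) + smash_map f y"
      unfolding s by (simp add: smash_map_add smash_map_scale)
    have "bcoprod bos' (pm_scale t (smash r (f h)) + smash_map f y)
        = pm_scale t (bcoprod bos' (smash r (f h))) + bcoprod bos' (smash_map f y)"
      unfolding bosonization_simps by (simp only: lin_ext_add lin_ext_scale)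
    then show ?thesis unfolding F 2 ys(3) scale by (simp add: case_prod_unfold comp_def smash_map_scale)
  qed
  ultimately show ?case by blast
qed

lemma bcounit_eq:
  "bcounit (bosonization c X K D) a
    = coef (lin_ext (\<lambda>p. if fst p = [] then bas () else 0) a) ()"
  unfolding bosonization_simps lookup_lin_ext by (intro sum.cong) auto

lemma hopf_map_smash_map: "hopf_map (smash_map f) bos bos'"
  unfolding hopf_map_def
proof (intro conjI ballI allI)
  show "smash_map f (bunit bos) = bunit bos'"
    by (simp add: bosonization_simps smash_map_def f_one)
  show "bcounit bos' (smash_map f a) = bcounit bos a" for a
    unfolding bcounit_eq smash_map_def lin_ext_lin_ext by (simp add: case_prod_unfold)
qed (simp_all only: smash_map_closed smash_map_prod smash_map_coprod smash_map_add smash_map_scale)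

lemma hopf_covering_smash_map:
  assumes "generate H (d ` X) = carrier H" "generate H' (d' ` X) = carrier H'"
  shows "hopf_covering c X H DH H' DH' (smash_map f)"
  unfolding hopf_covering_def
proof (intro conjI)
  show "realizes c X H DH" using A.yd A.braiding by (simp add: realizes_def)
  show "realizes c X H' DH'" using A'.yd A'.braiding by (simp add: realizes_def)
  have "yd_support X DH = d ` X" unfolding yd_support_def using A.coact by auto
  then show "link_indecomposable X H DH" using assms(1) by (simp add: link_indecomposable_def)
  show "hopf_map (smash_map f) bos bos'" by (rule hopf_map_smash_map)
  have "d' ` X \<subseteq> f ` carrier H" using f_degree A.d_closed by (metis image_eqI image_subsetI)
  then have "f \<in> epi H H'" by (rule epi_of_generators[OF A.is_group A'.is_group f_hom assms(2)])
  then show "\<exists>g\<in>epi H H'. \<forall>r\<in>nichols c X. \<forall>h\<in>carrier H. smash_map f (smash r h) = smash r (g h)"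
    by (intro bexI[of _ f]) simp_all
qed

end

section \<open>Hopf coverings are homogeneous\<close>

text \<open>If pushing the coaction forward along \<open>f\<close> makes the vectors \<open>v\<^sub>x\<close> homogeneous of pairwise
  distinct degrees \<open>x\<close>, then they were homogeneous before: coassociativity, with \<open>f\<close> applied to
  either group factor, shows that only terms \<open>h \<otimes> v\<^sub>x\<close> with \<open>f h = x\<close> occur in the coaction of
  \<open>v\<^sub>x\<close>, and without \<open>f\<close> that there is only one such \<open>h\<close>.\<close>

lemma (in yd_module) homogeneous_of_push_forward:
  fixes f :: "'h \<Rightarrow> 'x"
  assumes push: "\<And>x. x \<in> X \<Longrightarrow> lin_ext (\<lambda>(h, y). bas (f h, y)) (yd_coact DH x) = bas (x, x)"
    and x: "x \<in> X"
  shows "\<exists>h\<in>carrier H. f h = x \<and> yd_coact DH x = bas (h, x)"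
proof -
  let ?u = "yd_coact DH x"
  have "?u \<noteq> 0"
  proof
    assume "?u = 0"
    then have "lin_ext (\<lambda>(h, y). bas (f h, y)) ?u = 0" by simp
    then have "coef (bas (x, x) :: _ \<Rightarrow>\<^sub>0 'k) (x, x) = 0"
      unfolding push[OF x] by (simp only: lookup_zero)
    then show False by simp
  qed
  then have ne: "supp ?u \<noteq> {}" by simp
  have keys: "f h = x \<and> y = x" if k: "(h, y) \<in> supp ?u" for h y
  proof
    \<comment> \<open>Coassociativity with \<open>f\<close> on the second group factor.\<close>
    have "lin_ext (\<lambda>(h, h', y). bas (h, f h', y)) (lin_ext (\<lambda>(h, y). bas (h, h, y)) ?u)
        = lin_ext (\<lambda>(h, h', y). bas (h, f h', y))
            (lin_ext (\<lambda>(h, y). lin_ext (\<lambda>(h', z). bas (h, h', z)) (yd_coact DH y)) ?u)"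
      by (rule arg_cong[OF coact_coassoc[OF x]])
    then have "lin_ext (\<lambda>(h, y). bas (h, f h, y)) ?u
        = lin_ext (\<lambda>(h, y). lin_ext (\<lambda>(h', z). bas (h, f h', z)) (yd_coact DH y)) ?u"
      by (simp add: lin_ext_lin_ext case_prod_unfold)
    also have "\<dots> = lin_ext (\<lambda>(h, y). bas (h, y, y)) ?u"
    proof (rule lin_ext_cong, clarify)
      fix h y assume "(h, y) \<in> supp ?u"
      then have "y \<in> X" using coact_keys[OF x] by blast
      then have "lin_ext (\<lambda>(g, z). bas (h, g, z)) (lin_ext (\<lambda>(h, y). bas (f h, y)) (yd_coact DH y)) = bas (h, y, y)"
        by (simp add: push)
      then show "lin_ext (\<lambda>(h', z). bas (h, f h', z)) (yd_coact DH y) = bas (h, y, y)"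
        by (simp add: lin_ext_lin_ext case_prod_unfold)
    qed
    finally have "supp (lin_ext (\<lambda>p. bas (fst p, f (fst p), snd p)) ?u)
        = supp (lin_ext (\<lambda>p. bas (fst p, snd p, snd p)) ?u)"
      by (simp add: case_prod_unfold)
    then have "(\<lambda>p. (fst p, f (fst p), snd p)) ` supp ?u
        = (\<lambda>p. (fst p, snd p, snd p)) ` supp ?u"
      by (subst (asm) (1 2) keys_lin_ext_inj) (auto simp: inj_on_def)
    moreover have "(h, f h, y) \<in> (\<lambda>p. (fst p, f (fst p), snd p)) ` supp ?u" using k by force
    ultimately have fy: "f h = y" by auto
    \<comment> \<open>The same computation, with \<open>f\<close> on the first group factor.\<close>
    have "lin_ext (\<lambda>(h, h', y). bas (f h, h', y)) (lin_ext (\<lambda>(h, y). bas (h, h, y)) ?u)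
        = lin_ext (\<lambda>(h, h', y). bas (f h, h', y))
            (lin_ext (\<lambda>(h, y). lin_ext (\<lambda>(h', z). bas (h, h', z)) (yd_coact DH y)) ?u)"
      by (rule arg_cong[OF coact_coassoc[OF x]])
    then have "lin_ext (\<lambda>(h, y). bas (f h, h, y)) ?u
        = lin_ext (\<lambda>(g, y). lin_ext (\<lambda>(h', z). bas (g, h', z)) (yd_coact DH y)) (lin_ext (\<lambda>(h, y). bas (f h, y)) ?u)"
      by (simp add: lin_ext_lin_ext case_prod_unfold)
    then have "lin_ext (\<lambda>(h, y). bas (f h, h, y)) ?u = lin_ext (\<lambda>(h', z). bas (x, h', z)) ?u"
      by (simp add: push[OF x])
    then have "supp (lin_ext (\<lambda>p. bas (f (fst p), fst p, snd p)) ?u)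
        = supp (lin_ext (\<lambda>p. bas (x, fst p, snd p)) ?u)"
      by (simp add: case_prod_unfold)
    then have "(\<lambda>p. (f (fst p), fst p, snd p)) ` supp ?u
        = (\<lambda>p. (x, fst p, snd p)) ` supp ?u"
      by (subst (asm) (1 2) keys_lin_ext_inj) (auto simp: inj_on_def)
    moreover have "(f h, h, y) \<in> (\<lambda>p. (f (fst p), fst p, snd p)) ` supp ?u" using k by force
    ultimately show "f h = x" by auto
    then show "y = x" using fy by simp
  qed
  \<comment> \<open>Coassociativity now says that \<open>h1 \<otimes> h2 \<otimes> v\<^sub>x\<close> has coefficient zero unless \<open>h1 = h2\<close>.\<close>
  have unique: "h1 = h2" if k: "(h1, x) \<in> supp ?u" "(h2, x) \<in> supp ?u" for h1 h2
  proof -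
    let ?\<phi> = "\<lambda>p. (fst (fst p), fst (snd p), snd (snd p))"
    have "lin_ext (\<lambda>(h, y). lin_ext (\<lambda>(h', z). bas (h, h', z)) (yd_coact DH y)) ?u
        = lin_ext (\<lambda>(h, y). lin_ext (\<lambda>(h', z). bas (h, h', z)) ?u) ?u"
      by (rule lin_ext_cong) (use keys in auto)
    also have "\<dots> = lin_ext (\<lambda>p. bas (?\<phi> p)) (tens ?u ?u)"
      by (simp add: lin_ext_tens case_prod_unfold)
    finally have e: "lin_ext (\<lambda>(h, y). bas (h, h, y)) ?u = lin_ext (\<lambda>p. bas (?\<phi> p)) (tens ?u ?u)"
      using coact_coassoc[OF x] by simp
    have kt: "p \<in> supp (tens ?u ?u) \<longleftrightarrow> fst p \<in> supp ?u \<and> snd p \<in> supp ?u" for p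
      by (cases p) (simp add: in_keys_iff lookup_tens)
    have "inj_on ?\<phi> (supp (tens ?u ?u))"
    proof (rule inj_onI)
      fix p p' assume pp: "p \<in> supp (tens ?u ?u)" "p' \<in> supp (tens ?u ?u)" "?\<phi> p = ?\<phi> p'"
      have "snd (fst p) = x" "snd (fst p') = x"
        using keys[of "fst (fst p)" "snd (fst p)"] keys[of "fst (fst p')" "snd (fst p')"] pp(1,2) by (simp_all add: kt)
      then show "p = p'" using pp(3) by (simp add: prod_eq_iff)
    qed
    then have "supp (lin_ext (\<lambda>p. bas (?\<phi> p)) (tens ?u ?u)) = ?\<phi> ` supp (tens ?u ?u)"
      by (rule keys_lin_ext_inj)
    moreover have "(h1, h2, x) \<in> ?\<phi> ` supp (tens ?u ?u)"
      by (rule image_eqI[of _ _ "((h1, x), (h2, x))"]) (use k kt in auto)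
    ultimately have "(h1, h2, x) \<in> supp (lin_ext (\<lambda>(h, y). bas (h, h, y)) ?u)"
      using e by simp
    then show ?thesis using keys_lin_ext[of "\<lambda>(h, y). bas (h, h, y)" ?u] by fastforce
  qed
  obtain p0 where p0: "p0 \<in> supp ?u" using ne by blast
  define h where "h = fst p0"
  have h: "(h, x) \<in> supp ?u"
    using p0 keys[of "fst p0" "snd p0"] unfolding h_def by (metis prod.collapse)
  have "p = (h, x)" if "p \<in> supp ?u" for p
    using that h keys[of "fst p" "snd p"] unique[of "fst p" h] by (cases p) simp
  then have "supp ?u = {(h, x)}" using h by blast
  then obtain p t where pt: "?u = Poly_Mapping.single p t" using keys_single_subset[of ?u] by auto
  have "(h, x) \<in> supp (Poly_Mapping.single p t)" using h by (simp only: pt)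
  then have p: "p = (h, x)" by (simp split: if_splits)
  then have "Poly_Mapping.single x t = bas x" using coact_counit[OF x] pt by simp
  then have "t = 1" by (metis lookup_single_eq)
  then have "?u = bas (h, x)" using pt p by simp
  moreover have "f h = x" "h \<in> carrier H" using h keys coact_keys[OF x] by blast+
  ultimately show ?thesis by blast
qed

text \<open>Hopf maps are linear on the bosonization, which the elements \<open>r # h\<close> span.\<close>

lemma hopf_map_eq_smash_map:
  assumes hopf: "hopf_map F (bosonization c X H DH) A"
    and F: "\<And>r h. r \<in> nichols c X \<Longrightarrow> h \<in> carrier H \<Longrightarrow> F (smash r h) = smash r (f h)"
    and a: "a \<in> bspace (bosonization c X H DH)"
  shows "F a = smash_map f a"
proof -
  let ?B = "bspace (bosonization c X H DH)"
  have "a \<in> ?B \<and> F a = smash_map f a"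
    using a[unfolded bosonization_simps]
  proof (induction rule: pm.span_induct_alt)
    case base
    have 0: "0 \<in> ?B" by (simp add: bosonization_simps pm.span_zero)
    then have "F (pm_scale 0 0) = pm_scale 0 (F 0)" using hopf unfolding hopf_map_def by blast
    then show ?case using 0 by (simp add: smash_map_def)
  next
    case (step t z y)
    have z: "z \<in> ?B" using step(1) unfolding bosonization_simps by (rule pm.span_base)
    have tz: "pm_scale t z \<in> ?B" using z by (simp add: bosonization_simps pm.span_scale)
    have "F (pm_scale t z + y) = pm_scale t (F z) + F y" using hopf z tz step(2) unfolding hopf_map_def by metis
    moreover have "F z = smash_map f z" using step(1) F by auto
    moreover have "pm_scale t z + y \<in> ?B" using tz step(2) by (simp add: bosonization_simps pm.span_add)
    ultimately show ?case using step(2) by (simp add: smash_map_add smash_map_scale)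
  qed
  then show ?thesis ..
qed

text \<open>Comparing the coproducts of \<open>v\<^sub>x # 1\<close> shows that a Hopf covering pushes coactions forward.\<close>

lemma hopf_covering_push_forward:
  fixes X :: "'x set" and DH :: "('h, 'x, 'k::field) yd_struct" and D :: "('g, 'x, 'k) yd_struct"
    and H :: "('h, 'm) monoid_scheme" and G :: "('g, 'n) monoid_scheme"
  assumes cov: "hopf_covering c X H DH G D F" and f: "f \<in> hom H G"
    and Ff: "\<And>r h. r \<in> nichols c X \<Longrightarrow> h \<in> carrier H \<Longrightarrow> F (smash r h) = smash r (f h)"
    and x: "x \<in> X" "bas [x] \<in> nichols c X"
    and coact: "yd_coact D x = bas (g, x)" and g: "g \<in> carrier G"
  shows "lin_ext (\<lambda>(h, y). bas (f h, y)) (yd_coact DH x) = bas (g, x)"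
proof -
  let ?A = "bosonization c X H DH" and ?A' = "bosonization c X G D"
  let ?m = "\<lambda>p. (fst p, f (snd p))"
  have ydH: "yetter_drinfeld H X DH" and ydG: "yetter_drinfeld G X D" and hopf: "hopf_map F ?A ?A'"
    using cov by (auto simp: hopf_covering_def realizes_def)
  interpret H: yd_module H X DH by (rule yd_module.intro[OF ydH])
  interpret G: yd_module G X D by (rule yd_module.intro[OF ydG])
  have f1: "f \<one>\<^bsub>H\<^esub> = \<one>\<^bsub>G\<^esub>" by (rule hom_one[OF f H.is_group G.is_group])
  have F: "F a = smash_map f a" if "a \<in> bspace ?A" for a
    by (rule hopf_map_eq_smash_map[OF hopf Ff that])
  let ?a = "bas ([x], \<one>\<^bsub>H\<^esub>)"
  have "smash (bas [x]) \<one>\<^bsub>H\<^esub> \<in> bspace ?A" using x(2) by (rule smash_in_bspace) simp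
  then have a: "?a \<in> bspace ?A" by (simp add: smash_def)
  obtain ts where ts: "set ts \<subseteq> bspace ?A \<times> bspace ?A" "bcoprod ?A ?a = (\<Sum>(b, b')\<leftarrow>ts. tens b b')"
    "bcoprod ?A' (F ?a) = (\<Sum>(b, b')\<leftarrow>ts. tens (F b) (F b'))"
    using hopf a unfolding hopf_map_def by blast
  have "lin_ext (\<lambda>(p, r). tens (bas (?m p)) (bas (?m r))) (bcoprod ?A ?a)
      = (\<Sum>(b, b')\<leftarrow>ts. tens (F b) (F b'))"
    unfolding ts(2) lin_ext_sum_list
  proof (rule arg_cong[of _ _ sum_list], rule map_cong, rule refl, clarify)
    fix b b' assume "(b, b') \<in> set ts"
    then have "F b = lin_ext (\<lambda>p. bas (?m p)) b" "F b' = lin_ext (\<lambda>p. bas (?m p)) b'"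
      using ts(1) F by (auto simp: smash_map_def case_prod_unfold)
    then show "lin_ext (\<lambda>(p, r). tens (bas (?m p)) (bas (?m r))) (tens b b') = tens (F b) (F b')"
      using lin_ext_tens_prod[of "\<lambda>p. bas (?m p)" "\<lambda>p. bas (?m p)" b b'] by simp
  qed
  then have key: "lin_ext (\<lambda>(p, r). tens (bas (?m p)) (bas (?m r))) (bcoprod ?A ?a) = bcoprod ?A' (bas ([x], \<one>\<^bsub>G\<^esub>))"
    using ts(3) F[OF a] by (simp add: smash_map_def f1)
  \<comment> \<open>The first summand of the coproduct of \<open>v\<^sub>x # 1\<close> is the coaction of \<open>v\<^sub>x\<close>.\<close>
  have co: "bcoprod (bosonization c X K D') (bas ([x], \<one>\<^bsub>K\<^esub>))
      = lin_ext (\<lambda>(h, y). bas (([], h), ([y], \<one>\<^bsub>K\<^esub>))) (yd_coact D' x) + bas (([x], \<one>\<^bsub>K\<^esub>), ([], \<one>\<^bsub>K\<^esub>))"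
    if "yetter_drinfeld K X D'" for K :: "('i, 'j) monoid_scheme" and D' :: "('i, 'x, 'k) yd_struct"
  proof -
    interpret K: yd_module K X D' by (rule yd_module.intro[OF that])
    have "lin_ext (\<lambda>(g, w'). bas (([], g \<otimes>\<^bsub>K\<^esub> \<one>\<^bsub>K\<^esub>), (w', \<one>\<^bsub>K\<^esub>))) (coact_word K D' [x])
        = lin_ext (\<lambda>(h, y). bas (([], h \<otimes>\<^bsub>K\<^esub> \<one>\<^bsub>K\<^esub> \<otimes>\<^bsub>K\<^esub> \<one>\<^bsub>K\<^esub>), ([y], \<one>\<^bsub>K\<^esub>))) (yd_coact D' x)"
      by (simp add: coact_word_def lin_ext_lin_ext case_prod_unfold)
    also have "\<dots> = lin_ext (\<lambda>(h, y). bas (([], h), ([y], \<one>\<^bsub>K\<^esub>))) (yd_coact D' x)"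
      by (rule lin_ext_cong) (use K.coact_keys[OF x(1)] in auto)
    finally show ?thesis
      by (simp add: bosonization_simps atMost_Suc coact_word_def)
  qed
  have "lin_ext (\<lambda>(h, y). bas (([] :: 'x list, f h), ([y], \<one>\<^bsub>G\<^esub>))) (yd_coact DH x) = bas (([], g), ([x], \<one>\<^bsub>G\<^esub>))"
    using key unfolding co[OF ydH] co[OF ydG] by (simp add: lin_ext_add lin_ext_lin_ext case_prod_unfold f1 coact)
  then have "lin_ext (\<lambda>p. bas (snd (fst p), hd (fst (snd p))))
        (lin_ext (\<lambda>(h, y). bas (([] :: 'x list, f h), ([y], \<one>\<^bsub>G\<^esub>))) (yd_coact DH x))
      = lin_ext (\<lambda>p. bas (snd (fst p), hd (fst (snd p)))) (bas (([] :: 'x list, g), ([x], \<one>\<^bsub>G\<^esub>)))"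
    by (rule arg_cong)
  then show ?thesis by (simp add: lin_ext_lin_ext case_prod_unfold)
qed

section \<open>The universal Hopf covering\<close>

context rack_yd_module
begin

abbreviation "\<pi> \<equiv> enveloping_proj G"
abbreviation "DX \<equiv> enveloping_yd G X D"

lemma generator_map_id: "generator_map G X (\<lambda>x. x)"
  using X_closed by unfold_locales auto

lemma conj_relation: "x \<in> X \<Longrightarrow> y \<in> X \<Longrightarrow> x \<otimes> y = conjugate G x y \<otimes> x"
  using conjugate_mult X_closed by (metis subsetD)

lemma proj_hom: "\<pi> \<in> hom GX G"
  using enveloping_map_hom[OF generator_map_id conj_relation] by (simp add: enveloping_proj_eq id_def)

lemma proj_gx: "x \<in> X \<Longrightarrow> \<pi> (gx x) = x"
  using enveloping_map_gen[OF generator_map_id conj_relation] by (simp add: enveloping_proj_eq id_def)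

lemma proj_closed: "g \<in> carrier GX \<Longrightarrow> \<pi> g \<in> carrier G"
  by (rule hom_in_carrier[OF proj_hom])

lemma proj_epi: "\<pi> \<in> epi GX G"
proof (rule epi_of_generators[OF GX.is_group is_group proj_hom generates])
  show "X \<subseteq> \<pi> ` carrier GX" using proj_gx gx.d_closed by (metis image_eqI subsetI)
qed

sublocale GY: homogeneous_yd_module G X D "conjugate G" q c "\<lambda>x. x"
proof
  show "yetter_drinfeld G X D" by (rule yd)
qed (use X_closed coact c_braiding q_nonzero in auto)

text \<open>The relations of the enveloping group are the case of a generator \<open>g\<close>; both sides are
  multiplicative in \<open>g\<close>.\<close>

lemma gx_conjugate:
  assumes "g \<in> carrier GX" "x \<in> X"
  shows "gx (conjugate G (\<pi> g) x) = conjugate GX g (gx x)"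
proof -
  interpret p: group_hom GX G \<pi> by (intro group_hom.intro group_hom_axioms.intro GX.is_group is_group proj_hom)
  have conj_mult: "conjugate K (a \<otimes>\<^bsub>K\<^esub> b) z = conjugate K a (conjugate K b z)"
    if "group K" "a \<in> carrier K" "b \<in> carrier K" "z \<in> carrier K" for K :: "('i, 'j) monoid_scheme" and a b z
  proof -
    interpret K: group K by fact
    show ?thesis using that by (simp add: conjugate_def K.inv_mult_group K.m_assoc)
  qed
  have conj_gen: "gx (conjugate G y z) = conjugate GX (gx y) (gx z)" if "y \<in> X" "z \<in> X" for y z
    using gx_relation[OF that] gx.d_closed that ra_closed
    by (simp add: conjugate_def GX.m_assoc)
  have "\<forall>x\<in>X. gx (conjugate G (\<pi> g) x) = conjugate GX g (gx x)"
    using assms(1)[unfolded GX_eq]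
  proof (induction rule: E.generation_induct)
    case one
    have "gx (conjugate G (\<pi> \<one>\<^bsub>GX\<^esub>) x) = conjugate GX \<one>\<^bsub>GX\<^esub> (gx x)" if "x \<in> X" for x
      using that X_closed gx.d_closed by (auto simp: conjugate_def)
    then show ?case by (simp add: GX_eq)
  next
    case (gen y C)
    then have C: "C \<in> carrier GX" by (simp add: GX_eq)
    have "gx (conjugate G (\<pi> (gx y \<otimes>\<^bsub>GX\<^esub> C)) x) = conjugate GX (gx y \<otimes>\<^bsub>GX\<^esub> C) (gx x)" if x: "x \<in> X" for x
    proof -
      have y: "y \<in> carrier G" and xG: "x \<in> carrier G" using gen(1) x X_closed by auto
      have z: "conjugate G (\<pi> C) x \<in> X" using conj_closed[OF proj_closed[OF C] x] .
      have "conjugate G (\<pi> (gx y \<otimes>\<^bsub>GX\<^esub> C)) x = conjugate G y (conjugate G (\<pi> C) x)"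
        using C gx.d_closed[OF gen(1)] y xG conj_mult[OF is_group y proj_closed[OF C] xG]
        by (simp add: proj_gx[OF gen(1)])
      then show ?thesis
        using conj_gen[OF gen(1) z]
          gen(3) x conj_mult[OF GX.is_group gx.d_closed[OF gen(1)] C gx.d_closed[OF x]] by simp
    qed
    then show ?case by (simp add: GX_eq gx_eq)
  next
    case (inv y C)
    then have C: "C \<in> carrier GX" by (simp add: GX_eq)
    have "gx (conjugate G (\<pi> (inv\<^bsub>GX\<^esub> gx y \<otimes>\<^bsub>GX\<^esub> C)) x) = conjugate GX (inv\<^bsub>GX\<^esub> gx y \<otimes>\<^bsub>GX\<^esub> C) (gx x)" if x: "x \<in> X" for x
    proof -
      have y: "y \<in> carrier G" and xG: "x \<in> carrier G" using inv(1) x X_closed by auto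
      let ?x = "conjugate G (\<pi> C) x"
      let ?z = "conjugate G (inv y) ?x"
      have x': "?x \<in> X" using conj_closed[OF proj_closed[OF C] x] .
      have z: "?z \<in> X" using conj_closed[OF _ x'] y by simp
      have xG': "?x \<in> carrier G" "?z \<in> carrier G" using x' z X_closed by auto
      have iy: "inv\<^bsub>GX\<^esub> gx y \<in> carrier GX" using gx.d_closed[OF inv(1)] by simp
      have "conjugate G y ?z = ?x" using y xG'(1) by (simp add: conjugate_def m_assoc) (simp add: m_assoc[symmetric])
      then have "gx ?x = conjugate GX (gx y) (gx ?z)"
        using conj_gen[OF inv(1) z] by simp
      then have 1: "conjugate GX (inv\<^bsub>GX\<^esub> gx y) (gx ?x) = gx ?z"
        using gx.d_closed[OF inv(1)] gx.d_closed[OF z] by (simp add: conjugate_def GX.m_assoc) (simp add: GX.m_assoc[symmetric])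
      have "conjugate G (\<pi> (inv\<^bsub>GX\<^esub> gx y \<otimes>\<^bsub>GX\<^esub> C)) x = ?z"
        using C iy y xG conj_mult[OF is_group _ proj_closed[OF C] xG, of "inv y"] gx.d_closed[OF inv(1)]
        by (simp add: proj_gx[OF inv(1)])
      then show ?thesis
        using 1 inv(3) x conj_mult[OF GX.is_group iy C gx.d_closed[OF x]] by simp
    qed
    then show ?case by (simp add: GX_eq gx_eq)
  qed
  then show ?thesis using assms(2) by blast
qed

lemma DX_simps [simp]: "yd_act DX g = yd_act D (\<pi> g)" "yd_coact DX x = bas (gx x, x)"
  by (simp_all add: enveloping_yd_def)

lemma yetter_drinfeld_enveloping: "yetter_drinfeld GX X DX"
  unfolding yetter_drinfeld_def
proof (intro conjI ballI)
  interpret p: group_hom GX G \<pi> by (intro group_hom.intro group_hom_axioms.intro GX.is_group is_group proj_hom)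
  show "group GX" by (rule GX.is_group)
  fix x assume x: "x \<in> X"
  show "yd_act DX \<one>\<^bsub>GX\<^esub> x = bas x" using GY.act_one[OF x] by simp
  show "supp (yd_coact DX x) \<subseteq> carrier GX \<times> X" using x gx.d_closed by simp
  show "lin_ext (\<lambda>(h, y). bas y) (yd_coact DX x) = bas x" by simp
  show "lin_ext (\<lambda>(h, y). bas (h, h, y)) (yd_coact DX x)
      = lin_ext (\<lambda>(h, y). lin_ext (\<lambda>(h', z). bas (h, h', z)) (yd_coact DX y)) (yd_coact DX x)" by simp
next
  fix g x assume g: "g \<in> carrier GX" and x: "x \<in> X"
  show "supp (yd_act DX g x) \<subseteq> X" using GY.act_keys[OF proj_closed[OF g] x] by auto
  have "lin_ext (yd_coact DX) (yd_act DX g x) = lin_ext (\<lambda>z. bas (conjugate GX g (gx x), z)) (yd_act DX g x)"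
  proof (rule lin_ext_cong)
    fix z assume "z \<in> supp (yd_act DX g x)"
    then have "z = conjugate G (\<pi> g) x" using GY.act_degree[OF proj_closed[OF g] x] by simp
    then have "gx z = conjugate GX g (gx x)" using gx_conjugate[OF g x] by simp
    then show "yd_coact DX z = bas (conjugate GX g (gx x), z)" by simp
  qed
  then show "lin_ext (yd_coact DX) (yd_act DX g x)
      = lin_ext (\<lambda>(h, y). lin_ext (\<lambda>z. bas (conjugate GX g h, z)) (yd_act DX g y)) (yd_coact DX x)" by simp
next
  interpret p: group_hom GX G \<pi> by (intro group_hom.intro group_hom_axioms.intro GX.is_group is_group proj_hom)
  fix g h x assume gh: "g \<in> carrier GX" "h \<in> carrier GX" and x: "x \<in> X"
  show "yd_act DX (g \<otimes>\<^bsub>GX\<^esub> h) x = lin_ext (yd_act DX g) (yd_act DX h x)"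
    using GY.act_mult[OF proj_closed[OF gh(1)] proj_closed[OF gh(2)] x] gh by simp
qed

sublocale EY: homogeneous_yd_module GX X DX "conjugate G" q c gx
proof
  show "yetter_drinfeld GX X DX" by (rule yetter_drinfeld_enveloping)
  show "yd_braiding DX x y = c x y" if "x \<in> X" "y \<in> X" for x y
    using that by (simp add: c_braiding yd_braiding_def proj_gx coact)
qed (use gx.d_closed q_nonzero in auto)

lemma generate_gx: "generate GX (gx ` X) = carrier GX"
  unfolding GX_eq gx_eq by (rule E.generate_gen)

lemma hopf_covering_proj: "hopf_covering c X GX DX G D (smash_map \<pi>)"
proof -
  interpret yd_change_of_group GX X DX "conjugate G" q c gx G D "\<lambda>x. x" \<pi>
    by unfold_locales (simp_all add: proj_hom proj_gx)
  show ?thesis by (rule hopf_covering_smash_map) (simp_all add: generate_gx generates)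
qed

text \<open>A Hopf covering of \<open>B(V) # kG\<close> has homogeneous degrees, which satisfy the relations of the
  enveloping group. The actions are compatible because they agree on generators.\<close>

lemma hopf_covering_factor:
  fixes H :: "'h monoid" and DH :: "('h, 'a, 'k) yd_struct"
  assumes cov: "hopf_covering c X H DH G D F"
  shows "\<exists>E. hopf_covering c X GX DX H DH E \<and>
    (\<forall>a\<in>bspace (bosonization c X GX DX). smash_map \<pi> a = F (E a))"
proof -
  obtain f where "f \<in> epi H G" and Ff: "\<And>r h. r \<in> nichols c X \<Longrightarrow> h \<in> carrier H \<Longrightarrow> F (smash r h) = smash r (f h)"
    and real: "yetter_drinfeld H X DH" "\<And>x y. x \<in> X \<Longrightarrow> y \<in> X \<Longrightarrow> yd_braiding DH x y = c x y"
    and link: "generate H (yd_support X DH) = carrier H" and hopf: "hopf_map F (bosonization c X H DH) (bosonization c X G D)"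
    using cov unfolding hopf_covering_def realizes_def link_indecomposable_def by blast
  then have f: "f \<in> hom H G" by (simp add: epi_def)
  interpret Y: yd_module H X DH by (rule yd_module.intro[OF real(1)])
  have "lin_ext (\<lambda>(h, y). bas (f h, y)) (yd_coact DH x) = bas (x, x)" if "x \<in> X" for x
    using that X_closed by (intro hopf_covering_push_forward[OF cov f Ff]) (auto intro: short_word_in_nichols coact)
  then have "\<exists>h\<in>carrier H. f h = x \<and> yd_coact DH x = bas (h, x)" if "x \<in> X" for x
    using Y.homogeneous_of_push_forward that by blast
  then obtain d where d: "\<And>x. x \<in> X \<Longrightarrow> d x \<in> carrier H" "\<And>x. x \<in> X \<Longrightarrow> f (d x) = x"
    "\<And>x. x \<in> X \<Longrightarrow> yd_coact DH x = bas (d x, x)" by metis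
  interpret HY: homogeneous_yd_module H X DH "conjugate G" q c d
    by unfold_locales (simp_all add: d real(2) q_nonzero)
  have rel: "d x \<otimes>\<^bsub>H\<^esub> d y = d (conjugate G x y) \<otimes>\<^bsub>H\<^esub> d x" if "x \<in> X" "y \<in> X" for x y
    using HY.degree_relation[OF that] by simp
  define e where "e = presented_map H d"
  have e: "e \<in> hom GX H" "\<And>x. x \<in> X \<Longrightarrow> e (gx x) = d x"
    unfolding e_def using enveloping_map_hom[OF HY.generator_map_axioms rel]
      enveloping_map_gen[OF HY.generator_map_axioms rel] by blast+
  interpret e: group_hom GX H e by (intro group_hom.intro group_hom_axioms.intro GX.is_group Y.is_group e(1))
  interpret p: group_hom GX G \<pi> by (intro group_hom.intro group_hom_axioms.intro GX.is_group is_group proj_hom)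
  have gen_eq: "yd_act D y z = yd_act DH (d y) z" if "y \<in> X" "z \<in> X" for y z
    using act_generator[OF that] HY.act_degree_generator[OF that] by simp
  have inv_eq: "yd_act D (inv y) z = yd_act DH (inv\<^bsub>H\<^esub> d y) z" if y: "y \<in> X" and z: "z \<in> X" for y z
  proof -
    have yG: "y \<in> carrier G" using y X_closed by blast
    let ?u = "yd_act D (inv y) z"
    have u: "supp ?u \<subseteq> X" using GY.act_keys[OF inv_closed[OF yG] z] by blast
    have "bas z = lin_ext (yd_act D y) ?u" using GY.act_inverse[OF yG z] by simp
    also have "\<dots> = lin_ext (yd_act DH (d y)) ?u"
      by (rule lin_ext_cong) (use gen_eq[OF y] u in blast)
    finally have "lin_ext (yd_act DH (inv\<^bsub>H\<^esub> d y)) (bas z)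
        = lin_ext (yd_act DH (inv\<^bsub>H\<^esub> d y)) (lin_ext (yd_act DH (d y)) ?u)" by simp
    also have "\<dots> = ?u" by (rule Y.act_inverse_lin[OF d(1)[OF y] u])
    finally show ?thesis by simp
  qed
  have act: "\<forall>x\<in>X. yd_act D (\<pi> g) x = yd_act DH (e g) x" if "g \<in> carrier GX" for g
    using that[unfolded GX_eq]
  proof (induction rule: E.generation_induct)
    case one
    have "\<forall>x\<in>X. yd_act D (\<pi> \<one>\<^bsub>GX\<^esub>) x = yd_act DH (e \<one>\<^bsub>GX\<^esub>) x"
      by (simp add: GY.act_one Y.act_one)
    then show ?case by (simp only: GX_eq)
  next
    case (gen y C)
    then have C: "C \<in> carrier GX" by (simp add: GX_eq)
    have "yd_act D (\<pi> (gx y \<otimes>\<^bsub>GX\<^esub> C)) x = yd_act DH (e (gx y \<otimes>\<^bsub>GX\<^esub> C)) x" if x: "x \<in> X" for x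
    proof -
      have yG: "y \<in> carrier G" using gen(1) X_closed by blast
      have "yd_act D (\<pi> (gx y \<otimes>\<^bsub>GX\<^esub> C)) x = lin_ext (yd_act D y) (yd_act D (\<pi> C) x)"
        using GY.act_mult[OF yG proj_closed[OF C] x] C gx.d_closed[OF gen(1)] by (simp add: proj_gx[OF gen(1)])
      also have "\<dots> = lin_ext (yd_act DH (d y)) (yd_act D (\<pi> C) x)"
        by (rule lin_ext_cong) (use gen_eq[OF gen(1)] GY.act_keys[OF proj_closed[OF C] x] in blast)
      also have "\<dots> = lin_ext (yd_act DH (d y)) (yd_act DH (e C) x)" using gen(3) x by simp
      also have "\<dots> = yd_act DH (e (gx y \<otimes>\<^bsub>GX\<^esub> C)) x"
        using Y.act_mult[OF d(1)[OF gen(1)] e.hom_closed[OF C] x] C gx.d_closed[OF gen(1)] by (simp add: e(2)[OF gen(1)])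
      finally show ?thesis .
    qed
    then show ?case by (simp only: GX_eq gx_eq) simp
  next
    case (inv y C)
    then have C: "C \<in> carrier GX" by (simp add: GX_eq)
    have "yd_act D (\<pi> (inv\<^bsub>GX\<^esub> gx y \<otimes>\<^bsub>GX\<^esub> C)) x = yd_act DH (e (inv\<^bsub>GX\<^esub> gx y \<otimes>\<^bsub>GX\<^esub> C)) x" if x: "x \<in> X" for x
    proof -
      have yG: "inv y \<in> carrier G" using inv(1) X_closed by auto
      have dy: "inv\<^bsub>H\<^esub> d y \<in> carrier H" using d(1)[OF inv(1)] by simp
      have "yd_act D (\<pi> (inv\<^bsub>GX\<^esub> gx y \<otimes>\<^bsub>GX\<^esub> C)) x = lin_ext (yd_act D (inv y)) (yd_act D (\<pi> C) x)"
        using GY.act_mult[OF yG proj_closed[OF C] x] C gx.d_closed[OF inv(1)] by (simp add: proj_gx[OF inv(1)])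
      also have "\<dots> = lin_ext (yd_act DH (inv\<^bsub>H\<^esub> d y)) (yd_act D (\<pi> C) x)"
        by (rule lin_ext_cong) (use inv_eq[OF inv(1)] GY.act_keys[OF proj_closed[OF C] x] in blast)
      also have "\<dots> = lin_ext (yd_act DH (inv\<^bsub>H\<^esub> d y)) (yd_act DH (e C) x)" using inv(3) x by simp
      also have "\<dots> = yd_act DH (e (inv\<^bsub>GX\<^esub> gx y \<otimes>\<^bsub>GX\<^esub> C)) x"
        using Y.act_mult[OF dy e.hom_closed[OF C] x] C gx.d_closed[OF inv(1)] by (simp add: e(2)[OF inv(1)])
      finally show ?thesis .
    qed
    then show ?case by (simp only: GX_eq gx_eq) simp
  qed
  interpret yd_change_of_group GX X DX "conjugate G" q c gx H DH d e
    by unfold_locales (use e act in simp_all)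
  have supp: "yd_support X DH = d ` X" unfolding yd_support_def using d(3) by auto
  have 1: "hopf_covering c X GX DX H DH (smash_map e)"
    by (rule hopf_covering_smash_map) (use generate_gx link supp in simp_all)
  have comp: "f (e g) = \<pi> g" if "g \<in> carrier GX" for g
    by (rule hom_eq_on_gx[OF is_group hom_comp[OF e(1) f] proj_hom _ that]) (simp add: e(2) d(2) proj_gx)
  have "smash_map \<pi> a = F (smash_map e a)" if a: "a \<in> bspace (bosonization c X GX DX)" for a
  proof -
    have "F (smash_map e a) = smash_map f (smash_map e a)"
      by (rule hopf_map_eq_smash_map[OF hopf Ff smash_map_closed[OF a]])
    also have "\<dots> = smash_map \<pi> a"
      unfolding smash_map_def lin_ext_lin_ext
      by (rule lin_ext_cong) (use bspace_keys[OF a] comp in auto)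
    finally show ?thesis by simp
  qed
  then show ?thesis using 1 by blast
qed

theorem universal_hopf_covering_proj: "universal_hopf_covering u c X GX DX G D (smash_map \<pi>)"
  unfolding universal_hopf_covering_def using hopf_covering_proj hopf_covering_factor by blast

end

theorem theorem4p1:
  fixes G :: "('g, 'm) monoid_scheme"
    and X :: "'g set"
    and D :: "('g, 'g, 'k::field) yd_struct"
    and c :: "'g \<Rightarrow> 'g \<Rightarrow> ('g \<times> 'g \<Rightarrow>\<^sub>0 'k)"
    and q :: "'g \<Rightarrow> 'g \<Rightarrow> 'k"
  assumes "group G" "X \<subseteq> carrier G" "finite X"
    and "\<forall>g\<in>carrier G. \<forall>x\<in>X. conjugate G g x \<in> X"
    and "generate G X = carrier G"
    and "yetter_drinfeld G X D"
    and "\<forall>x\<in>X. yd_coact D x = bas (x, x)"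
    and "c = yd_braiding D"
    and "\<forall>x\<in>X. \<forall>y\<in>X. q x y \<noteq> 0 \<and> c x y = Poly_Mapping.single (conjugate G x y, x) (q x y)"
    and "full_quadratic_relations G X c"
  shows
    \<comment> \<open>(a)\<close>
    "(\<exists>\<phi>\<in>iso (covering_group X (nichols_paths c X)) (enveloping_group G X).
        \<forall>x\<in>X. \<phi> (covering_gen X (nichols_paths c X) x) = enveloping_gen G X x)
     \<and>
     \<comment> \<open>(b)\<close>
     universal_coalgebra_covering TYPE('v) TYPE('a)
        (degree_quiver (enveloping_group G X) X (enveloping_gen G X))
        (smash_path (enveloping_group G X) X (enveloping_gen G X) `
           bspace (bosonization c X (enveloping_group G X) (enveloping_yd G X D)))
        degree_proj
        (loop_quiver X) (nichols_paths c X)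
     \<and> (\<forall>b\<in>nichols c X. \<forall>g\<in>carrier (enveloping_group G X).
          path_lin degree_proj (smash_path (enveloping_group G X) X (enveloping_gen G X) (smash b g))
            = word_path b)
     \<and>
     \<comment> \<open>(c)\<close>
     enveloping_proj G \<in> epi (enveloping_group G X) G
     \<and> (\<forall>x\<in>X. enveloping_proj G (enveloping_gen G X x) = x)
     \<and> universal_hopf_covering TYPE('h) c X
          (enveloping_group G X) (enveloping_yd G X D) G D
          (smash_map (enveloping_proj G))"
proof -
  interpret rack_yd_module G X D c q
    using assms by (intro rack_yd_module.intro rack_yd_module_axioms.intro) blast+
  have full: "full_quadratic_relations G X c" by fact
  have "path_lin degree_proj (smash_path GX X gx (smash b g)) = word_path b"
    if "b \<in> nichols c X" "g \<in> carrier GX" for b g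
    unfolding smash_path_smash[OF that] degree_proj_def
    by (rule gx.DQ.proj_lift_lin) (use that nichols_keys in auto)
  then show ?thesis
    unfolding smash_path_bosonization
    by (intro conjI ballI covering_group_iso[OF full] proj_epi proj_gx universal_hopf_covering_proj
        universal_coalgebra_covering_degree_quiver[OF full])
qed

end
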